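(* The following groups have no nontrivial left Engel elements (that is, $L(G)=1$ for each such group $G$): (1) the Basilica group $\mathcal{B}=\langle a,b\rangle\leq\operatorname{Aut}\mathcal{T}_2$, where $a=(1,b)$ and $b=(1,a)\sigma$, with $\sigma$ the rooted automorphism corresponding to $(1\,2)$; (2) the Brunner-Sidki-Vieira group $\mathcal{S}=\langle c,d\rangle\leq\operatorname{Aut}\mathcal{T}_2$, where $c=(1,c^{-1})\sigma$ and $d=(1,d)\sigma$, with $\sigma$ the rooted automorphism corresponding to $(1\,2)$; (3) for every odd prime $p$, the GGS-group with constant defining vector $\mathcal{G}=\langle a,b\rangle\leq\operatorname{Aut}\mathcal{T}_p$, where $a$ is the rooted automorphism corresponding to the cycle $(1\,2\,\dots\,p)$ and $b=(a,\overset{p-1}{\dots},a,b)$.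
   Context: Automorphisms act on the right. For a group $G$, $[x,y]=x^{-1}y^{-1}xy$, $[x,_1y]=[x,y]$, $[x,_ny]=[[x,_{n-1}y],y]$ for $n\ge 2$. An element $g\in G$ is left Engel if for every $x\in G$ there is $n=n(g,x)\ge1$ with $[x,_ng]=1$; $L(G)$ denotes the set of left Engel elements of $G$. $\mathcal{T}_d$ is the rooted tree in which every vertex has $d$ children; $\mathrm{st}(1)$ is the subgroup of $\operatorname{Aut}\mathcal{T}_d$ fixing every first-level vertex, and $\psi:\mathrm{st}(1)\to \operatorname{Aut}\mathcal{T}_d\times\overset{d}{\cdots}\times\operatorname{Aut}\mathcal{T}_d$ is the isomorphism sending $g$ to the tuple of its sections at the first-level vertices (its actions on the subtrees hanging from these vertices, each identified with $\mathcal{T}_d$). A rooted automorphism rigidly permutes the $d$ subtrees hanging from the first-level vertices according to a permutation $\sigma\in S_d$, with which it is identified. The notation $(g_1,\dots,g_d)\sigma$ stands for $\psi^{-1}(g_1,\dots,g_d)\cdot\sigma$, and $(g_1,\dots,g_d)$ for $\psi^{-1}(g_1,\dots,g_d)$; conjugation by a rooted automorphism satisfies $\psi(g^\sigma)=(g_{\sigma^{-1}(1)},\dots,g_{\sigma^{-1}(d)})$. The recursive equations define the automorphisms uniquely. (GGS-groups defined by nonzero proportional vectors coincide, so the constant vector is taken to be $(1,\dots,1)$.) *)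

theory Defs
  imports
    "HOL-Algebra.Generated_Groups"
    "HOL-Combinatorics.Cycles"
    "HOL-Computational_Algebra.Primes"
begin

section \<open>Left Engel elements\<close>

definition comm :: "('a, 'b) monoid_scheme \<Rightarrow> 'a \<Rightarrow> 'a \<Rightarrow> 'a"
  where "comm G x y = inv\<^bsub>G\<^esub> x \<otimes>\<^bsub>G\<^esub> inv\<^bsub>G\<^esub> y \<otimes>\<^bsub>G\<^esub> x \<otimes>\<^bsub>G\<^esub> y"

primrec iter_comm :: "('a, 'b) monoid_scheme \<Rightarrow> 'a \<Rightarrow> nat \<Rightarrow> 'a \<Rightarrow> 'a" where
  "iter_comm G x 0 y = x"
| "iter_comm G x (Suc n) y = comm G (iter_comm G x n y) y"

definition left_engel :: "('a, 'b) monoid_scheme \<Rightarrow> 'a set"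
  where "left_engel G =
    {g \<in> carrier G. \<forall>x\<in>carrier G. \<exists>n\<ge>1. iter_comm G x n g = \<one>\<^bsub>G\<^esub>}"


section \<open>Automorphisms of the regular rooted tree\<close>

text \<open>The vertices of the \<open>d\<close>-ary rooted tree are the words over \<open>{1..d}\<close>; the root is the
  empty word and the children of \<open>v\<close> are the words \<open>v @ [x]\<close>.\<close>

definition vertices :: "nat \<Rightarrow> nat list set"
  where "vertices d = lists {1..d}"

definition adjacent :: "nat list \<Rightarrow> nat list \<Rightarrow> bool"
  where "adjacent u v \<longleftrightarrow> (\<exists>x. v = u @ [x] \<or> u = v @ [x])"

text \<open>Automorphisms act on the right, so \<open>f \<otimes> g\<close> is ``first \<open>f\<close>, then \<open>g\<close>''. They are
  represented as functions that are the identity on words that are not vertices.\<close>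

definition Aut_tree :: "nat \<Rightarrow> (nat list \<Rightarrow> nat list) monoid"
  where "Aut_tree d =
    \<lparr>carrier = {f. f permutes vertices d \<and> f [] = [] \<and>
                 (\<forall>u\<in>vertices d. \<forall>v\<in>vertices d. adjacent (f u) (f v) \<longleftrightarrow> adjacent u v)},
     monoid.mult = (\<lambda>f g. g \<circ> f),
     one = id\<rparr>"

definition tree_section :: "nat \<Rightarrow> nat list \<Rightarrow> (nat list \<Rightarrow> nat list) \<Rightarrow> nat list \<Rightarrow> nat list"
  where "tree_section d u g =
    (\<lambda>w. if w \<in> vertices d then drop (length u) (g (u @ w)) else w)"

definition st1 :: "nat \<Rightarrow> (nat list \<Rightarrow> nat list) set"
  where "st1 d = {g \<in> carrier (Aut_tree d). \<forall>x\<in>{1..d}. g [x] = [x]}"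

definition psi :: "nat \<Rightarrow> (nat list \<Rightarrow> nat list) \<Rightarrow> (nat list \<Rightarrow> nat list) list"
  where "psi d g = map (\<lambda>x. tree_section d [x] g) [1..<Suc d]"

definition from_sections :: "nat \<Rightarrow> (nat list \<Rightarrow> nat list) list \<Rightarrow> nat list \<Rightarrow> nat list"
  where "from_sections d = inv_into (st1 d) (psi d)"

definition rooted :: "nat \<Rightarrow> (nat \<Rightarrow> nat) \<Rightarrow> nat list \<Rightarrow> nat list"
  where "rooted d \<sigma> v = (if v \<in> vertices d \<and> v \<noteq> [] then \<sigma> (hd v) # tl v else v)"


section \<open>Defining equations of the generators\<close>

definition basilica_generators ::
    "(nat list \<Rightarrow> nat list) \<Rightarrow> (nat list \<Rightarrow> nat list) \<Rightarrow> bool"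
  where "basilica_generators a b \<longleftrightarrow>
    a \<in> carrier (Aut_tree 2) \<and> b \<in> carrier (Aut_tree 2) \<and>
    a = from_sections 2 [\<one>\<^bsub>Aut_tree 2\<^esub>, b] \<and>
    b = from_sections 2 [\<one>\<^bsub>Aut_tree 2\<^esub>, a] \<otimes>\<^bsub>Aut_tree 2\<^esub> rooted 2 (transpose 1 2)"

definition bsv_generators ::
    "(nat list \<Rightarrow> nat list) \<Rightarrow> (nat list \<Rightarrow> nat list) \<Rightarrow> bool"
  where "bsv_generators c d \<longleftrightarrow>
    c \<in> carrier (Aut_tree 2) \<and> d \<in> carrier (Aut_tree 2) \<and>
    c = from_sections 2 [\<one>\<^bsub>Aut_tree 2\<^esub>, inv\<^bsub>Aut_tree 2\<^esub> c] \<otimes>\<^bsub>Aut_tree 2\<^esub> rooted 2 (transpose 1 2) \<and>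
    d = from_sections 2 [\<one>\<^bsub>Aut_tree 2\<^esub>, d] \<otimes>\<^bsub>Aut_tree 2\<^esub> rooted 2 (transpose 1 2)"

definition ggs_constant_generators ::
    "nat \<Rightarrow> (nat list \<Rightarrow> nat list) \<Rightarrow> (nat list \<Rightarrow> nat list) \<Rightarrow> bool"
  where "ggs_constant_generators p a b \<longleftrightarrow>
    a \<in> carrier (Aut_tree p) \<and> b \<in> carrier (Aut_tree p) \<and>
    a = rooted p (cycle_of_list [1..<Suc p]) \<and>
    b = from_sections p (replicate (p - 1) a @ [b])"


section \<open>The conventions are consistent\<close>

lemma vertices_simps [simp]:
  "[] \<in> vertices d"
  "x # w \<in> vertices d \<longleftrightarrow> x \<in> {1..d} \<and> w \<in> vertices d"
  "u @ w \<in> vertices d \<longleftrightarrow> u \<in> vertices d \<and> w \<in> vertices d"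
  by (auto simp: vertices_def)

lemma adjacent_simps [simp]:
  "adjacent (u @ v) (u @ w) \<longleftrightarrow> adjacent v w"
  "adjacent [] v \<longleftrightarrow> (\<exists>x. v = [x])"
  "adjacent v [] \<longleftrightarrow> (\<exists>x. v = [x])"
  by (auto simp: adjacent_def)

lemma adjacent_Cons [simp]:
  "adjacent (x # v) (y # w) \<longleftrightarrow>
     x = y \<and> adjacent v w"
  by (auto simp: adjacent_def)

lemma Aut_tree_simps [simp]:
  "f \<otimes>\<^bsub>Aut_tree d\<^esub> g = g \<circ> f" "\<one>\<^bsub>Aut_tree d\<^esub> = id"
  by (simp_all add: Aut_tree_def)

lemma Aut_tree_iff:
  "f \<in> carrier (Aut_tree d) \<longleftrightarrow> f permutes vertices d \<and> f [] = [] \<and>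
     (\<forall>u\<in>vertices d. \<forall>v\<in>vertices d. adjacent (f u) (f v) \<longleftrightarrow> adjacent u v)"
  by (simp add: Aut_tree_def)

lemma inv_fun_Aut_tree:
  assumes "f \<in> carrier (Aut_tree d)"
  shows "Hilbert_Choice.inv f \<in> carrier (Aut_tree d)"
proof -
  have p: "f permutes vertices d" and r: "f [] = []"
    and a: "\<And>u v. u \<in> vertices d \<Longrightarrow> v \<in> vertices d \<Longrightarrow> adjacent (f u) (f v) \<longleftrightarrow> adjacent u v"
    using assms by (auto simp: Aut_tree_iff)
  have "Hilbert_Choice.inv f permutes vertices d"
    using p by (rule permutes_inv)
  moreover from this have "Hilbert_Choice.inv f u \<in> vertices d" if "u \<in> vertices d" for u
    using that by (simp add: permutes_in_image)
  ultimately show ?thesis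
    using a r permutes_inverses[OF p] by (auto simp: Aut_tree_iff) (metis+)
qed

lemma group_Aut_tree: "group (Aut_tree d)"
proof (rule groupI)
  fix f g assume "f \<in> carrier (Aut_tree d)" "g \<in> carrier (Aut_tree d)"
  then show "f \<otimes>\<^bsub>Aut_tree d\<^esub> g \<in> carrier (Aut_tree d)"
    by (auto simp: Aut_tree_iff permutes_compose permutes_in_image)
next
  show "\<one>\<^bsub>Aut_tree d\<^esub> \<in> carrier (Aut_tree d)"
    by (auto simp: Aut_tree_iff permutes_id)
next
  fix f assume f: "f \<in> carrier (Aut_tree d)"
  then have "f \<circ> Hilbert_Choice.inv f = id"
    using permutes_inv_o(1) Aut_tree_iff by metis
  then show "\<exists>g\<in>carrier (Aut_tree d). g \<otimes>\<^bsub>Aut_tree d\<^esub> f = \<one>\<^bsub>Aut_tree d\<^esub>"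
    using inv_fun_Aut_tree[OF f] by auto
qed (auto simp: o_assoc)

lemma inv_Aut_tree:
  assumes f: "f \<in> carrier (Aut_tree d)"
  shows "inv\<^bsub>Aut_tree d\<^esub> f = Hilbert_Choice.inv f"
proof (rule group.inv_equality[OF group_Aut_tree _ f inv_fun_Aut_tree[OF f]])
  show "Hilbert_Choice.inv f \<otimes>\<^bsub>Aut_tree d\<^esub> f = \<one>\<^bsub>Aut_tree d\<^esub>"
    using permutes_inv_o(1) f Aut_tree_iff Aut_tree_simps by metis
qed

lemma Aut_tree_snoc:
  assumes f: "f \<in> carrier (Aut_tree d)" and "u @ [x] \<in> vertices d"
  shows "\<exists>y\<in>{1..d}. f (u @ [x]) = f u @ [y]"
  using assms(2)
proof (induction u arbitrary: x rule: rev_induct)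
  case Nil
  have "f [x] \<in> vertices d" "f [] = []"
    using f Nil permutes_in_image[of f "vertices d" "[x]"] by (auto simp: Aut_tree_iff)
  moreover have "adjacent (f []) (f [x]) \<longleftrightarrow> adjacent [] [x]"
    using f Nil unfolding Aut_tree_iff by (metis append_Nil vertices_simps(1))
  ultimately show ?case by auto
next
  case (snoc z u)
  obtain y where y: "f (u @ [z]) = f u @ [y]" using snoc by auto
  have *: "f ((u @ [z]) @ [x]) \<in> vertices d"
    using f snoc.prems by (simp add: Aut_tree_iff permutes_in_image)
  have "adjacent (f (u @ [z])) (f ((u @ [z]) @ [x])) \<longleftrightarrow> adjacent (u @ [z]) ((u @ [z]) @ [x])"
    using f snoc.prems unfolding Aut_tree_iff by (metis vertices_simps(3))
  then have "adjacent (f (u @ [z])) (f ((u @ [z]) @ [x]))"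
    unfolding adjacent_def by blast
  moreover have "f (u @ [z]) \<noteq> f ((u @ [z]) @ [x]) @ [t]" for t
  proof
    assume "f (u @ [z]) = f ((u @ [z]) @ [x]) @ [t]"
    then have "f u = f ((u @ [z]) @ [x])" using y by simp
    moreover have "inj f" using f Aut_tree_iff permutes_inj by blast
    ultimately have "u = (u @ [z]) @ [x]" by (metis injD)
    then show False by simp
  qed
  ultimately obtain t where "f ((u @ [z]) @ [x]) = f (u @ [z]) @ [t]"
    unfolding adjacent_def by auto
  then show ?case using * by auto
qed

lemma Aut_tree_length:
  assumes "f \<in> carrier (Aut_tree d)" "u \<in> vertices d"
  shows "length (f u) = length u"
  using assms(2)
proof (induction u rule: rev_induct)
  case Nil
  then show ?case using assms by (simp add: Aut_tree_iff)
next
  case (snoc x u)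
  then show ?case using Aut_tree_snoc[OF assms(1), of u x] by auto
qed

lemma Aut_tree_append:
  assumes f: "f \<in> carrier (Aut_tree d)" and "u \<in> vertices d" "w \<in> vertices d"
  shows "f (u @ w) = f u @ tree_section d u f w"
proof -
  have "\<exists>t. f (u @ w) = f u @ t"
    using assms(3)
  proof (induction w rule: rev_induct)
    case (snoc x w)
    then show ?case using Aut_tree_snoc[OF f, of "u @ w" x] assms(2) by auto
  qed simp
  then show ?thesis
    using Aut_tree_length[OF f assms(2)] assms(3) by (auto simp: tree_section_def)
qed

lemma tree_section_Aut_tree:
  assumes f: "f \<in> carrier (Aut_tree d)" and u: "u \<in> vertices d"
  shows "tree_section d u f \<in> carrier (Aut_tree d)"
proof -
  let ?s = "tree_section d u f"
  have app: "f (u @ w) = f u @ ?s w" if "w \<in> vertices d" for w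
    using Aut_tree_append[OF f u that] .
  have p: "f permutes vertices d" using f by (simp add: Aut_tree_iff)
  have mem: "?s w \<in> vertices d" if "w \<in> vertices d" for w
    using app[OF that] permutes_in_image[OF p, of "u @ w"] u that by auto
  have "bij_betw ?s (vertices d) (vertices d)"
  proof (rule bij_betw_imageI)
    show "inj_on ?s (vertices d)"
      using app permutes_inj[OF p] by (intro inj_onI) (metis injD same_append_eq)
    have "w \<in> ?s ` vertices d" if w: "w \<in> vertices d" for w
    proof -
      let ?g = "Hilbert_Choice.inv f"
      note g = inv_fun_Aut_tree[OF f]
      have fu: "f u \<in> vertices d" using p u by (simp add: permutes_in_image)
      have "?g (f u @ w) = u @ tree_section d (f u) ?g w"
        using Aut_tree_append[OF g fu w] permutes_inverses[OF p] by simp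
      moreover from this have "tree_section d (f u) ?g w \<in> vertices d"
        using permutes_in_image[OF permutes_inv[OF p], of "f u @ w"] fu w by simp
      ultimately show ?thesis
        by (metis app imageI permutes_inverses(1)[OF p] same_append_eq)
    qed
    then show "?s ` vertices d = vertices d" using mem by blast
  qed
  then have "?s permutes vertices d"
    by (rule bij_imp_permutes) (simp add: tree_section_def)
  moreover have "?s [] = []"
    using app[of "[]"] by simp
  moreover have "adjacent (?s v) (?s w) \<longleftrightarrow> adjacent v w"
    if "v \<in> vertices d" "w \<in> vertices d" for v w
  proof -
    have "adjacent (f (u @ v)) (f (u @ w)) \<longleftrightarrow> adjacent (u @ v) (u @ w)"
      using f that u unfolding Aut_tree_iff by (metis vertices_simps(3))
    then show ?thesis using app that by simp
  qed
  ultimately show ?thesis by (simp add: Aut_tree_iff)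
qed

lemma Aut_tree_coinduct:
  assumes "f \<in> A"
    and step: "\<And>f. f \<in> A \<Longrightarrow> f [] = [] \<and> (\<forall>v. v \<notin> vertices d \<longrightarrow> f v = v) \<and>
      (\<exists>\<pi> F. \<pi> permutes {1..d} \<and> (\<forall>x\<in>{1..d}. F x \<in> A \<and>
         (\<forall>w\<in>vertices d. f (x # w) = \<pi> x # F x w)))"
  shows "f \<in> carrier (Aut_tree d)"
proof -
  have Nil: "f [] = []" and out: "v \<notin> vertices d \<Longrightarrow> f v = v" if "f \<in> A" for f v
    using step[OF that] by auto
  have dec: "\<exists>\<pi> F. \<pi> permutes {1..d} \<and> (\<forall>x\<in>{1..d}. F x \<in> A \<and>
         (\<forall>w\<in>vertices d. f (x # w) = \<pi> x # F x w))" if "f \<in> A" for f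
    using step[OF that] by auto
  have mem: "f v \<in> vertices d" if "f \<in> A" "v \<in> vertices d" for f v
    using that
  proof (induction v arbitrary: f)
    case (Cons x v)
    obtain \<pi> F where p: "\<pi> permutes {1..d}"
      and F: "\<And>x. x \<in> {1..d} \<Longrightarrow> F x \<in> A"
      and e: "\<And>x w. x \<in> {1..d} \<Longrightarrow> w \<in> vertices d \<Longrightarrow> f (x # w) = \<pi> x # F x w"
      using dec[OF Cons.prems(1)] by blast
    have x: "x \<in> {1..d}" "v \<in> vertices d" using Cons.prems by auto
    show ?case
      using Cons.IH[OF F[OF x(1)] x(2)] e[OF x] permutes_in_image[OF p, of x] x by simp
  qed (simp add: Nil)
  have inj: "u = v" if "f \<in> A" "u \<in> vertices d" "v \<in> vertices d" "f u = f v" for f u v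
    using that
  proof (induction u arbitrary: f v)
    case Nil
    then show ?case using dec[OF Nil.prems(1)] step[OF Nil.prems(1)] by (cases v) force+
  next
    case (Cons x u)
    obtain \<pi> F where p: "\<pi> permutes {1..d}"
      and F: "\<And>x. x \<in> {1..d} \<Longrightarrow> F x \<in> A"
      and e: "\<And>x w. x \<in> {1..d} \<Longrightarrow> w \<in> vertices d \<Longrightarrow> f (x # w) = \<pi> x # F x w"
      using dec[OF Cons.prems(1)] by blast
    have x: "x \<in> {1..d}" "u \<in> vertices d" using Cons.prems by auto
    have "f (x # u) \<noteq> []" "f [] = []" using e[OF x] step[OF Cons.prems(1)] by auto
    then obtain y w where v: "v = y # w" using Cons.prems(4) by (cases v) auto
    then have y: "y \<in> {1..d}" "w \<in> vertices d" using Cons.prems by auto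
    have "\<pi> x # F x u = \<pi> y # F y w" using Cons.prems(4) e[OF x] e[OF y] v by simp
    then have "x = y" "F x u = F x w" using permutes_inj[OF p] by (auto dest: injD)
    then show ?case using Cons.IH[OF F[OF x(1)] x(2) y(2)] v by simp
  qed
  have surj: "\<exists>u\<in>vertices d. f u = v" if "f \<in> A" "v \<in> vertices d" for f v
    using that
  proof (induction v arbitrary: f)
    case Nil
    then show ?case using step[OF Nil.prems(1)] by (intro bexI[of _ "[]"]) auto
  next
    case (Cons y v)
    obtain \<pi> F where p: "\<pi> permutes {1..d}"
      and F: "\<And>x. x \<in> {1..d} \<Longrightarrow> F x \<in> A"
      and e: "\<And>x w. x \<in> {1..d} \<Longrightarrow> w \<in> vertices d \<Longrightarrow> f (x # w) = \<pi> x # F x w"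
      using dec[OF Cons.prems(1)] by blast
    have y: "y \<in> {1..d}" "v \<in> vertices d" using Cons.prems by auto
    obtain x where x: "x \<in> {1..d}" "\<pi> x = y"
      using permutes_image[OF p] y(1) by (metis imageE)
    obtain u where "u \<in> vertices d" "F x u = v"
      using Cons.IH[OF F[OF x(1)] y(2)] by blast
    then show ?case using e[OF x(1)] x by (intro bexI[of _ "x # u"]) auto
  qed
  have adj: "adjacent (f u) (f v) \<longleftrightarrow> adjacent u v"
    if "f \<in> A" "u \<in> vertices d" "v \<in> vertices d" for f u v
    using that
  proof (induction u arbitrary: f v)
    case Nil
    show ?case
    proof (cases v)
      case (Cons y w)
      obtain \<pi> F where F: "\<And>x. x \<in> {1..d} \<Longrightarrow> F x \<in> A"
        and e: "\<And>x w. x \<in> {1..d} \<Longrightarrow> w \<in> vertices d \<Longrightarrow> f (x # w) = \<pi> x # F x w"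
        using dec[OF Nil.prems(1)] by blast
      have y: "y \<in> {1..d}" "w \<in> vertices d" using Nil.prems Cons by auto
      have "F y w = [] \<longleftrightarrow> w = []"
        using inj[OF F[OF y(1)] y(2), of "[]"] step[OF F[OF y(1)]] by auto
      then show ?thesis using Cons e[OF y] step[OF Nil.prems(1)] by simp
    qed (use Nil step[OF Nil.prems(1)] in simp)
  next
    case (Cons x u)
    obtain \<pi> F where p: "\<pi> permutes {1..d}"
      and F: "\<And>x. x \<in> {1..d} \<Longrightarrow> F x \<in> A"
      and e: "\<And>x w. x \<in> {1..d} \<Longrightarrow> w \<in> vertices d \<Longrightarrow> f (x # w) = \<pi> x # F x w"
      using dec[OF Cons.prems(1)] by blast
    have x: "x \<in> {1..d}" "u \<in> vertices d" using Cons.prems by auto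
    show ?case
    proof (cases v)
      case Nil
      have "F x u = [] \<longleftrightarrow> u = []"
        using inj[OF F[OF x(1)] x(2), of "[]"] step[OF F[OF x(1)]] by auto
      then show ?thesis using Nil e[OF x] step[OF Cons.prems(1)] by simp
    next
      case v: (Cons y w)
      then have y: "y \<in> {1..d}" "w \<in> vertices d" using Cons.prems by auto
      have "\<pi> x = \<pi> y \<longleftrightarrow> x = y" using permutes_inj[OF p] by (auto dest: injD)
      then show ?thesis
        using Cons.IH[OF F[OF x(1)] x(2) y(2)] e[OF x] e[OF y] v by auto
    qed
  qed
  have "bij_betw f (vertices d) (vertices d)"
  proof (rule bij_betw_imageI)
    show "inj_on f (vertices d)" using inj[OF assms(1)] by (auto intro: inj_onI)
    show "f ` vertices d = vertices d" using mem[OF assms(1)] surj[OF assms(1)] by force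
  qed
  then have "f permutes vertices d"
    using step[OF assms(1)] by (auto intro: bij_imp_permutes)
  then show ?thesis
    using step[OF assms(1)] adj[OF assms(1)] by (simp add: Aut_tree_iff)
qed

lemma Aut_tree_decomp:
  assumes f: "f \<in> carrier (Aut_tree d)"
  shows "\<exists>\<pi>. \<pi> permutes {1..d} \<and>
           (\<forall>x\<in>{1..d}. \<forall>w\<in>vertices d. f (x # w) = \<pi> x # tree_section d [x] f w)"
proof -
  define \<pi> where "\<pi> x = (if x \<in> {1..d} then hd (f [x]) else x)" for x
  have p: "f permutes vertices d" using f by (simp add: Aut_tree_iff)
  have fx: "f [x] = [\<pi> x]" "\<pi> x \<in> {1..d}" if "x \<in> {1..d}" for x
  proof -
    have "\<exists>y\<in>{1..d}. f ([] @ [x]) = f [] @ [y]"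
      using that by (intro Aut_tree_snoc[OF f]) simp
    moreover have "f [] = []" using f by (simp add: Aut_tree_iff)
    ultimately obtain y where "y \<in> {1..d}" "f [x] = [y]" by auto
    then show "f [x] = [\<pi> x]" "\<pi> x \<in> {1..d}" using that by (auto simp: \<pi>_def)
  qed
  have "inj_on \<pi> {1..d}"
  proof (rule inj_onI)
    fix x y assume "x \<in> {1..d}" "y \<in> {1..d}" "\<pi> x = \<pi> y"
    then have "f [x] = f [y]" using fx(1) by metis
    then show "x = y" using permutes_inj[OF p] by (auto dest: injD)
  qed
  moreover have "\<pi> ` {1..d} \<subseteq> {1..d}" using fx(2) by blast
  ultimately have "bij_betw \<pi> {1..d} {1..d}"
    by (simp add: bij_betw_def endo_inj_surj)
  then have "\<pi> permutes {1..d}"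
    by (rule bij_imp_permutes) (auto simp: \<pi>_def)
  moreover have "f (x # w) = \<pi> x # tree_section d [x] f w"
    if "x \<in> {1..d}" "w \<in> vertices d" for x w
    using Aut_tree_append[OF f, of "[x]" w] that fx(1)[of x] by simp
  ultimately show ?thesis by blast
qed

lemma Aut_tree_outside:
  "f \<in> carrier (Aut_tree d) \<Longrightarrow> v \<notin> vertices d \<Longrightarrow> f v = v"
  by (auto simp: Aut_tree_iff permutes_def)

lemma Aut_tree_step:
  assumes f: "f \<in> carrier (Aut_tree d)" and sub: "carrier (Aut_tree d) \<subseteq> A"
  shows "f [] = [] \<and> (\<forall>v. v \<notin> vertices d \<longrightarrow> f v = v) \<and>
      (\<exists>\<pi> F. \<pi> permutes {1..d} \<and> (\<forall>x\<in>{1..d}. F x \<in> A \<and>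
         (\<forall>w\<in>vertices d. f (x # w) = \<pi> x # F x w)))"
proof -
  obtain \<pi> where "\<pi> permutes {1..d}"
    "\<forall>x\<in>{1..d}. \<forall>w\<in>vertices d. f (x # w) = \<pi> x # tree_section d [x] f w"
    using Aut_tree_decomp[OF f] by blast
  moreover have "tree_section d [x] f \<in> A" if "x \<in> {1..d}" for x
    using tree_section_Aut_tree[OF f, of "[x]"] that sub by auto
  moreover have "f [] = []" using f by (simp add: Aut_tree_iff)
  ultimately show ?thesis
    using Aut_tree_outside[OF f]
    by (intro conjI allI impI exI[of _ \<pi>] exI[of _ "\<lambda>x. tree_section d [x] f"] ballI) auto
qed

lemma rooted_simps [simp]:
  "rooted d \<sigma> [] = []"
  "v \<notin> vertices d \<Longrightarrow> rooted d \<sigma> v = v"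
  "x # w \<in> vertices d \<Longrightarrow> rooted d \<sigma> (x # w) = \<sigma> x # w"
  by (auto simp: rooted_def)

lemma id_Aut_tree: "id \<in> carrier (Aut_tree d)"
  using group.is_monoid[OF group_Aut_tree, THEN monoid.one_closed, of d] by simp

lemma rooted_Aut_tree:
  assumes "\<sigma> permutes {1..d}"
  shows "rooted d \<sigma> \<in> carrier (Aut_tree d)"
proof (rule Aut_tree_coinduct[of _ "insert (rooted d \<sigma>) (carrier (Aut_tree d))"])
  let ?A = "insert (rooted d \<sigma>) (carrier (Aut_tree d))"
  fix f assume "f \<in> ?A"
  then consider "f = rooted d \<sigma>" | "f \<in> carrier (Aut_tree d)" by blast
  then show "f [] = [] \<and> (\<forall>v. v \<notin> vertices d \<longrightarrow> f v = v) \<and>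
      (\<exists>\<pi> F. \<pi> permutes {1..d} \<and> (\<forall>x\<in>{1..d}. F x \<in> ?A \<and>
         (\<forall>w\<in>vertices d. f (x # w) = \<pi> x # F x w)))"
  proof cases
    case 1
    then show ?thesis using assms id_Aut_tree
      by (intro conjI exI[of _ \<sigma>] exI[of _ "\<lambda>_. id"]) auto
  next
    case 2
    then show ?thesis by (rule Aut_tree_step) blast
  qed
qed simp

text \<open>\<open>psi\<close> is a bijection from \<open>st1 d\<close> onto the \<open>d\<close>-tuples of automorphisms, and its inverse
  \<open>from_sections d\<close> is computed as follows.\<close>

definition spine :: "nat \<Rightarrow> (nat list \<Rightarrow> nat list) list \<Rightarrow> nat list \<Rightarrow> nat list"
  where "spine d gs v =
    (if v \<in> vertices d \<and> v \<noteq> [] then hd v # (gs ! (hd v - 1)) (tl v) else v)"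

lemma spine_simps [simp]:
  "spine d gs [] = []"
  "v \<notin> vertices d \<Longrightarrow> spine d gs v = v"
  "x # w \<in> vertices d \<Longrightarrow> spine d gs (x # w) = x # (gs ! (x - 1)) w"
  by (auto simp: spine_def)

lemma spine_st1:
  assumes "length gs = d" "set gs \<subseteq> carrier (Aut_tree d)"
  shows "spine d gs \<in> st1 d"
proof -
  let ?A = "insert (spine d gs) (carrier (Aut_tree d))"
  have gs: "gs ! (x - 1) \<in> carrier (Aut_tree d)" if "x \<in> {1..d}" for x
    using that assms nth_mem[of "x - 1" gs] by fastforce
  have "spine d gs \<in> carrier (Aut_tree d)"
  proof (rule Aut_tree_coinduct[of _ ?A])
    fix f assume "f \<in> ?A"
    then consider "f = spine d gs" | "f \<in> carrier (Aut_tree d)" by blast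
    then show "f [] = [] \<and> (\<forall>v. v \<notin> vertices d \<longrightarrow> f v = v) \<and>
        (\<exists>\<pi> F. \<pi> permutes {1..d} \<and> (\<forall>x\<in>{1..d}. F x \<in> ?A \<and>
           (\<forall>w\<in>vertices d. f (x # w) = \<pi> x # F x w)))"
    proof cases
      case 1
      then show ?thesis using gs
        by (intro conjI exI[of _ id] exI[of _ "\<lambda>x. gs ! (x - 1)"]) (auto simp: permutes_id)
    next
      case 2
      then show ?thesis by (rule Aut_tree_step) blast
    qed
  qed simp
  moreover have "spine d gs [x] = [x]" if "x \<in> {1..d}" for x
    using gs[OF that] that by (simp add: Aut_tree_iff)
  ultimately show ?thesis by (simp add: st1_def)
qed

lemma psi_spine:
  assumes "length gs = d" "set gs \<subseteq> carrier (Aut_tree d)"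
  shows "psi d (spine d gs) = gs"
proof (rule nth_equalityI)
  show "length (psi d (spine d gs)) = length gs"
    using assms by (simp add: psi_def)
  fix i assume "i < length (psi d (spine d gs))"
  then have i: "i < d" by (simp add: psi_def del: upt_Suc)
  then have "gs ! i \<in> carrier (Aut_tree d)" using assms by auto
  from Aut_tree_outside[OF this] have "tree_section d [Suc i] (spine d gs) = gs ! i"
    using i by (auto simp: tree_section_def fun_eq_iff)
  then show "psi d (spine d gs) ! i = gs ! i"
    using i by (simp add: psi_def nth_append del: upt_Suc)
qed

lemma st1_eqI:
  assumes f: "f \<in> st1 d" and g: "g \<in> st1 d" and e: "psi d f = psi d g"
  shows "f = g"
proof
  fix v
  show "f v = g v"
  proof (cases "v \<in> vertices d \<and> v \<noteq> []")
    case True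
    then obtain x w where v: "v = x # w" and x: "x \<in> {1..d}" "w \<in> vertices d"
      by (cases v) auto
    have "tree_section d [x] f = tree_section d [x] g"
      using e x(1) by (auto simp: psi_def simp del: upt_Suc)
    then show ?thesis
      using Aut_tree_append[of f d "[x]" w] Aut_tree_append[of g d "[x]" w] f g v x
      by (auto simp: st1_def)
  next
    case False
    moreover have "f \<in> carrier (Aut_tree d)" "g \<in> carrier (Aut_tree d)" "f [] = g []"
      using f g by (simp_all add: st1_def Aut_tree_iff)
    ultimately show ?thesis by (cases "v = []") (simp_all add: Aut_tree_outside)
  qed
qed

lemma bij_betw_psi:
  "bij_betw (psi d) (st1 d) {gs. length gs = d \<and> set gs \<subseteq> carrier (Aut_tree d)}"
proof (rule bij_betw_imageI)
  show "inj_on (psi d) (st1 d)" using st1_eqI by (auto intro: inj_onI)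
  have "psi d g \<in> {gs. length gs = d \<and> set gs \<subseteq> carrier (Aut_tree d)}" if "g \<in> st1 d" for g
    using that tree_section_Aut_tree[of g d] by (auto simp: psi_def st1_def simp del: upt_Suc)
  moreover have "gs \<in> psi d ` st1 d" if "length gs = d" "set gs \<subseteq> carrier (Aut_tree d)" for gs
    using psi_spine[OF that] spine_st1[OF that] by (rule rev_image_eqI[OF _ sym, rotated])
  ultimately show "psi d ` st1 d = {gs. length gs = d \<and> set gs \<subseteq> carrier (Aut_tree d)}"
    by blast
qed

lemma from_sections_eq:
  assumes "length gs = d" "set gs \<subseteq> carrier (Aut_tree d)"
  shows "from_sections d gs = spine d gs"
  unfolding from_sections_def
  using bij_betw_psi psi_spine[OF assms] spine_st1[OF assms]
  by (auto simp: bij_betw_def intro: inv_into_f_eq)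

lemma psi_conj_rooted:
  assumes s: "\<sigma> permutes {1..d}" and g: "g \<in> st1 d" and x: "x \<in> {1..d}"
  shows "tree_section d [x]
           (inv\<^bsub>Aut_tree d\<^esub> rooted d \<sigma> \<otimes>\<^bsub>Aut_tree d\<^esub> g \<otimes>\<^bsub>Aut_tree d\<^esub> rooted d \<sigma>) =
         tree_section d [Hilbert_Choice.inv \<sigma> x] g"
proof
  fix w
  let ?y = "Hilbert_Choice.inv \<sigma> x"
  have y: "?y \<in> {1..d}" "\<sigma> ?y = x"
    using permutes_in_image[OF permutes_inv[OF s], of x] permutes_inverses[OF s] x by auto
  note r = rooted_Aut_tree[OF s]
  show "tree_section d [x]
           (inv\<^bsub>Aut_tree d\<^esub> rooted d \<sigma> \<otimes>\<^bsub>Aut_tree d\<^esub> g \<otimes>\<^bsub>Aut_tree d\<^esub> rooted d \<sigma>) w =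
         tree_section d [?y] g w"
  proof (cases "w \<in> vertices d")
    case w: True
    have "rooted d \<sigma> permutes vertices d" using r by (simp add: Aut_tree_iff)
    then have "Hilbert_Choice.inv (rooted d \<sigma>) (x # w) = ?y # w"
      using y w by (simp add: permutes_inverses permutes_inv_eq)
    moreover have "g (?y # w) = ?y # tree_section d [?y] g w"
      using Aut_tree_append[of g d "[?y]" w] g y w by (simp add: st1_def)
    moreover have "tree_section d [?y] g w \<in> vertices d"
      using tree_section_Aut_tree[of g d "[?y]"] g y w
      by (simp add: st1_def Aut_tree_iff permutes_in_image)
    ultimately have "(inv\<^bsub>Aut_tree d\<^esub> rooted d \<sigma> \<otimes>\<^bsub>Aut_tree d\<^esub> g \<otimes>\<^bsub>Aut_tree d\<^esub> rooted d \<sigma>) (x # w) =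
        x # tree_section d [?y] g w"
      using y w inv_Aut_tree[OF r] by simp
    then show ?thesis
      using w by (simp add: tree_section_def[of d "[x]"])
  qed (simp add: tree_section_def)
qed

lemma cycle_of_list_upt:
  assumes "x \<in> {1..p}"
  shows "cycle_of_list [1..<Suc p] x = (if x = p then 1 else x + 1)"
proof -
  have "map (cycle_of_list [1..<Suc p]) [1..<Suc p] ! (x - 1) = rotate1 [1..<Suc p] ! (x - 1)"
    using cyclic_rotation[of "[1..<Suc p]" 1] by (simp del: upt_Suc)
  then show ?thesis using assms
    by (auto simp: nth_rotate1 simp del: upt_Suc)
qed

lemma transpose_1_2_permutes: "transpose 1 2 permutes {1..2::nat}"
  by (rule permutes_swap_id) auto

text \<open>The recursive equations have exactly one solution. For existence, the solutions are
  computed by transducers with output functions \<open>out\<close> and transition functions \<open>nxt\<close>.\<close>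

primrec run :: "(nat \<Rightarrow> nat \<Rightarrow> nat) \<Rightarrow> (nat \<Rightarrow> nat \<Rightarrow> nat) \<Rightarrow> nat list \<Rightarrow> nat \<Rightarrow> nat list" where
  "run out nxt [] s = []"
| "run out nxt (x # w) s = out s x # run out nxt w (nxt s x)"

definition transducer ::
    "nat \<Rightarrow> (nat \<Rightarrow> nat \<Rightarrow> nat) \<Rightarrow> (nat \<Rightarrow> nat \<Rightarrow> nat) \<Rightarrow> nat \<Rightarrow> nat list \<Rightarrow> nat list"
  where "transducer d out nxt s v = (if v \<in> vertices d then run out nxt v s else v)"

lemma transducer_simps [simp]:
  "transducer d out nxt s [] = []"
  "v \<notin> vertices d \<Longrightarrow> transducer d out nxt s v = v"
  "x # w \<in> vertices d \<Longrightarrow>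
     transducer d out nxt s (x # w) = out s x # transducer d out nxt (nxt s x) w"
  by (auto simp: transducer_def)

lemma transducer_Aut_tree:
  assumes "\<And>s. out s permutes {1..d}"
  shows "transducer d out nxt s \<in> carrier (Aut_tree d)"
proof (rule Aut_tree_coinduct[of _ "range (transducer d out nxt)"])
  fix f assume "f \<in> range (transducer d out nxt)"
  then obtain t where "f = transducer d out nxt t" by blast
  then show "f [] = [] \<and> (\<forall>v. v \<notin> vertices d \<longrightarrow> f v = v) \<and>
      (\<exists>\<pi> F. \<pi> permutes {1..d} \<and> (\<forall>x\<in>{1..d}. F x \<in> range (transducer d out nxt) \<and>
         (\<forall>w\<in>vertices d. f (x # w) = \<pi> x # F x w)))"
    using assms[of t]
    by (intro conjI exI[of _ "out t"] exI[of _ "\<lambda>x. transducer d out nxt (nxt t x)"]) auto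
qed simp

lemma transducer_eq_id:
  assumes "out s = id" "\<And>x. nxt s x = s"
  shows "transducer d out nxt s = id"
proof
  fix v
  have "run out nxt v s = v" by (induction v) (use assms in auto)
  then show "transducer d out nxt s v = id v" by (simp add: transducer_def)
qed

lemma transducer_decomp:
  assumes "length gs = d" "out s permutes {1..d}"
    and "\<And>x. x \<in> {1..d} \<Longrightarrow> gs ! (x - 1) = transducer d out nxt (nxt s x)"
    and "\<And>t. out t permutes {1..d}"
  shows "transducer d out nxt s = from_sections d gs \<otimes>\<^bsub>Aut_tree d\<^esub> rooted d (out s)"
proof -
  have "set gs \<subseteq> carrier (Aut_tree d)"
  proof
    fix g assume "g \<in> set gs"
    then obtain i where "i < d" "g = gs ! i" using assms(1) by (auto simp: in_set_conv_nth)
    then have "g = transducer d out nxt (nxt s (Suc i))"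
      using assms(3)[of "Suc i"] by simp
    then show "g \<in> carrier (Aut_tree d)" using transducer_Aut_tree[OF assms(4)] by simp
  qed
  then have *: "from_sections d gs = spine d gs" and st: "spine d gs \<in> carrier (Aut_tree d)"
    using from_sections_eq[OF assms(1)] spine_st1[OF assms(1)] by (auto simp: st1_def)
  have "transducer d out nxt s v = rooted d (out s) (spine d gs v)" for v
  proof (cases "v \<in> vertices d \<and> v \<noteq> []")
    case True
    then obtain x w where v: "v = x # w" "x \<in> {1..d}" "w \<in> vertices d" by (cases v) auto
    have "spine d gs v \<in> vertices d"
      using st v by (simp add: Aut_tree_iff permutes_in_image del: spine_simps)
    then show ?thesis using v assms(3)[of x] by auto
  qed (auto simp: rooted_def spine_def)
  then show ?thesis using * by (auto simp: fun_eq_iff)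
qed

lemma rooted_id [simp]: "rooted d id = id"
  by (auto simp: fun_eq_iff rooted_def)

lemma spine_rooted_2:
  assumes "f = from_sections 2 [g, h] \<otimes>\<^bsub>Aut_tree 2\<^esub> rooted 2 \<sigma>"
    and "g \<in> carrier (Aut_tree 2)" "h \<in> carrier (Aut_tree 2)" "w \<in> vertices 2"
  shows "f (1 # w) = \<sigma> 1 # g w" "f (2 # w) = \<sigma> 2 # h w"
proof -
  have "g w \<in> vertices 2" "h w \<in> vertices 2"
    using assms by (simp_all add: Aut_tree_iff permutes_in_image)
  then show "f (1 # w) = \<sigma> 1 # g w" "f (2 # w) = \<sigma> 2 # h w"
    using assms by (simp_all add: from_sections_eq)
qed

lemma vertex_2_induct [consumes 1, case_names Nil one two]:
  assumes "v \<in> vertices 2" "P []"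
    and "\<And>w. w \<in> vertices 2 \<Longrightarrow> P w \<Longrightarrow> P (1 # w)"
    and "\<And>w. w \<in> vertices 2 \<Longrightarrow> P w \<Longrightarrow> P (2 # w)"
  shows "P v"
  using assms(1)
proof (induction v)
  case (Cons x w)
  then have "x = 1 \<or> x = 2" "w \<in> vertices 2" by auto
  then show ?case using assms(3,4) Cons.IH by blast
qed (use assms in simp)

lemma Aut_tree_eqI:
  assumes "f \<in> carrier (Aut_tree d)" "g \<in> carrier (Aut_tree d)"
    and "\<And>v. v \<in> vertices d \<Longrightarrow> f v = g v"
  shows "f = g"
  using assms Aut_tree_outside by (metis ext)

lemma basilica_generators_ex1: "\<exists>!g. basilica_generators (fst g) (snd g)"
proof (rule ex_ex1I)
  define out where "out s = (if s = (2::nat) then transpose 1 2 else (id :: nat \<Rightarrow> nat))" for s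
  define nxt where "nxt s x = (if s = 0 \<or> x = (1::nat) then 0 else 3 - s)" for s x :: nat
  let ?T = "transducer 2 out nxt"
  have out: "out s permutes {1..2}" for s
    using transpose_1_2_permutes by (simp add: out_def permutes_id)
  have id: "?T 0 = id" by (rule transducer_eq_id) (auto simp: out_def nxt_def)
  have nx: "[?T 0, ?T (3 - s)] ! (x - 1) = ?T (nxt s x)"
    if "s \<in> {1, 2}" "x \<in> {1..2}" for s x
  proof -
    have "x = 1 \<or> x = 2" using that(2) by auto
    then show ?thesis using that(1) by (auto simp: nxt_def)
  qed
  have "?T s = from_sections 2 [?T 0, ?T (3 - s)] \<otimes>\<^bsub>Aut_tree 2\<^esub> rooted 2 (out s)"
    if "s \<in> {1, 2}" for s
    by (rule transducer_decomp) (use nx[OF that] out in auto)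
  from this[of 1] this[of 2]
  have "?T 1 = from_sections 2 [\<one>\<^bsub>Aut_tree 2\<^esub>, ?T 2]"
    "?T 2 = from_sections 2 [\<one>\<^bsub>Aut_tree 2\<^esub>, ?T 1] \<otimes>\<^bsub>Aut_tree 2\<^esub> rooted 2 (transpose 1 2)"
    by (simp_all add: id out_def)
  moreover have "?T s \<in> carrier (Aut_tree 2)" for s
    by (rule transducer_Aut_tree) (rule out)
  ultimately have "basilica_generators (?T 1) (?T 2)"
    unfolding basilica_generators_def by blast
  then show "\<exists>g. basilica_generators (fst g) (snd g)" by (metis fst_conv snd_conv)
next
  have main: "a = a' \<and> b = b'" if "basilica_generators a b" "basilica_generators a' b'"
    for a b a' b'
  proof -
    have eqs: "a (1 # w) = 1 # w \<and> a (2 # w) = 2 # b w \<and> b (1 # w) = 2 # w \<and> b (2 # w) = 1 # a w"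
      if "basilica_generators a b" "w \<in> vertices 2" for a b w
    proof -
      have ab: "a \<in> carrier (Aut_tree 2)" "b \<in> carrier (Aut_tree 2)"
        and a0: "a = from_sections 2 [\<one>\<^bsub>Aut_tree 2\<^esub>, b]"
        and b0: "b = from_sections 2 [\<one>\<^bsub>Aut_tree 2\<^esub>, a] \<otimes>\<^bsub>Aut_tree 2\<^esub> rooted 2 (transpose 1 2)"
        using that(1) unfolding basilica_generators_def by blast+
      have a: "a = from_sections 2 [id, b] \<otimes>\<^bsub>Aut_tree 2\<^esub> rooted 2 id"
        using a0 by simp
      have b: "b = from_sections 2 [id, a] \<otimes>\<^bsub>Aut_tree 2\<^esub> rooted 2 (transpose 1 2)"
        using b0 by simp
      show ?thesis
        using spine_rooted_2[OF a id_Aut_tree ab(2) that(2)]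
          spine_rooted_2[OF b id_Aut_tree ab(1) that(2)] by simp
    qed
    have "a v = a' v \<and> b v = b' v" if "v \<in> vertices 2" for v
      using that
    proof (induction v rule: vertex_2_induct)
      case Nil
      then show ?case
        using \<open>basilica_generators a b\<close> \<open>basilica_generators a' b'\<close>
        unfolding basilica_generators_def Aut_tree_iff by metis
    qed (use eqs[OF \<open>basilica_generators a b\<close>] eqs[OF \<open>basilica_generators a' b'\<close>] in auto)
    then show ?thesis
      using that Aut_tree_eqI unfolding basilica_generators_def by blast
  qed
  fix g h :: "(nat list \<Rightarrow> nat list) \<times> (nat list \<Rightarrow> nat list)"
  assume "basilica_generators (fst g) (snd g)" "basilica_generators (fst h) (snd h)"
  then show "g = h" using main by (simp add: prod_eq_iff)
qed

lemma bsv_generators_ex1: "\<exists>!g. bsv_generators (fst g) (snd g)"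
proof (rule ex_ex1I)
  define out where "out s = (if s = (0::nat) then (id :: nat \<Rightarrow> nat) else transpose 1 2)" for s
  define nxt where "nxt s x =
    (if s = 1 \<and> x = 2 then 2 else if s = 2 \<and> x = 1 then 1 else if s = 3 \<and> x = 2 then 3 else (0 :: nat))"
    for s x :: nat
  let ?T = "transducer 2 out nxt"
  have out: "out s permutes {1..2}" for s
    using transpose_1_2_permutes by (simp add: out_def permutes_id)
  have id: "?T 0 = id" by (rule transducer_eq_id) (auto simp: out_def nxt_def)
  have T: "?T s \<in> carrier (Aut_tree 2)" for s
    by (rule transducer_Aut_tree) (rule out)
  have in_V: "?T s w \<in> vertices 2" if "w \<in> vertices 2" for s w
    using T[of s] that by (simp add: Aut_tree_iff permutes_in_image)
  have "out 1 = transpose 1 2" "out 2 = transpose 1 2"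
    "nxt 1 1 = 0" "nxt 1 2 = 2" "nxt 2 1 = 1" "nxt 2 2 = 0"
    by (simp_all add: out_def nxt_def)
  then have T12: "?T 1 (1 # w) = 2 # w" "?T 1 (2 # w) = 1 # ?T 2 w"
    "?T 2 (1 # w) = 2 # ?T 1 w" "?T 2 (2 # w) = 1 # w" if "w \<in> vertices 2" for w
    using that by (simp_all add: id del: One_nat_def)
  have "?T 1 (?T 2 v) = v \<and> ?T 2 (?T 1 v) = v" if "v \<in> vertices 2" for v
    using that
    by (induction v rule: vertex_2_induct) (simp_all add: T12 in_V del: One_nat_def transducer_simps(3))
  then have "?T 1 (?T 2 v) = v \<and> ?T 2 (?T 1 v) = v" for v
    by (cases "v \<in> vertices 2") simp_all
  then have inv: "inv\<^bsub>Aut_tree 2\<^esub> (?T 1) = ?T 2"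
    unfolding inv_Aut_tree[OF T] by (intro inv_unique_comp) (auto simp: fun_eq_iff)
  have letters: "x = 1 \<or> x = 2" if "x \<in> {1..2}" for x :: nat using that by auto
  have "?T 1 = from_sections 2 [?T 0, ?T 2] \<otimes>\<^bsub>Aut_tree 2\<^esub> rooted 2 (out 1)"
    by (rule transducer_decomp) (use letters out in \<open>auto simp: nxt_def\<close>)
  moreover have "?T 3 = from_sections 2 [?T 0, ?T 3] \<otimes>\<^bsub>Aut_tree 2\<^esub> rooted 2 (out 3)"
    by (rule transducer_decomp) (use letters out in \<open>auto simp: nxt_def\<close>)
  ultimately have
    "?T 1 = from_sections 2 [\<one>\<^bsub>Aut_tree 2\<^esub>, ?T 2] \<otimes>\<^bsub>Aut_tree 2\<^esub> rooted 2 (transpose 1 2)"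
    "?T 3 = from_sections 2 [\<one>\<^bsub>Aut_tree 2\<^esub>, ?T 3] \<otimes>\<^bsub>Aut_tree 2\<^esub> rooted 2 (transpose 1 2)"
    by (simp_all add: id out_def)
  then have "bsv_generators (?T 1) (?T 3)"
    using T unfolding bsv_generators_def inv by blast
  then show "\<exists>g. bsv_generators (fst g) (snd g)" by (metis fst_conv snd_conv)
next
  let ?i = Hilbert_Choice.inv
  have main: "c = c' \<and> d = d'" if "bsv_generators c d" "bsv_generators c' d'" for c d c' d'
  proof -
    have eqs: "c (1 # w) = 2 # w \<and> c (2 # w) = 1 # ?i c w \<and> ?i c (2 # w) = 1 # w \<and>
        ?i c (1 # w) = 2 # c w \<and> d (1 # w) = 2 # w \<and> d (2 # w) = 1 # d w"
      if "bsv_generators c d" "w \<in> vertices 2" for c d w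
    proof -
      have cd: "c \<in> carrier (Aut_tree 2)" "d \<in> carrier (Aut_tree 2)"
        using that(1) unfolding bsv_generators_def by simp_all
      have c: "c = from_sections 2 [id, ?i c] \<otimes>\<^bsub>Aut_tree 2\<^esub> rooted 2 (transpose 1 2)"
        and d: "d = from_sections 2 [id, d] \<otimes>\<^bsub>Aut_tree 2\<^esub> rooted 2 (transpose 1 2)"
        using that(1) inv_Aut_tree[OF cd(1)] unfolding bsv_generators_def by simp_all
      have p: "c permutes vertices 2" using cd by (simp add: Aut_tree_iff)
      have cw: "c w \<in> vertices 2" using p that(2) by (simp add: permutes_in_image)
      note 1 = spine_rooted_2[OF c id_Aut_tree inv_fun_Aut_tree[OF cd(1)]]
      have "c (1 # w) = 2 # w" "c (2 # w) = 1 # ?i c w" "c (2 # c w) = 1 # w"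
        using 1[OF that(2)] 1[OF cw] permutes_inverses[OF p] by simp_all
      moreover from this have "?i c (2 # w) = 1 # w" "?i c (1 # w) = 2 # c w"
        using permutes_inv_eq[OF p] by blast+
      ultimately show ?thesis
        using spine_rooted_2[OF d id_Aut_tree cd(2) that(2)] by simp
    qed
    have root: "c [] = [] \<and> ?i c [] = [] \<and> d [] = []" if "bsv_generators c d" for c d
      using that inv_fun_Aut_tree[of c 2] unfolding bsv_generators_def Aut_tree_iff by blast
    have "c v = c' v \<and> ?i c v = ?i c' v \<and> d v = d' v" if "v \<in> vertices 2" for v
      using that
    proof (induction v rule: vertex_2_induct)
      case Nil
      then show ?case
        using root[OF \<open>bsv_generators c d\<close>] root[OF \<open>bsv_generators c' d'\<close>] by simp
    qed (use eqs[OF \<open>bsv_generators c d\<close>] eqs[OF \<open>bsv_generators c' d'\<close>] in auto)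
    then show ?thesis
      using that Aut_tree_eqI unfolding bsv_generators_def by blast
  qed
  fix g h :: "(nat list \<Rightarrow> nat list) \<times> (nat list \<Rightarrow> nat list)"
  assume "bsv_generators (fst g) (snd g)" "bsv_generators (fst h) (snd h)"
  then show "g = h" using main by (simp add: prod_eq_iff)
qed

lemma cycle_upt_permutes: "cycle_of_list [1..<Suc p] permutes {1..p}"
  using cycle_permutes[of "[1..<Suc p]"] by (simp add: atLeastLessThanSuc_atLeastAtMost del: upt_Suc)

lemma ggs_constant_generators_ex1:
  assumes "p \<ge> 1"
  shows "\<exists>!g. ggs_constant_generators p (fst g) (snd g)"
proof (rule ex_ex1I)
  let ?a = "rooted p (cycle_of_list [1..<Suc p])"
  define out where "out s = (if s = (1::nat) then cycle_of_list [1..<Suc p] else id)" for s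
  define nxt where "nxt s x = (if s = (2::nat) then if x = p then 2 else 1 else 0::nat)" for s x
  let ?T = "transducer p out nxt"
  have out: "out s permutes {1..p}" for s
    using cycle_upt_permutes by (simp add: out_def permutes_id del: upt_Suc)
  have id: "?T 0 = id" by (rule transducer_eq_id) (auto simp: out_def nxt_def)
  have a: "?T 1 = ?a"
  proof
    fix v
    show "?T 1 v = ?a v"
      by (cases v; cases "v \<in> vertices p") (simp_all add: out_def nxt_def id del: upt_Suc)
  qed
  have "?T 2 = from_sections p (replicate (p - 1) (?T 1) @ [?T 2]) \<otimes>\<^bsub>Aut_tree p\<^esub> rooted p (out 2)"
    by (rule transducer_decomp) (use assms out in \<open>auto simp: nxt_def nth_append\<close>)
  then have "?T 2 = from_sections p (replicate (p - 1) ?a @ [?T 2])"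
    unfolding a by (simp add: out_def del: upt_Suc)
  moreover have "?T 2 \<in> carrier (Aut_tree p)"
    by (rule transducer_Aut_tree) (rule out)
  ultimately have "ggs_constant_generators p ?a (?T 2)"
    using rooted_Aut_tree[OF cycle_upt_permutes[of p]] unfolding ggs_constant_generators_def by blast
  then show "\<exists>g. ggs_constant_generators p (fst g) (snd g)" by (metis fst_conv snd_conv)
next
  have main: "a = a' \<and> b = b'"
    if "ggs_constant_generators p a b" "ggs_constant_generators p a' b'" for a b a' b'
  proof -
    have eqs: "b (x # w) = x # (if x = p then b w else a w)"
      if "ggs_constant_generators p a b" "x # w \<in> vertices p" for a b x w
    proof -
      have "a \<in> carrier (Aut_tree p)" "b \<in> carrier (Aut_tree p)"
        and b: "b = from_sections p (replicate (p - 1) a @ [b])"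
        using that(1) unfolding ggs_constant_generators_def by blast+
      then have "from_sections p (replicate (p - 1) a @ [b]) = spine p (replicate (p - 1) a @ [b])"
        using assms by (intro from_sections_eq) auto
      then have "b (x # w) = spine p (replicate (p - 1) a @ [b]) (x # w)"
        using b by simp
      then show ?thesis using that(2) by (auto simp: nth_append)
    qed
    have a: "a = a'" using that unfolding ggs_constant_generators_def by blast
    have "b v = b' v" if "v \<in> vertices p" for v
      using that
    proof (induction v)
      case Nil
      then show ?case
        using \<open>ggs_constant_generators p a b\<close> \<open>ggs_constant_generators p a' b'\<close>
        unfolding ggs_constant_generators_def Aut_tree_iff by metis
    next
      case (Cons x v)
      then show ?case
        using eqs[OF \<open>ggs_constant_generators p a b\<close>] eqs[OF \<open>ggs_constant_generators p a' b'\<close>] a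
        by simp
    qed
    then show ?thesis
      using that a Aut_tree_eqI unfolding ggs_constant_generators_def by blast
  qed
  fix g h :: "(nat list \<Rightarrow> nat list) \<times> (nat list \<Rightarrow> nat list)"
  assume "ggs_constant_generators p (fst g) (snd g)" "ggs_constant_generators p (fst h) (snd h)"
  then show "g = h" using main by (simp add: prod_eq_iff)
qed

end

theory Submission
  imports Defs "HOL-Computational_Algebra.Polynomial"
begin

text \<open>All nontrivial subgroups of the Basilica group, of the Brunner-Sidki-Vieira group, and of a normal
  subgroup \<open>H\<close> of finite index of the GGS-group, have nontrivial homomorphisms to the reals: there is a
  homomorphism to the integers whose kernel fixes the first level and has its sections again
  in the group (resp. in \<open>H\<close>), so a subgroup without characters fixes all vertices. That it is well
  defined on words follows by induction along sections, which together are as long as the word.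

  Moreover, every vertex \<open>u\<close> supports a nontrivial element \<open>x\<close>. If \<open>g\<close> moves \<open>u\<close>, take a nonzero
  character of the group generated by the parts below \<open>u\<close> of the conjugates of \<open>x\<close> by powers \<open>g^k\<close>. If
  \<open>[x,\<^sub>n g] = 1\<close>, then its value at the \<open>k\<close>-th part is a polynomial in \<open>k\<close>. But these parts are trivial
  for infinitely many \<open>k\<close>, so the character vanishes on the generators, a contradiction.\<close>

section \<open>Groups with many characters and rigid stabilizers\<close>

text \<open>The parts below \<open>u\<close> do not commute with each other. A character makes their
  contributions additive, and commutation with \<open>g\<close> becomes a forward difference in
  \<open>k\<close>. It must exist on the group generated by all the parts at once, of which little
  is known; hence the demand that every nontrivial subgroup has one. Infinitely many parts are
  trivial because two consecutive powers of \<open>g\<close> cannot both fix a vertex that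
  \<open>g\<close> moves.

  The generators of the GGS-group have finite order, so this group itself has no nonzero character.
  This forces \<open>H\<close>, the kernel of the map to the integers modulo \<open>p\<close>
  sending both generators to 1. As \<open>g\<close> stays arbitrary, \<open>H\<close> has to be
  normal and has to contain \<open>x\<close>.

  Copying an element below a vertex may lead out of the group. Commutators can be copied: their two
  entries are lifted to elements whose nontrivial sections overlap at one place only.\<close>

abbreviation finv :: "('a \<Rightarrow> 'a) \<Rightarrow> 'a \<Rightarrow> 'a"
  where "finv \<equiv> Hilbert_Choice.inv"

text \<open>Newton's formula writes \<open>F 0 k\<close> as a combination of binomial coefficients
  in \<open>k\<close> with the iterated differences at 0. Since the differences of order at least
  \<open>n\<close> vanish, \<open>F 0\<close> is a polynomial in \<open>k\<close>, and it has
  infinitely many roots.\<close>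

lemma forward_difference_zero:
  fixes F :: "nat \<Rightarrow> nat \<Rightarrow> real"
  assumes step: "\<And>n k. F (Suc n) k = F n (Suc k) - F n k"
    and zero: "\<And>k. F n k = 0"
    and inf: "infinite {k. F 0 k = 0}"
  shows "F 0 k = 0"
proof -
  have newton: "F m k = (\<Sum>j\<le>k. real (k choose j) * F (m + j) 0)" for m k
  proof (induction k arbitrary: m)
    case (Suc k)
    have "F m (Suc k) = F (Suc m) k + F m k" using step[of m k] by simp
    also have "\<dots> = (\<Sum>j\<le>k. real (k choose j) * F (m + Suc j) 0) +
        (\<Sum>j\<le>Suc k. real (k choose j) * F (m + j) 0)"
      by (simp add: Suc)
    also have "\<dots> = (\<Sum>j\<le>Suc k. real (Suc k choose j) * F (m + j) 0)"
      unfolding sum.atMost_Suc_shift[of _ k] by (simp add: algebra_simps sum.distrib)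
    finally show ?case .
  qed simp
  have late: "F (n + m) k = 0" for m k
    by (induction m arbitrary: k) (use zero step in auto)
  \<comment> \<open>The product of the \<open>X - i\<close> over \<open>i < j\<close>, divided by
    the factorial of \<open>j\<close>, is the binomial coefficient \<open>X\<close> over
    \<open>j\<close> as a polynomial.\<close>
  define q where "q = (\<Sum>j<n. smult (F j 0 / fact j) (\<Prod>i=0..<j. [:- of_nat i, 1:]))"
  have q: "F 0 k = poly q (real k)" for k
  proof -
    have "F 0 k = (\<Sum>j\<le>k. real (k choose j) * F j 0)" using newton[of 0 k] by simp
    also have "\<dots> = (\<Sum>j<n + Suc k. real (k choose j) * F j 0)"
      by (intro sum.mono_neutral_left) auto
    also have "\<dots> = (\<Sum>j<n. real (k choose j) * F j 0)"
    proof (intro sum.mono_neutral_right ballI)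
      fix j assume "j \<in> {..<n + Suc k} - {..<n}"
      then show "real (k choose j) * F j 0 = 0" using late[of "j - n" 0] by auto
    qed auto
    also have "\<dots> = poly q (real k)"
      by (simp add: q_def poly_sum poly_prod binomial_gbinomial gbinomial_prod_rev algebra_simps
          atLeast0LessThan)
    finally show ?thesis .
  qed
  have "infinite (real ` {k. F 0 k = 0})"
    using inf by (simp add: finite_image_iff)
  moreover have "real ` {k. F 0 k = 0} \<subseteq> {x. poly q x = 0}" using q by auto
  ultimately have "q = 0" using poly_roots_finite finite_subset by blast
  then show ?thesis using q by simp
qed

lemma Aut_tree_comp:
  "f \<in> carrier (Aut_tree d) \<Longrightarrow> g \<in> carrier (Aut_tree d) \<Longrightarrow> f \<circ> g \<in> carrier (Aut_tree d)"
  using monoid.m_closed[OF group.is_monoid[OF group_Aut_tree], of g d f] by simp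

lemma Aut_tree_finv_cancel [simp]:
  assumes "f \<in> carrier (Aut_tree d)"
  shows "f (finv f v) = v" "finv f (f v) = v" "f \<circ> finv f = id" "finv f \<circ> f = id" "finv (finv f) = f"
proof -
  have "f permutes vertices d" using assms by (simp add: Aut_tree_iff)
  then show "f (finv f v) = v" "finv f (f v) = v" "f \<circ> finv f = id" "finv f \<circ> f = id" "finv (finv f) = f"
    by (auto simp: permutes_inverses permutes_inv_o permutes_inv_inv)
qed

lemma Aut_tree_finv_comp:
  assumes "f \<in> carrier (Aut_tree d)" "g \<in> carrier (Aut_tree d)"
  shows "finv (f \<circ> g) = finv g \<circ> finv f"
  using assms unfolding Aut_tree_iff by (intro o_inv_distrib permutes_bij) auto

lemma Aut_tree_vertices_iff [simp]:
  "f \<in> carrier (Aut_tree d) \<Longrightarrow> f v \<in> vertices d \<longleftrightarrow> v \<in> vertices d"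
  by (simp add: Aut_tree_iff permutes_in_image)

lemma Aut_tree_inj: "f \<in> carrier (Aut_tree d) \<Longrightarrow> f u = f v \<longleftrightarrow> u = v"
  by (metis Aut_tree_finv_cancel(2))

lemma subgroup_Aut_treeI:
  assumes "G \<subseteq> carrier (Aut_tree d)" "id \<in> G"
    and "\<And>f g. f \<in> G \<Longrightarrow> g \<in> G \<Longrightarrow> f \<circ> g \<in> G" "\<And>f. f \<in> G \<Longrightarrow> finv f \<in> G"
  shows "subgroup G (Aut_tree d)"
proof (rule group.subgroupI[OF group_Aut_tree])
  fix f assume "f \<in> G"
  then show "inv\<^bsub>Aut_tree d\<^esub> f \<in> G" using assms inv_Aut_tree by (metis subsetD)
qed (use assms in auto)

lemma subgroup_Aut_treeD:
  assumes "subgroup G (Aut_tree d)"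
  shows "f \<in> G \<Longrightarrow> f \<in> carrier (Aut_tree d)" "id \<in> G"
    and "f \<in> G \<Longrightarrow> g \<in> G \<Longrightarrow> f \<circ> g \<in> G" "f \<in> G \<Longrightarrow> finv f \<in> G"
proof -
  show c: "f \<in> G \<Longrightarrow> f \<in> carrier (Aut_tree d)" for f
    using subgroup.mem_carrier[OF assms] .
  show "id \<in> G" using subgroup.one_closed[OF assms] by simp
  show "f \<in> G \<Longrightarrow> g \<in> G \<Longrightarrow> f \<circ> g \<in> G" using subgroup.m_closed[OF assms, of g f] by simp
  show "f \<in> G \<Longrightarrow> finv f \<in> G" using subgroup.m_inv_closed[OF assms, of f] inv_Aut_tree[OF c] by simp
qed

definition has_character :: "('a \<Rightarrow> 'a) set \<Rightarrow> bool"
  where "has_character P \<longleftrightarrow>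
    (\<exists>\<chi> :: ('a \<Rightarrow> 'a) \<Rightarrow> real. (\<forall>f\<in>P. \<forall>g\<in>P. \<chi> (f \<circ> g) = \<chi> f + \<chi> g) \<and> (\<exists>f\<in>P. \<chi> f \<noteq> 0))"

lemma has_characterI:
  fixes \<chi> :: "('a \<Rightarrow> 'a) \<Rightarrow> real"
  assumes "\<And>f g. f \<in> P \<Longrightarrow> g \<in> P \<Longrightarrow> \<chi> (f \<circ> g) = \<chi> f + \<chi> g" "f \<in> P" "\<chi> f \<noteq> 0"
  shows "has_character P"
  using assms unfolding has_character_def by blast

lemma has_characterE:
  assumes "has_character P"
  obtains \<chi> :: "('a \<Rightarrow> 'a) \<Rightarrow> real" and h
  where "\<forall>f\<in>P. \<forall>g\<in>P. \<chi> (f \<circ> g) = \<chi> f + \<chi> g" "h \<in> P" "\<chi> h \<noteq> 0"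
  using assms unfolding has_character_def by (elim exE conjE bexE) (rule that)

text \<open>If \<open>P\<close> has no character then \<open>\<tau>\<close> vanishes on \<open>P\<close>, so \<open>P\<close> fixes the first level, and
  its groups of sections, being quotients of \<open>P\<close>, have no characters either.\<close>

lemma has_character_if_self_similar:
  fixes \<tau> :: "(nat list \<Rightarrow> nat list) \<Rightarrow> real"
  assumes H: "H \<subseteq> carrier (Aut_tree d)"
    and hom: "\<And>f g. f \<in> H \<Longrightarrow> g \<in> H \<Longrightarrow> \<tau> (f \<circ> g) = \<tau> f + \<tau> g"
    and st: "\<And>f. f \<in> H \<Longrightarrow> \<tau> f = 0 \<Longrightarrow> f \<in> st1 d"
    and sec: "\<And>f x. f \<in> H \<Longrightarrow> \<tau> f = 0 \<Longrightarrow> x \<in> {1..d} \<Longrightarrow> tree_section d [x] f \<in> H"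
    and P: "P \<subseteq> H" "\<And>f g. f \<in> P \<Longrightarrow> g \<in> P \<Longrightarrow> f \<circ> g \<in> P" "\<not> P \<subseteq> {id}"
  shows "has_character P"
proof (rule ccontr)
  assume no: "\<not> has_character P"
  \<comment> \<open>The group has to vary in the induction on the vertex: below the letter
    \<open>x\<close> it is replaced by the group of sections at \<open>x\<close>.\<close>
  have "f v = v" if "v \<in> vertices d" "P \<subseteq> H" "\<forall>f\<in>P. \<forall>g\<in>P. f \<circ> g \<in> P" "\<not> has_character P" "f \<in> P"
    for P f v
    using that
  proof (induction v arbitrary: P f)
    case Nil
    then show ?case using H by (auto simp: Aut_tree_iff)
  next
    case (Cons x v)
    have x: "x \<in> {1..d}" "v \<in> vertices d" using Cons.prems by auto
    have PH: "f \<in> P \<Longrightarrow> f \<in> H" for f using Cons.prems by auto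
    have "\<forall>f\<in>P. \<tau> f = 0"
      using has_characterI[of P \<tau>, OF hom[OF PH PH]] Cons.prems(4) by blast
    then have st: "f \<in> st1 d" and secH: "tree_section d [x] f \<in> H" if "f \<in> P" for f
      using st sec x that PH by auto
    let ?s = "tree_section d [x]"
    have app: "f (x # w) = x # ?s f w" if "f \<in> P" "w \<in> vertices d" for f w
      using Aut_tree_append[of f d "[x]" w] st[OF that(1)] x that by (simp add: st1_def)
    have s_hom: "?s (f \<circ> g) = ?s f \<circ> ?s g" if "f \<in> P" "g \<in> P" for f g
    proof
      fix w
      show "?s (f \<circ> g) w = (?s f \<circ> ?s g) w"
      proof (cases "w \<in> vertices d")
        case True
        have "f \<circ> g \<in> P" using Cons.prems(3) that by blast
        moreover have "?s g w \<in> vertices d"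
          using secH[OF that(2)] H True by auto
        ultimately have "x # ?s (f \<circ> g) w = x # ?s f (?s g w)"
          using app[of "f \<circ> g" w] app[of g w] app[of f "?s g w"] that True by (metis comp_apply)
        then show ?thesis by simp
      qed (simp add: tree_section_def)
    qed
    have "\<not> has_character (?s ` P)"
    proof
      assume "has_character (?s ` P)"
      then obtain \<chi> :: "(nat list \<Rightarrow> nat list) \<Rightarrow> real" and h
        where \<chi>: "\<forall>f\<in>?s ` P. \<forall>g\<in>?s ` P. \<chi> (f \<circ> g) = \<chi> f + \<chi> g"
        and h: "h \<in> ?s ` P" "\<chi> h \<noteq> 0" by (rule has_characterE)
      obtain h' where "h' \<in> P" "\<chi> (?s h') \<noteq> 0" using h by blast
      moreover have "\<chi> (?s (f \<circ> g)) = \<chi> (?s f) + \<chi> (?s g)" if "f \<in> P" "g \<in> P" for f g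
        using \<chi> that s_hom[OF that] by simp
      ultimately have "has_character P" using has_characterI[of P "\<lambda>f. \<chi> (?s f)"] by blast
      then show False using Cons.prems(4) by blast
    qed
    moreover have "\<forall>f\<in>?s ` P. \<forall>g\<in>?s ` P. f \<circ> g \<in> ?s ` P"
    proof (intro ballI)
      fix f g assume "f \<in> ?s ` P" "g \<in> ?s ` P"
      then obtain f' g' where fg: "f' \<in> P" "g' \<in> P" and "f = ?s f'" "g = ?s g'" by blast
      then have "f \<circ> g = ?s (f' \<circ> g')" using s_hom[OF fg] by (simp only:)
      moreover have "f' \<circ> g' \<in> P" using Cons.prems(3) fg by blast
      ultimately show "f \<circ> g \<in> ?s ` P" by (simp only: imageI)
    qed
    moreover have "?s ` P \<subseteq> H" using secH by auto
    ultimately have "?s f v = v" using Cons.IH[of "?s ` P" "?s f"] x(2) Cons.prems(5) by blast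
    then show ?case using app[OF Cons.prems(5) x(2)] by simp
  qed
  then have "f v = v" if "f \<in> P" for f v
    using that P no Aut_tree_outside[of f d v] H by (cases "v \<in> vertices d") blast+
  then show False using P by (auto simp: fun_eq_iff)
qed

section \<open>Restriction to the subtree below a vertex\<close>

lemma take_length_eq_iff: "take (length u) v = u \<longleftrightarrow> (\<exists>w. v = u @ w)"
  by (metis append_eq_conv_conj append_take_drop_id)

lemma Aut_tree_take:
  assumes f: "f \<in> carrier (Aut_tree d)" and "v \<in> vertices d" "take (length u) v = u"
  shows "take (length u) (f v) = f u"
proof -
  obtain w where v: "v = u @ w" using assms(3) take_length_eq_iff by blast
  then have u: "u \<in> vertices d" "w \<in> vertices d" using assms(2) by simp_all
  show ?thesis
    unfolding v Aut_tree_append[OF f u] using Aut_tree_length[OF f u(1)] by simp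
qed

lemma Aut_tree_take_fixed:
  assumes f: "f \<in> carrier (Aut_tree d)" and u: "u \<in> vertices d" "f u = u"
  shows "take (length u) (f v) = u \<longleftrightarrow> take (length u) v = u"
proof (cases "v \<in> vertices d")
  case True
  note f' = inv_fun_Aut_tree[OF f]
  have "finv f u = u" using Aut_tree_finv_cancel(2)[OF f, of u] u by simp
  then show ?thesis
    using Aut_tree_take[OF f True, of u] Aut_tree_take[OF f', of "f v" u] True f u by force
qed (simp add: Aut_tree_outside[OF f])

text \<open>This is what the overview calls the part of \<open>f\<close> below \<open>u\<close>. It
  is multiplicative only on elements fixing \<open>u\<close>, so all elements to which it is applied
  are first shown to fix \<open>u\<close>.\<close>

definition restrict_below :: "'a list \<Rightarrow> ('a list \<Rightarrow> 'a list) \<Rightarrow> 'a list \<Rightarrow> 'a list"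
  where "restrict_below u f v = (if take (length u) v = u then f v else v)"

lemma restrict_below_comp:
  assumes "g \<in> carrier (Aut_tree d)" "u \<in> vertices d" "g u = u"
  shows "restrict_below u (f \<circ> g) = restrict_below u f \<circ> restrict_below u g"
  using Aut_tree_take_fixed[OF assms] by (auto simp: restrict_below_def fun_eq_iff)

lemma restrict_below_id [simp]: "restrict_below u id = id"
  by (auto simp: restrict_below_def fun_eq_iff)

lemma restrict_below_finv:
  assumes f: "f \<in> carrier (Aut_tree d)" and u: "u \<in> vertices d" "f u = u"
  shows "restrict_below u (finv f) = finv (restrict_below u f)"
proof -
  have f': "finv f \<in> carrier (Aut_tree d)" "finv f u = u"
    using inv_fun_Aut_tree[OF f] Aut_tree_finv_cancel(2)[OF f, of u] u by simp_all
  have "restrict_below u f \<circ> restrict_below u (finv f) = id"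
    "restrict_below u (finv f) \<circ> restrict_below u f = id"
    using restrict_below_comp[OF f'(1) u(1) f'(2), of f] restrict_below_comp[OF f u, of "finv f"] f
    by simp_all
  then show ?thesis by (metis inv_unique_comp)
qed

text \<open>Automorphisms act on the right, so as a composite of functions the commutator of
  \<open>y\<close> and \<open>g\<close> is the conjugate \<open>g \<circ> y \<circ> finv g\<close>
  composed with \<open>finv y\<close>. In this form a homomorphism turns it into a
  difference.\<close>

lemma iter_comm_subgroup:
  assumes G: "subgroup G (Aut_tree d)" and x: "x \<in> G" and g: "g \<in> G"
  shows "iter_comm ((Aut_tree d)\<lparr>carrier := G\<rparr>) x n g \<in> G"
    and "iter_comm ((Aut_tree d)\<lparr>carrier := G\<rparr>) x (Suc n) g =
      (g \<circ> iter_comm ((Aut_tree d)\<lparr>carrier := G\<rparr>) x n g \<circ> finv g) \<circ>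
      finv (iter_comm ((Aut_tree d)\<lparr>carrier := G\<rparr>) x n g)"
proof -
  note GD = subgroup_Aut_treeD[OF G]
  have inv: "inv\<^bsub>(Aut_tree d)\<lparr>carrier := G\<rparr>\<^esub> f = finv f" if "f \<in> G" for f
    using group.m_inv_consistent[OF group_Aut_tree G that] inv_Aut_tree[OF GD(1)[OF that]] by simp
  have comm: "comm ((Aut_tree d)\<lparr>carrier := G\<rparr>) y g = (g \<circ> y \<circ> finv g) \<circ> finv y" if "y \<in> G" for y
    using that g by (simp add: comm_def inv o_assoc)
  show *: "iter_comm ((Aut_tree d)\<lparr>carrier := G\<rparr>) x n g \<in> G" for n
  proof (induction n)
    case (Suc n)
    show ?case unfolding iter_comm.simps comm[OF Suc] by (intro GD(3,4) Suc g)
  qed (use x in simp)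
  show "iter_comm ((Aut_tree d)\<lparr>carrier := G\<rparr>) x (Suc n) g =
      (g \<circ> iter_comm ((Aut_tree d)\<lparr>carrier := G\<rparr>) x n g \<circ> finv g) \<circ>
      finv (iter_comm ((Aut_tree d)\<lparr>carrier := G\<rparr>) x n g)"
    by (simp only: iter_comm.simps comm[OF *])
qed

text \<open>Suppose \<open>g\<close> moves \<open>u\<close> and let \<open>x\<close> be supported below \<open>u\<close>. For a character \<open>\<chi>\<close> of the
  group generated by the parts below \<open>u\<close> of the conjugates of \<open>x\<close>, let \<open>F n k\<close> be the value of
  \<open>\<chi>\<close> at the part below \<open>u\<close> of the conjugate of \<open>[x,\<^sub>n g]\<close> by \<open>g^k\<close>. Then \<open>F (n + 1)\<close>
  is the forward difference of \<open>F n\<close>.\<close>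

lemma not_left_engel_if_moves:
  assumes G: "subgroup G (Aut_tree d)" and H: "subgroup H (Aut_tree d)" "H \<subseteq> G"
    and normal: "\<And>y. y \<in> H \<Longrightarrow> g \<circ> y \<circ> finv g \<in> H"
    and char: "\<And>P. subgroup P (Aut_tree d) \<Longrightarrow> P \<subseteq> H \<Longrightarrow> P \<noteq> {id} \<Longrightarrow> has_character P"
    and u: "u \<in> vertices d" and g: "g \<in> G" "g u \<noteq> u"
    and x: "x \<in> H" "x \<noteq> id"
    and supp: "\<And>v. v \<in> vertices d \<Longrightarrow> take (length u) v \<noteq> u \<Longrightarrow> x v = v"
  shows "iter_comm ((Aut_tree d)\<lparr>carrier := G\<rparr>) x n g \<noteq> id"
proof
  assume engel: "iter_comm ((Aut_tree d)\<lparr>carrier := G\<rparr>) x n g = id"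
  let ?A = "carrier (Aut_tree d)"
  note GD = subgroup_Aut_treeD[OF G] and HD = subgroup_Aut_treeD[OF H(1)]
  define gk where "gk k = g ^^ k" for k
  define c where "c k y = gk k \<circ> y \<circ> finv (gk k)" for k y
  have gk: "gk k \<in> ?A" for k
    unfolding gk_def
  proof (induction k)
    case (Suc k)
    then show ?case unfolding funpow.simps by (rule Aut_tree_comp[OF GD(1)[OF g(1)]])
  qed (simp only: funpow.simps id_Aut_tree)
  have gk_Suc: "gk (Suc k) = gk k \<circ> g" for k
    by (simp add: gk_def funpow_Suc_right del: funpow.simps)
  have c_id: "c 0 y = y" for y by (simp add: c_def gk_def)
  have c_in: "c k y \<in> ?A" if "y \<in> ?A" for k y
    using that gk[of k] by (simp add: c_def Aut_tree_comp inv_fun_Aut_tree)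
  have c_comp: "c k (y \<circ> z) = c k y \<circ> c k z" for k y z
    using gk[of k] by (simp add: c_def fun_eq_iff)
  have c_finv: "c k (finv y) = finv (c k y)" if "y \<in> ?A" for k y
    unfolding c_def Aut_tree_finv_comp[OF Aut_tree_comp[OF gk that] inv_fun_Aut_tree[OF gk]]
      Aut_tree_finv_comp[OF gk that]
    using gk[of k] by (simp add: o_assoc)
  have c_conj: "c k (g \<circ> y \<circ> finv g) = c (Suc k) y" for k y
    using gk[of k] GD(1)[OF g(1)] by (simp add: c_def gk_Suc Aut_tree_finv_comp o_assoc)
  have c_H: "c k y \<in> H" if "y \<in> H" for k y
    using that
  proof (induction k arbitrary: y)
    case (Suc k)
    then show ?case using normal c_conj by metis
  qed (simp add: c_id)
  have xA: "x \<in> ?A" using x HD by blast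
  have move: "x v \<noteq> v \<Longrightarrow> take (length u) v = u" for v
    using supp[of v] Aut_tree_outside[OF xA] by metis
  have xu: "x u = u"
  proof (rule ccontr)
    assume "x u \<noteq> u"
    then have "x (x u) \<noteq> x u" using Aut_tree_inj[OF xA] by blast
    then have "take (length u) (x u) = u" using move by blast
    then show False using \<open>x u \<noteq> u\<close> Aut_tree_length[OF xA u] by simp
  qed
  have conj_take: "take (length u) v = gk k u" if "c k x v \<noteq> v" for k v
  proof -
    have "x (finv (gk k) v) \<noteq> finv (gk k) v"
      using that Aut_tree_finv_cancel(1)[OF gk] by (auto simp: c_def)
    moreover from this have "finv (gk k) v \<in> vertices d" using Aut_tree_outside[OF xA] by blast
    ultimately have "take (length u) (gk k (finv (gk k) v)) = gk k u"
      using Aut_tree_take[OF gk] move by blast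
    then show ?thesis by (simp add: Aut_tree_finv_cancel(1)[OF gk])
  qed
  \<comment> \<open>If \<open>g^k\<close> moves \<open>u\<close>, then \<open>u\<close> does not lie
    below the different vertex \<open>gk k u\<close> of the same length, so the conjugate fixes
    it.\<close>
  have cxu: "c k x u = u" for k
  proof (cases "gk k u = u")
    case True
    then have "finv (gk k) u = u" using Aut_tree_finv_cancel(2)[OF gk, of k u] by simp
    then show ?thesis using True xu by (simp add: c_def)
  next
    case False
    then show ?thesis using conj_take[of k u] by auto
  qed
  \<comment> \<open>Vertices of equal length have equal or disjoint subtrees, so the conjugate is
    kept entirely or lost entirely.\<close>
  have rest: "restrict_below u (c k x) = (if gk k u = u then c k x else id)" for k
  proof -
    have "c k x v = v" if "take (length u) v \<noteq> gk k u" for v using conj_take that by blast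
    then show ?thesis by (auto simp: restrict_below_def fun_eq_iff)
  qed
  define X where "X = range (\<lambda>k. restrict_below u (c k x))"
  define P where "P = generate (Aut_tree d) X"
  have XH: "X \<subseteq> H" using rest c_H[OF x(1)] HD(2) by (auto simp: X_def)
  then have PH: "P \<subseteq> H"
    unfolding P_def using group.generate_subgroup_incl[OF group_Aut_tree] H(1) by blast
  have P: "subgroup P (Aut_tree d)"
    unfolding P_def using XH HD(1) by (intro group.generate_is_subgroup[OF group_Aut_tree]) blast
  note PD = subgroup_Aut_treeD[OF P]
  have XP: "X \<subseteq> P" unfolding P_def by (auto intro: generate.incl)
  have "x \<in> X"
    unfolding X_def by (rule range_eqI[of _ _ 0]) (use rest[of 0] in \<open>simp add: c_id gk_def\<close>)
  then have "P \<noteq> {id}" using x XP by auto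
  from char[OF P PH this] obtain \<chi> :: "(nat list \<Rightarrow> nat list) \<Rightarrow> real" and h where
    \<chi>: "\<forall>f\<in>P. \<forall>g\<in>P. \<chi> (f \<circ> g) = \<chi> f + \<chi> g" and h: "h \<in> P" "\<chi> h \<noteq> 0"
    by (rule has_characterE)
  have \<chi>_id: "\<chi> id = 0"
    using \<chi>[rule_format, OF PD(2) PD(2)] by simp
  have \<chi>_inv: "\<chi> (finv f) = - \<chi> f" if "f \<in> P" for f
    using \<chi>[rule_format, OF that PD(4)[OF that]] PD(1)[OF that] \<chi>_id by simp
  \<comment> \<open>On \<open>N\<close>, applying \<open>c k\<close>, restricting below
    \<open>u\<close> and evaluating \<open>\<chi>\<close> is additive for every \<open>k\<close>.
    Closure under products, inverses and conjugation by \<open>g\<close> puts all iterated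
    commutators into \<open>N\<close>.\<close>
  define N where "N = {y \<in> ?A. \<forall>k. c k y u = u \<and> restrict_below u (c k y) \<in> P}"
  have N_inv: "finv y \<in> N" if "y \<in> N" for y
  proof -
    have y: "y \<in> ?A" "c k y u = u" "restrict_below u (c k y) \<in> P" for k using that by (auto simp: N_def)
    have "c k (finv y) u = u" for k
      using c_finv[OF y(1)] y(2)[of k] c_in[OF y(1), of k] by (metis Aut_tree_finv_cancel(2))
    then show ?thesis
      using restrict_below_finv[OF c_in[OF y(1)] u y(2)] PD(4)[OF y(3)] c_finv[OF y(1)]
        inv_fun_Aut_tree[OF y(1)] by (simp add: N_def)
  qed
  have N_comp: "y \<circ> z \<in> N" if "y \<in> N" "z \<in> N" for y z
  proof -
    have y: "y \<in> ?A" "c k y u = u" "restrict_below u (c k y) \<in> P" for k using that by (auto simp: N_def)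
    have z: "z \<in> ?A" "c k z u = u" "restrict_below u (c k z) \<in> P" for k using that by (auto simp: N_def)
    have "restrict_below u (c k (y \<circ> z)) \<in> P" for k
      unfolding c_comp restrict_below_comp[OF c_in[OF z(1)] u z(2)] by (rule PD(3)[OF y(3) z(3)])
    moreover have "c k (y \<circ> z) u = u" for k
      unfolding c_comp by (simp add: y z)
    ultimately show ?thesis
      using Aut_tree_comp[OF y(1) z(1)] by (simp only: N_def mem_Collect_eq simp_thms)
  qed
  have N_conj: "g \<circ> y \<circ> finv g \<in> N" if "y \<in> N" for y
  proof -
    have y: "y \<in> ?A" "c k y u = u" "restrict_below u (c k y) \<in> P" for k using that by (auto simp: N_def)
    have "g \<circ> y \<circ> finv g \<in> ?A"
      using Aut_tree_comp[OF Aut_tree_comp[OF GD(1)[OF g(1)] y(1)] inv_fun_Aut_tree[OF GD(1)[OF g(1)]]] .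
    then show ?thesis
      using y c_conj by (simp only: N_def mem_Collect_eq simp_thms)
  qed
  define Y where "Y n = iter_comm ((Aut_tree d)\<lparr>carrier := G\<rparr>) x n g" for n
  have xG: "x \<in> G" using x H by blast
  have Y_Suc: "Y (Suc n) = (g \<circ> Y n \<circ> finv g) \<circ> finv (Y n)" for n
    unfolding Y_def using iter_comm_subgroup(2)[OF G xG g(1)] .
  have Y: "Y n \<in> N" for n
  proof (induction n)
    case 0
    show ?case using xA cxu XP by (auto simp: Y_def N_def X_def)
  next
    case (Suc n)
    then show ?case unfolding Y_Suc by (intro N_comp N_conj N_inv)
  qed
  define F where "F n k = \<chi> (restrict_below u (c k (Y n)))" for n k
  have F_Suc: "F (Suc n) k = F n (Suc k) - F n k" for n k
  proof -
    have y: "Y n \<in> ?A" "c k (Y n) u = u" "restrict_below u (c k (Y n)) \<in> P" for k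
      using Y[of n] by (auto simp: N_def)
    have "finv (Y n) \<in> N" using Y N_inv by blast
    then have i: "c k (finv (Y n)) \<in> ?A" "c k (finv (Y n)) u = u"
      "restrict_below u (c k (finv (Y n))) \<in> P" using c_in by (auto simp: N_def)
    have "restrict_below u (c k (Y (Suc n))) =
        restrict_below u (c (Suc k) (Y n)) \<circ> restrict_below u (c k (finv (Y n)))"
      unfolding Y_Suc c_comp[of k "g \<circ> Y n \<circ> finv g"] c_conj restrict_below_comp[OF i(1) u i(2)] ..
    then have "F (Suc n) k = F n (Suc k) + \<chi> (restrict_below u (c k (finv (Y n))))"
      unfolding F_def using \<chi> y(3) i(3) by simp
    also have "restrict_below u (c k (finv (Y n))) = finv (restrict_below u (c k (Y n)))"
      unfolding c_finv[OF y(1)] using restrict_below_finv[OF c_in[OF y(1)] u y(2)] .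
    finally show ?thesis using \<chi>_inv[OF y(3)] by (simp add: F_def)
  qed
  have "F n k = 0" for k
    using engel gk[of k] by (simp add: F_def Y_def \<chi>_id c_def)
  moreover have "infinite {k. F 0 k = 0}"
    unfolding infinite_nat_iff_unbounded_le
  proof
    fix m
    have "gk m u \<noteq> u \<or> gk (Suc m) u \<noteq> u"
      using g(2) gk_Suc Aut_tree_inj[OF gk] by (metis comp_apply)
    then have "F 0 m = 0 \<or> F 0 (Suc m) = 0"
      using rest by (auto simp: F_def Y_def \<chi>_id)
    moreover have "m \<le> Suc m" by simp
    ultimately show "\<exists>n\<ge>m. n \<in> {k. F 0 k = 0}" by blast
  qed
  ultimately have "F 0 k = 0" for k
    using forward_difference_zero[of F n k, OF F_Suc] by blast
  then have \<chi>X: "\<chi> f = 0" if "f \<in> X" for f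
    using that by (auto simp: X_def F_def Y_def)
  have "\<chi> f = 0" if "f \<in> P" for f
    using that unfolding P_def
  proof (induction f rule: generate.induct)
    case one
    show ?case by (simp only: Aut_tree_simps \<chi>_id)
  next
    case (incl f)
    then show ?case by (rule \<chi>X)
  next
    case (inv f)
    then have "f \<in> P" using XP by blast
    then show ?case using \<chi>_inv \<chi>X inv PD(1) by (simp add: inv_Aut_tree)
  next
    case (eng f f')
    then show ?case using \<chi> unfolding P_def[symmetric] by (simp only: Aut_tree_simps)
  qed
  then show False using h by blast
qed

lemma left_engel_trivial:
  assumes G: "subgroup G (Aut_tree d)" and H: "subgroup H (Aut_tree d)" "H \<subseteq> G"
    and normal: "\<And>g y. g \<in> G \<Longrightarrow> y \<in> H \<Longrightarrow> g \<circ> y \<circ> finv g \<in> H"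
    and char: "\<And>P. subgroup P (Aut_tree d) \<Longrightarrow> P \<subseteq> H \<Longrightarrow> P \<noteq> {id} \<Longrightarrow> has_character P"
    and branch: "\<And>u. u \<in> vertices d \<Longrightarrow>
      \<exists>x\<in>H. x \<noteq> id \<and> (\<forall>v\<in>vertices d. take (length u) v \<noteq> u \<longrightarrow> x v = v)"
  shows "left_engel ((Aut_tree d)\<lparr>carrier := G\<rparr>) = {\<one>\<^bsub>Aut_tree d\<^esub>}"
proof -
  let ?G = "(Aut_tree d)\<lparr>carrier := G\<rparr>"
  note GD = subgroup_Aut_treeD[OF G]
  have "g = id" if "g \<in> left_engel ?G" for g
  proof (rule ccontr)
    assume "g \<noteq> id"
    have g: "g \<in> G" and engel: "\<forall>x\<in>G. \<exists>n. iter_comm ?G x n g = id"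
      using that by (auto simp: left_engel_def)
    obtain u where u: "u \<in> vertices d" "g u \<noteq> u"
      using \<open>g \<noteq> id\<close> Aut_tree_outside[OF GD(1)[OF g]] by (auto simp: fun_eq_iff)
    obtain x where x: "x \<in> H" "x \<noteq> id" "\<And>v. v \<in> vertices d \<Longrightarrow> take (length u) v \<noteq> u \<Longrightarrow> x v = v"
      using branch[OF u(1)] by blast
    then show False
      using not_left_engel_if_moves[OF G H normal[OF g] char u(1) g u(2) x] engel H by blast
  qed
  moreover have "id \<in> left_engel ?G"
  proof -
    have "iter_comm ?G x 1 id = id" if "x \<in> G" for x
      using iter_comm_subgroup(2)[OF G that GD(2), of 0] GD(1)[OF that] by simp
    then show ?thesis using GD(2) by (auto simp: left_engel_def)
  qed
  ultimately show ?thesis by auto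
qed

section \<open>Self-similar groups of words\<close>

text \<open>The letters name generators, \<open>step\<close> is their action on the first level, and
  \<open>out\<close> gives a word for each section. Inverses are not built in: the binary groups
  have extra letters for them, the GGS-group writes them as powers.\<close>

locale automaton =
  fixes d :: nat and ev :: "'l \<Rightarrow> nat list \<Rightarrow> nat list"
    and step :: "'l \<Rightarrow> nat \<Rightarrow> nat" and out :: "'l \<Rightarrow> nat \<Rightarrow> 'l list"
  assumes ev_Aut: "ev l \<in> carrier (Aut_tree d)"
    and step_in: "x \<in> {1..d} \<Longrightarrow> step l x \<in> {1..d}"
    and ev_Cons: "x \<in> {1..d} \<Longrightarrow> v \<in> vertices d \<Longrightarrow> ev l (x # v) = step l x # fold ev (out l x) v"
begin

text \<open>\<open>fold ev w\<close> is the automorphism represented by the word \<open>w\<close>, and \<open>sec w x\<close> is a word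
  for its section at \<open>x\<close>.\<close>

primrec sec :: "'l list \<Rightarrow> nat \<Rightarrow> 'l list" where
  "sec [] x = []"
| "sec (l # w) x = out l x @ sec w (step l x)"

lemma fold_Aut: "fold ev w \<in> carrier (Aut_tree d)"
proof (induction w)
  case (Cons l w)
  then show ?case unfolding fold.simps by (rule Aut_tree_comp[OF _ ev_Aut])
qed (simp only: fold.simps id_Aut_tree)

lemma fold_step_in: "x \<in> {1..d} \<Longrightarrow> fold step w x \<in> {1..d}"
  by (induction w arbitrary: x) (use step_in in auto)

lemma fold_Cons:
  assumes "x \<in> {1..d}" "v \<in> vertices d"
  shows "fold ev w (x # v) = fold step w x # fold ev (sec w x) v"
  using assms
proof (induction w arbitrary: x v)
  case (Cons l w)
  have "fold ev (out l x) v \<in> vertices d"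
    using Cons.prems fold_Aut by simp
  then show ?case
    using ev_Cons[OF Cons.prems] Cons.IH[OF step_in[OF Cons.prems(1)]] by simp
qed simp

lemma fold_section:
  assumes "x \<in> {1..d}"
  shows "tree_section d [x] (fold ev w) = fold ev (sec w x)"
  using fold_Cons[OF assms] Aut_tree_outside[OF fold_Aut] by (auto simp: tree_section_def fun_eq_iff)

lemma fold_st1:
  assumes "\<And>x. x \<in> {1..d} \<Longrightarrow> fold step w x = x"
  shows "fold ev w \<in> st1 d"
  using fold_Aut[of w] fold_Aut[of "sec w x" for x] fold_Cons[of _ "[]" w] assms
  by (auto simp: st1_def Aut_tree_iff)

lemma fold_eq_id:
  assumes "fold ev w = id" "x \<in> {1..d}"
  shows "fold step w x = x" "fold ev (sec w x) = id"
proof -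
  have "fold step w x # fold ev (sec w x) v = x # v" if "v \<in> vertices d" for v
    using fold_Cons[OF assms(2) that, of w] assms(1) by simp
  then show "fold step w x = x" "fold ev (sec w x) = id"
    using Aut_tree_outside[OF fold_Aut] by (auto simp: fun_eq_iff) (metis vertices_simps(1))
qed

text \<open>Vanishing on trivial words makes \<open>f\<close> depend on the automorphism only: two
  words for the same element are compared by appending a word for its inverse to both. The condition
  on the kernel is the self-similarity that \<open>has_character_if_self_similar\<close> asks
  for.\<close>

lemma has_character_words:
  fixes f :: "'l list \<Rightarrow> int"
  assumes append: "\<And>u v. u \<in> W \<Longrightarrow> v \<in> W \<Longrightarrow> u @ v \<in> W \<and> f (u @ v) = f u + f v"
    and inverse: "\<And>u. u \<in> W \<Longrightarrow> \<exists>v\<in>W. fold ev v = finv (fold ev u)"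
    and trivial: "\<And>u. u \<in> W \<Longrightarrow> fold ev u = id \<Longrightarrow> f u = 0"
    and kernel: "\<And>u x. u \<in> W \<Longrightarrow> f u = 0 \<Longrightarrow> x \<in> {1..d} \<Longrightarrow> fold step u x = x \<and> sec u x \<in> W"
    and P: "subgroup P (Aut_tree d)" "P \<subseteq> fold ev ` W" "P \<noteq> {id}"
  shows "has_character P"
proof -
  have wd: "f u = f v" if uv: "u \<in> W" "v \<in> W" "fold ev u = fold ev v" for u v
  proof -
    obtain v' where v': "v' \<in> W" "fold ev v' = finv (fold ev v)" using inverse uv(2) by blast
    have "fold ev (u @ v') = id" "fold ev (v @ v') = id"
      using uv(3) v'(2) Aut_tree_finv_cancel(4)[OF fold_Aut] by (simp_all add: fold_append)
    then have "f u + f v' = 0" "f v + f v' = 0"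
      using append uv v'(1) trivial by metis+
    then show ?thesis by simp
  qed
  define \<tau> where "\<tau> g = real_of_int (f (SOME u. u \<in> W \<and> fold ev u = g))" for g
  have \<tau>: "\<tau> (fold ev u) = f u" if "u \<in> W" for u
  proof -
    have "\<exists>v. v \<in> W \<and> fold ev v = fold ev u" using that by blast
    then have "(SOME v. v \<in> W \<and> fold ev v = fold ev u) \<in> W \<and>
        fold ev (SOME v. v \<in> W \<and> fold ev v = fold ev u) = fold ev u" by (rule someI_ex)
    then show ?thesis using wd[OF _ that] unfolding \<tau>_def by auto
  qed
  show ?thesis
  proof (rule has_character_if_self_similar[of "fold ev ` W" d \<tau>])
    fix g h assume "g \<in> fold ev ` W" "h \<in> fold ev ` W"
    then obtain u v where uv: "u \<in> W" "v \<in> W" "g = fold ev u" "h = fold ev v" by blast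
    then have "g \<circ> h = fold ev (v @ u)" by (simp only: fold_append)
    then show "\<tau> (g \<circ> h) = \<tau> g + \<tau> h" using uv append \<tau> by (simp only: of_int_add)
  next
    fix g assume "g \<in> fold ev ` W" "\<tau> g = 0"
    then obtain u where u: "u \<in> W" "g = fold ev u" "f u = 0" using \<tau> by auto
    then show "g \<in> st1 d" using kernel fold_st1 by simp
    fix x assume "x \<in> {1..d}"
    then show "tree_section d [x] g \<in> fold ev ` W" using u kernel fold_section by simp
  next
    show "\<not> P \<subseteq> {id}" using P(3) subgroup_Aut_treeD(2)[OF P(1)] by blast
  qed (use P(2) fold_Aut subgroup_Aut_treeD(3)[OF P(1)] in \<open>blast+\<close>)
qed

lemma subgroup_fold:
  assumes "[] \<in> W" "\<And>u v. u \<in> W \<Longrightarrow> v \<in> W \<Longrightarrow> u @ v \<in> W"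
    and "\<And>u. u \<in> W \<Longrightarrow> \<exists>v\<in>W. fold ev v = finv (fold ev u)"
  shows "subgroup (fold ev ` W) (Aut_tree d)"
proof (rule subgroup_Aut_treeI)
  show "fold ev ` W \<subseteq> carrier (Aut_tree d)" using fold_Aut by blast
  show "id \<in> fold ev ` W" using assms(1) by force
next
  fix g h assume "g \<in> fold ev ` W" "h \<in> fold ev ` W"
  then obtain u v where uv: "u \<in> W" "v \<in> W" "g = fold ev u" "h = fold ev v" by blast
  then have "g \<circ> h = fold ev (v @ u)" by (simp only: fold_append)
  then show "g \<circ> h \<in> fold ev ` W" using uv assms(2) by blast
next
  fix g assume "g \<in> fold ev ` W"
  then obtain u where "u \<in> W" "g = fold ev u" by blast
  then show "finv g \<in> fold ev ` W" using assms(3) by (metis imageI)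
qed

lemma generate_eq_range_fold:
  assumes "S \<subseteq> range ev" "range ev \<subseteq> generate (Aut_tree d) S"
    and inv: "\<And>l. \<exists>w. fold ev w = finv (ev l)"
  shows "generate (Aut_tree d) S = range (fold ev)"
    and "\<exists>v. fold ev v = finv (fold ev u)"
proof -
  show inverse: "\<exists>v. fold ev v = finv (fold ev u)" for u
  proof (induction u)
    case Nil
    have "fold ev [] = finv (fold ev [])" by simp
    then show ?case by blast
  next
    case (Cons l u)
    then obtain v where v: "fold ev v = finv (fold ev u)" by blast
    obtain w where "fold ev w = finv (ev l)" using inv by blast
    then have "fold ev (v @ w) = finv (fold ev (l # u))"
      using v Aut_tree_finv_comp[OF fold_Aut ev_Aut, of u l] by (simp only: fold_append fold.simps)
    then show ?case by blast
  qed
  have sub: "subgroup (range (fold ev)) (Aut_tree d)"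
    by (rule subgroup_fold) (use inverse in auto)
  have "S \<subseteq> carrier (Aut_tree d)" using assms(1) ev_Aut by blast
  then have gen: "subgroup (generate (Aut_tree d) S) (Aut_tree d)"
    by (rule group.generate_is_subgroup[OF group_Aut_tree])
  have "ev l \<in> range (fold ev)" for l by (rule range_eqI[of _ _ "[l]"]) simp
  then have "S \<subseteq> range (fold ev)" using assms(1) by blast
  then have "generate (Aut_tree d) S \<subseteq> range (fold ev)"
    using group.generate_subgroup_incl[OF group_Aut_tree _ sub] by blast
  moreover have "fold ev w \<in> generate (Aut_tree d) S" for w
  proof (induction w)
    case Nil
    show ?case using subgroup_Aut_treeD(2)[OF gen] by (simp only: fold.simps)
  next
    case (Cons l w)
    then show ?case
      unfolding fold.simps using assms(2) by (intro subgroup_Aut_treeD(3)[OF gen]) auto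
  qed
  ultimately show "generate (Aut_tree d) S = range (fold ev)" by blast
qed

end

text \<open>In the Basilica and the Brunner-Sidki-Vieira group every generator has exactly one
  nontrivial section, and it is again a generator or the inverse of one. The weights \<open>f\<close> and
  \<open>f \<circ> sub\<close> extend to homomorphisms to the integers.\<close>

locale binary_automaton =
  fixes ev :: "'l \<Rightarrow> nat list \<Rightarrow> nat list" and f :: "'l \<Rightarrow> int" and sub :: "'l \<Rightarrow> 'l"
  assumes ev_Aut_2: "ev l \<in> carrier (Aut_tree 2)"
    and f_range: "f l \<in> {-1, 0, 1}"
    and f_sub_sub: "f (sub (sub l)) = f l"
    and ev_Cons_2: "x \<in> {1, 2} \<Longrightarrow> v \<in> vertices 2 \<Longrightarrow> ev l (x # v) =
      (if f l = 0 then x else 3 - x) # (if x = (if f l = -1 then 1 else 2) then ev (sub l) v else v)"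
    and ev_inverse: "\<exists>w. fold ev w = finv (ev l)"
begin

definition step :: "'l \<Rightarrow> nat \<Rightarrow> nat"
  where "step l x = (if f l = 0 then x else 3 - x)"

definition out :: "'l \<Rightarrow> nat \<Rightarrow> 'l list"
  where "out l x = (if x = (if f l = -1 then 1 else 2) then [sub l] else [])"

lemma atLeastAtMost_1_2: "{1..2} = {1, 2::nat}"
  by auto

lemma step_out:
  "f l = -1 \<and> step l (Suc 0) = 2 \<and> step l 2 = Suc 0 \<and> out l (Suc 0) = [sub l] \<and> out l 2 = [] \<or>
   f l = 0 \<and> step l (Suc 0) = Suc 0 \<and> step l 2 = 2 \<and> out l (Suc 0) = [] \<and> out l 2 = [sub l] \<or>
   f l = 1 \<and> step l (Suc 0) = 2 \<and> step l 2 = Suc 0 \<and> out l (Suc 0) = [] \<and> out l 2 = [sub l]"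
  using f_range[of l] by (auto simp: step_def out_def)

sublocale automaton 2 ev step out
  using ev_Aut_2 ev_Cons_2 by unfold_locales (auto simp: step_def out_def atLeastAtMost_1_2)

definition weight :: "('l \<Rightarrow> int) \<Rightarrow> 'l list \<Rightarrow> int"
  where "weight h w = sum_list (map h w)"

text \<open>Every letter \<open>l\<close> passes exactly one letter, \<open>sub l\<close>, to
  exactly one of the two sections.\<close>

lemma weight_sec: "weight h (sec w 1) + weight h (sec w 2) = weight (\<lambda>l. h (sub l)) w"
proof (induction w)
  case (Cons l w)
  then show ?case
    using step_out[of l] by (auto simp: weight_def)
qed (simp add: weight_def)

lemma length_sec: "length (sec w 1) + length (sec w 2) = length w"
proof -
  have "weight (\<lambda>_. 1) w = int (length w)" for w by (induction w) (simp_all add: weight_def)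
  then show ?thesis using weight_sec[of "\<lambda>_. 1" w] by (simp flip: of_nat_add)
qed

lemma fold_step: "x \<in> {1, 2} \<Longrightarrow> fold step w x = (if even (weight f w) then x else 3 - x)"
proof (induction w arbitrary: x)
  case (Cons l w)
  have "step l x \<in> {1, 2}" using Cons.prems by (auto simp: step_def)
  then show ?case
    using Cons.IH[of "step l x"] Cons.prems step_out[of l]
    by (auto simp: weight_def)
qed (simp add: weight_def)

text \<open>A letter \<open>l\<close> leaves its section at the place \<open>x\<close> with \<open>f l = x - step l x\<close>; hence the
  weight telescopes if all letters leave theirs on the same path.\<close>

lemma weight_if_sec_Nil:
  "x \<in> {1, 2} \<Longrightarrow> sec w (3 - x) = [] \<Longrightarrow> weight f w = int x - int (fold step w x)"
proof (induction w arbitrary: x)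
  case (Cons l w)
  have "step l x \<in> {1, 2}" "3 - step l x = step l (3 - x)" "f l = int x - int (step l x)"
    using Cons.prems step_out[of l] by auto
  then show ?case
    using Cons.IH[of "step l x"] Cons.prems(2) by (simp add: weight_def)
qed (simp add: weight_def)

text \<open>The sections of a trivial word are trivial and their lengths add up to that of the word.
  If both are nonempty, they are shorter, and \<open>weight_sec\<close> carries the two weights
  back, exchanging them. If one is empty, the other is as long as the word and induction says
  nothing; but then the first weight telescopes, and the second is the first weight of that other
  section.\<close>

lemma weight_if_trivial:
  assumes "fold ev w = id"
  shows "weight f w = 0 \<and> weight (\<lambda>l. f (sub l)) w = 0"
  using assms
proof (induction w rule: length_induct)
  case (1 w)
  have triv: "fold ev (sec u x) = id" "fold step u x = x" if "fold ev u = id" "x \<in> {1, 2}" for u x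
    using fold_eq_id[OF that(1), of x] that(2) by auto
  have IH: "weight f (sec u x) = 0" "weight (\<lambda>l. f (sub l)) (sec u x) = 0"
    if "fold ev u = id" "length u = length w" "\<forall>x\<in>{1, 2}. sec u x \<noteq> []" "x \<in> {1, 2}" for u x
  proof -
    have "length (sec u 1) > 0" "length (sec u 2) > 0" using that(3) by auto
    then have "length (sec u 1) < length w" "length (sec u 2) < length w"
      using length_sec[of u] that(2) by linarith+
    then have "length (sec u x) < length w" using that(4) by auto
    then show "weight f (sec u x) = 0" "weight (\<lambda>l. f (sub l)) (sec u x) = 0"
      using 1(1) triv(1)[OF that(1,4)] by blast+
  qed
  \<comment> \<open>Needed for all trivial words of the length of \<open>w\<close>, because it is
    applied below to a section of this very length as well.\<close>
  have f: "weight f u = 0" if u: "fold ev u = id" "length u = length w" for u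
  proof (cases "\<exists>x\<in>{1, 2}. sec u x = []")
    case True
    then obtain x where "x \<in> {1, 2}" "sec u x = []" by blast
    then have "3 - x \<in> {1, 2}" "sec u (3 - (3 - x)) = []" by auto
    then show ?thesis using weight_if_sec_Nil triv(2)[OF u(1)] by simp
  next
    case False
    then show ?thesis using IH[OF u] weight_sec[of "\<lambda>l. f (sub l)" u] by (simp add: f_sub_sub)
  qed
  have "weight f (sec w x) = 0" if "x \<in> {1, 2}" for x
  proof (cases "\<exists>x\<in>{1, 2}. sec w x = []")
    case True
    then have "sec w x = [] \<or> length (sec w x) = length w"
      using that length_sec[of w] by auto
    then show ?thesis using f[OF triv(1)[OF 1(2) that]] by (auto simp: weight_def)
  qed (use IH[OF 1(2)] that in blast)
  then show ?case using f[OF 1(2)] weight_sec[of f w] by simp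
qed

lemma has_character_binary:
  assumes "subgroup P (Aut_tree 2)" "P \<subseteq> range (fold ev)" "P \<noteq> {id}"
    and "\<And>u. \<exists>v. fold ev v = finv (fold ev u)"
  shows "has_character P"
proof (rule has_character_words[of UNIV "weight f"])
  fix u x assume "weight f u = 0" "x \<in> {1..2::nat}"
  then show "fold step u x = x \<and> sec u x \<in> UNIV" using fold_step[of x u] by (auto simp: le_Suc_eq numeral_2_eq_2)
qed (use assms weight_if_trivial in \<open>auto simp: weight_def\<close>)

end

section \<open>Elements supported below a vertex\<close>

definition place :: "nat \<Rightarrow> nat \<Rightarrow> (nat list \<Rightarrow> nat list) \<Rightarrow> nat list \<Rightarrow> nat list"
  where "place d i x v = (if v \<in> vertices d \<and> v \<noteq> [] \<and> hd v = i then i # x (tl v) else v)"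

text \<open>A relation rather than a use of \<open>psi\<close>: the sections \<open>F\<close> are
  given explicitly, so that those of products and inverses are computed place by place.\<close>

definition level1 :: "nat \<Rightarrow> (nat list \<Rightarrow> nat list) \<Rightarrow> (nat \<Rightarrow> nat list \<Rightarrow> nat list) \<Rightarrow> bool"
  where "level1 d f F \<longleftrightarrow> f \<in> carrier (Aut_tree d) \<and>
    (\<forall>j\<in>{1..d}. F j \<in> carrier (Aut_tree d) \<and> (\<forall>v\<in>vertices d. f (j # v) = j # F j v))"

lemma level1D:
  assumes "level1 d f F"
  shows "f \<in> carrier (Aut_tree d)" "j \<in> {1..d} \<Longrightarrow> F j \<in> carrier (Aut_tree d)"
    and "j \<in> {1..d} \<Longrightarrow> v \<in> vertices d \<Longrightarrow> f (j # v) = j # F j v"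
  using assms by (auto simp: level1_def)

lemma level1_id: "level1 d id (\<lambda>_. id)"
  using id_Aut_tree by (simp add: level1_def)

lemma level1_comp:
  assumes f: "level1 d f F" and g: "level1 d g G"
  shows "level1 d (f \<circ> g) (\<lambda>j. F j \<circ> G j)"
  unfolding level1_def
proof (intro conjI ballI)
  show "f \<circ> g \<in> carrier (Aut_tree d)" using level1D(1)[OF f] level1D(1)[OF g] by (rule Aut_tree_comp)
  fix j assume j: "j \<in> {1..d}"
  show "F j \<circ> G j \<in> carrier (Aut_tree d)"
    using level1D(2)[OF f j] level1D(2)[OF g j] by (rule Aut_tree_comp)
  fix v assume "v \<in> vertices d"
  then show "(f \<circ> g) (j # v) = j # (F j \<circ> G j) v"
    using level1D[OF f] level1D[OF g] j by simp
qed

lemma level1_finv: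
  assumes f: "level1 d f F"
  shows "level1 d (finv f) (\<lambda>j. finv (F j))"
  unfolding level1_def
proof (intro conjI ballI)
  show "finv f \<in> carrier (Aut_tree d)" using level1D(1)[OF f] by (rule inv_fun_Aut_tree)
  fix j assume j: "j \<in> {1..d}"
  show F: "finv (F j) \<in> carrier (Aut_tree d)" using level1D(2)[OF f j] by (rule inv_fun_Aut_tree)
  fix v assume "v \<in> vertices d"
  then have "f (j # finv (F j) v) = j # v"
    using level1D(3)[OF f j, of "finv (F j) v"] level1D(2)[OF f j] F by simp
  then show "finv f (j # v) = j # finv (F j) v"
    using Aut_tree_finv_cancel(2)[OF level1D(1)[OF f]] by metis
qed

lemma level1_eqI:
  assumes f: "level1 d f F" and g: "level1 d g G" and "\<And>j. j \<in> {1..d} \<Longrightarrow> F j = G j"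
  shows "f = g"
proof (rule Aut_tree_eqI[OF level1D(1)[OF f] level1D(1)[OF g]])
  fix v assume "v \<in> vertices d"
  then show "f v = g v"
    using level1D[OF f] level1D[OF g] assms(3) by (cases v) (auto simp: Aut_tree_iff)
qed

lemma level1_place:
  assumes x: "x \<in> carrier (Aut_tree d)" and i: "i \<in> {1..d}"
  shows "level1 d (place d i x) (\<lambda>j. if j = i then x else id)"
proof -
  let ?gs = "map (\<lambda>j. if j = i then x else id) [1..<Suc d]"
  have nth: "?gs ! (j - 1) = (if j = i then x else id)" if "j \<in> {1..d}" for j
    using that by (auto simp del: upt_Suc)
  have "spine d ?gs \<in> st1 d"
    by (rule spine_st1) (use x id_Aut_tree in \<open>auto simp del: upt_Suc\<close>)
  moreover have "spine d ?gs v = place d i x v" for v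
  proof (cases v)
    case (Cons j w)
    then show ?thesis
      using nth[of j] by (cases "v \<in> vertices d") (auto simp: place_def simp del: upt_Suc)
  qed (simp add: place_def)
  then have "spine d ?gs = place d i x" by blast
  ultimately have "place d i x \<in> carrier (Aut_tree d)"
    unfolding st1_def by (metis (no_types, lifting) mem_Collect_eq)
  then show ?thesis
    using x id_Aut_tree by (auto simp: level1_def place_def)
qed

text \<open>For \<open>J = {}\<close> this is the projection to the place \<open>i\<close> of the
  elements of \<open>N\<close> fixing the first level; at the places in \<open>J\<close> the
  sections have to be trivial. With all other places in \<open>J\<close> it describes the rigid
  stabilizer of \<open>i\<close> in \<open>N\<close>.\<close>

definition coord :: "nat \<Rightarrow> (nat list \<Rightarrow> nat list) set \<Rightarrow> nat \<Rightarrow> nat set \<Rightarrow> (nat list \<Rightarrow> nat list) set"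
  where "coord d N i J = {k. \<exists>f\<in>N. \<exists>F. level1 d f F \<and> F i = k \<and> (\<forall>j\<in>J. F j = id)}"

lemma coordI:
  "f \<in> N \<Longrightarrow> level1 d f F \<Longrightarrow> F i = k \<Longrightarrow> (\<And>j. j \<in> J \<Longrightarrow> F j = id) \<Longrightarrow> k \<in> coord d N i J"
  unfolding coord_def by blast

lemma coordE:
  assumes "k \<in> coord d N i J"
  obtains f F where "f \<in> N" "level1 d f F" "F i = k" "\<forall>j\<in>J. F j = id"
  using assms unfolding coord_def by blast

lemma subgroup_coord:
  assumes N: "subgroup N (Aut_tree d)" and i: "i \<in> {1..d}"
  shows "subgroup (coord d N i J) (Aut_tree d)"
proof (rule subgroup_Aut_treeI)
  note ND = subgroup_Aut_treeD[OF N]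
  show "coord d N i J \<subseteq> carrier (Aut_tree d)"
    using level1D(2)[OF _ i] by (auto elim: coordE)
  show "id \<in> coord d N i J" by (rule coordI[OF ND(2) level1_id]) auto
  show "k \<circ> l \<in> coord d N i J" if kl: "k \<in> coord d N i J" "l \<in> coord d N i J" for k l
  proof -
    obtain f F where f: "f \<in> N" "level1 d f F" "F i = k" "\<forall>j\<in>J. F j = id"
      using kl(1) by (rule coordE)
    obtain g G where g: "g \<in> N" "level1 d g G" "G i = l" "\<forall>j\<in>J. G j = id"
      using kl(2) by (rule coordE)
    show ?thesis
      by (rule coordI[OF ND(3)[OF f(1) g(1)] level1_comp[OF f(2) g(2)]]) (simp_all add: f g)
  qed
  show "finv k \<in> coord d N i J" if k: "k \<in> coord d N i J" for k
  proof -
    obtain f F where f: "f \<in> N" "level1 d f F" "F i = k" "\<forall>j\<in>J. F j = id"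
      using k by (rule coordE)
    show ?thesis
      by (rule coordI[OF ND(4)[OF f(1)] level1_finv[OF f(2)]]) (simp_all add: f)
  qed
qed

definition commutator :: "('a \<Rightarrow> 'a) \<Rightarrow> ('a \<Rightarrow> 'a) \<Rightarrow> 'a \<Rightarrow> 'a"
  where "commutator k l = k \<circ> l \<circ> finv k \<circ> finv l"

lemma commutator_eq_id_iff:
  assumes "k \<in> carrier (Aut_tree d)" "l \<in> carrier (Aut_tree d)"
  shows "commutator k l = id \<longleftrightarrow> k \<circ> l = l \<circ> k"
proof
  assume "commutator k l = id"
  then have "commutator k l (l (k v)) = l (k v)" for v by simp
  then show "k \<circ> l = l \<circ> k"
    using Aut_tree_finv_cancel[OF assms(1)] Aut_tree_finv_cancel[OF assms(2)]
    by (simp add: commutator_def fun_eq_iff)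
next
  assume "k \<circ> l = l \<circ> k"
  then have "commutator k l = l \<circ> k \<circ> finv k \<circ> finv l" by (simp add: commutator_def)
  then show "commutator k l = id"
    using Aut_tree_finv_cancel[OF assms(1)] Aut_tree_finv_cancel[OF assms(2)] by (simp add: fun_eq_iff)
qed

lemma commutator_closed:
  "subgroup N (Aut_tree d) \<Longrightarrow> k \<in> N \<Longrightarrow> l \<in> N \<Longrightarrow> commutator k l \<in> N"
  unfolding commutator_def by (intro subgroup_Aut_treeD)

lemma commutator_conj:
  assumes "g \<in> carrier (Aut_tree d)" "k \<in> carrier (Aut_tree d)" "l \<in> carrier (Aut_tree d)"
  shows "finv g \<circ> commutator k l \<circ> g = commutator (finv g \<circ> k \<circ> g) (finv g \<circ> l \<circ> g)"
proof -
  have "finv (finv g \<circ> x \<circ> g) = finv g \<circ> finv x \<circ> g" if "x \<in> carrier (Aut_tree d)" for x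
    using Aut_tree_finv_comp[OF Aut_tree_comp[OF inv_fun_Aut_tree[OF assms(1)] that] assms(1)]
      Aut_tree_finv_comp[OF inv_fun_Aut_tree[OF assms(1)] that] Aut_tree_finv_cancel(5)[OF assms(1)]
    by (simp only: o_assoc)
  then show ?thesis
    using Aut_tree_finv_cancel(1)[OF assms(1)] assms by (simp add: commutator_def fun_eq_iff)
qed

text \<open>Commuting two elements kills all sections at which one of them is trivial.\<close>

lemma place_commutator:
  assumes N: "subgroup N (Aut_tree d)" "subgroup N' (Aut_tree d)" and i: "i \<in> {1..d}"
    and k: "k \<in> coord d N i J" and l: "l \<in> coord d N' i J'" and J: "{1..d} \<subseteq> insert i (J \<union> J')"
  obtains f g where "f \<in> N" "g \<in> N'" "place d i (commutator k l) = commutator f g"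
proof -
  obtain f F where f: "f \<in> N" "level1 d f F" "F i = k" "\<forall>j\<in>J. F j = id"
    using k by (rule coordE)
  obtain g G where g: "g \<in> N'" "level1 d g G" "G i = l" "\<forall>j\<in>J'. G j = id"
    using l by (rule coordE)
  have *: "level1 d (commutator f g) (\<lambda>j. commutator (F j) (G j))"
    unfolding commutator_def by (intro level1_comp level1_finv f(2) g(2))
  have kl: "k \<in> carrier (Aut_tree d)" "l \<in> carrier (Aut_tree d)"
    using level1D(2)[OF f(2) i] level1D(2)[OF g(2) i] f(3) g(3) by simp_all
  have "commutator k l \<in> carrier (Aut_tree d)"
    unfolding commutator_def by (intro Aut_tree_comp inv_fun_Aut_tree kl)
  from level1_place[OF this i] have "place d i (commutator k l) = commutator f g"
  proof (rule level1_eqI[OF _ *])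
    fix j assume j: "j \<in> {1..d}"
    show "(if j = i then commutator k l else id) = commutator (F j) (G j)"
    proof (cases "j = i")
      case False
      then have "j \<in> J \<or> j \<in> J'" using J j by blast
      then have "F j \<circ> G j = G j \<circ> F j" using f(4) g(4) by auto
      then show ?thesis
        using False commutator_eq_id_iff[OF level1D(2)[OF f(2) j] level1D(2)[OF g(2) j]] by simp
    qed (simp add: f g)
  qed
  then show ?thesis using that f(1) g(1) by blast
qed

text \<open>\<open>place\<close> is applied once for each letter of \<open>u\<close>, starting with
  the last. \<open>D\<close> is a mere set, so that a set of commutators can serve.\<close>

lemma exists_supported_below:
  assumes D: "D \<subseteq> carrier (Aut_tree d)" "x \<in> D" "x \<noteq> id"
    and place: "\<And>x i. x \<in> D \<Longrightarrow> i \<in> {1..d} \<Longrightarrow> place d i x \<in> D"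
    and u: "u \<in> vertices d"
  shows "\<exists>x\<in>D. x \<noteq> id \<and> (\<forall>v\<in>vertices d. take (length u) v \<noteq> u \<longrightarrow> x v = v)"
  using u
proof (induction u)
  case Nil
  have "\<forall>v\<in>vertices d. take (length []) v \<noteq> [] \<longrightarrow> x v = v" by simp
  then show ?case using D(2,3) by blast
next
  case (Cons i u)
  then have "u \<in> vertices d" by simp
  from Cons.IH[OF this] obtain x where
    x: "x \<in> D" "x \<noteq> id" "\<forall>v\<in>vertices d. take (length u) v \<noteq> u \<longrightarrow> x v = v"
    by blast
  have i: "i \<in> {1..d}" using Cons.prems by simp
  obtain v where "v \<in> vertices d" "x v \<noteq> v"
    using x(1,2) D(1) Aut_tree_outside[of x d] by (auto simp: fun_eq_iff)
  then have "place d i x (i # v) \<noteq> i # v" using i by (simp add: place_def)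
  then have "place d i x \<noteq> id" by (metis id_apply)
  moreover have "place d i x v = v" if "v \<in> vertices d" "take (length (i # u)) v \<noteq> i # u" for v
    using that x(3) by (cases v) (auto simp: place_def)
  ultimately show ?case using place[OF x(1) i] by blast
qed

lemma subset_coord_if_generators:
  assumes N: "subgroup N (Aut_tree d)" and i: "i \<in> {1..d}"
    and "S \<subseteq> coord d N i J" "g \<in> generate (Aut_tree d) S"
  shows "g \<in> coord d N i J"
  using group.generate_subgroup_incl[OF group_Aut_tree assms(3) subgroup_coord[OF N i]] assms(4)
  by blast

text \<open>The elements of \<open>G\<close> whose copies below the vertex 2, with trivial section
  at 1, lie in \<open>G\<close> again.\<close>

definition rigid_coord :: "(nat list \<Rightarrow> nat list) set \<Rightarrow> (nat list \<Rightarrow> nat list) set"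
  where "rigid_coord G = G \<inter> coord 2 G 2 {1}"

text \<open>The projection at the place 2 covers \<open>G\<close>, so each \<open>g\<close> in
  \<open>G\<close> is the section at 2 of some \<open>h\<close> in \<open>G\<close>. Conjugating
  \<open>(1, k)\<close> by \<open>h\<close> conjugates \<open>k\<close> by \<open>g\<close> and
  leaves the section at 1 trivial.\<close>

lemma binary_rigid_coord:
  assumes G: "G = generate (Aut_tree 2) S" "S \<subseteq> carrier (Aut_tree 2)"
    and onto: "S \<subseteq> coord 2 G 2 {}"
  shows "subgroup (rigid_coord G) (Aut_tree 2)"
    and "g \<in> G \<Longrightarrow> k \<in> rigid_coord G \<Longrightarrow> g \<circ> k \<circ> finv g \<in> rigid_coord G"
    and "g \<in> G \<Longrightarrow> k \<in> rigid_coord G \<Longrightarrow> finv g \<circ> k \<circ> g \<in> rigid_coord G"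
proof -
  have sub: "subgroup G (Aut_tree 2)"
    unfolding G(1) by (rule group.generate_is_subgroup[OF group_Aut_tree G(2)])
  note GD = subgroup_Aut_treeD[OF sub]
  show "subgroup (rigid_coord G) (Aut_tree 2)"
    unfolding rigid_coord_def
    by (rule group.subgroups_Inter_pair[OF group_Aut_tree sub subgroup_coord[OF sub]]) simp
  show conj: "g \<circ> k \<circ> finv g \<in> rigid_coord G" if g: "g \<in> G" and k: "k \<in> rigid_coord G" for g k
  proof -
    have "g \<in> coord 2 G 2 {}"
      using g subset_coord_if_generators[OF sub _ onto] G(1) by simp
    then obtain h H where h: "h \<in> G" "level1 2 h H" "H 2 = g" by (rule coordE)
    have "k \<in> coord 2 G 2 {1}" using k by (simp add: rigid_coord_def)
    then obtain f F where f: "f \<in> G" "level1 2 f F" "F 2 = k" "\<forall>j\<in>{1}. F j = id"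
      by (rule coordE)
    have "g \<circ> k \<circ> finv g \<in> coord 2 G 2 {1}"
    proof (rule coordI)
      show "h \<circ> f \<circ> finv h \<in> G" by (intro GD(3,4) h f)
      show "level1 2 (h \<circ> f \<circ> finv h) (\<lambda>j. H j \<circ> F j \<circ> finv (H j))"
        by (intro level1_comp level1_finv h f)
      show "H j \<circ> F j \<circ> finv (H j) = id" if "j \<in> {1}" for j
        using that f(4) Aut_tree_finv_cancel(3)[OF level1D(2)[OF h(2)], of 1] by simp
    qed (simp add: h f)
    moreover have "g \<circ> k \<circ> finv g \<in> G"
      using k by (intro GD(3,4) g) (simp add: rigid_coord_def)
    ultimately show ?thesis by (simp only: rigid_coord_def Int_iff)
  qed
  show "finv g \<circ> k \<circ> g \<in> rigid_coord G" if g: "g \<in> G" and k: "k \<in> rigid_coord G"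
    using conj[OF GD(4)[OF g] k] Aut_tree_finv_cancel(5)[OF GD(1)[OF g]] by simp
qed

text \<open>The commutators of elements of \<open>G\<close> with elements of \<open>rigid_coord G\<close> (in either
  order) are stable under \<open>place\<close>: at the vertex 2 by \<open>place_commutator\<close>, at the
  vertex 1 by conjugation with \<open>t\<close>.\<close>

lemma binary_branch:
  assumes G: "G = generate (Aut_tree 2) S" "S \<subseteq> carrier (Aut_tree 2)"
    and onto: "S \<subseteq> coord 2 (rigid_coord G) 2 {}"
    and t: "t \<in> G" "\<And>v. v \<in> vertices 2 \<Longrightarrow> t (1 # v) = 2 # v \<and> hd (t (2 # v)) = 1"
    and m: "m \<in> rigid_coord G" "g \<in> G" "m \<circ> g \<noteq> g \<circ> m"
    and u: "u \<in> vertices 2"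
  shows "\<exists>x\<in>G. x \<noteq> id \<and> (\<forall>v\<in>vertices 2. take (length u) v \<noteq> u \<longrightarrow> x v = v)"
proof -
  let ?M = "rigid_coord G"
  have sub: "subgroup G (Aut_tree 2)"
    unfolding G(1) by (rule group.generate_is_subgroup[OF group_Aut_tree G(2)])
  note GD = subgroup_Aut_treeD[OF sub]
  have MG: "?M \<subseteq> G" by (auto simp: rigid_coord_def)
  have "S \<subseteq> coord 2 G 2 {}" using onto MG unfolding coord_def by blast
  note M = binary_rigid_coord[OF G this]
  define D where "D = {commutator k l | k l. k \<in> ?M \<and> l \<in> G} \<union> {commutator l k | k l. k \<in> ?M \<and> l \<in> G}"
  have DG: "D \<subseteq> G" using commutator_closed[OF sub] MG by (auto simp: D_def)
  \<comment> \<open>Here \<open>l\<close> becomes a section at 2 of an element of \<open>?M\<close>,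
    while \<open>k\<close> in \<open>?M\<close> is one of an element of \<open>G\<close> trivial at
    1. The copy of a commutator of \<open>k\<close> and \<open>l\<close> is the commutator of these
    lifts, with the roles of \<open>G\<close> and \<open>?M\<close> exchanged; this is why
    \<open>D\<close> contains both orders.\<close>
  have lift: "l \<in> coord 2 ?M 2 {}" if "l \<in> G" for l
    using that subset_coord_if_generators[OF M(1) _ onto] G(1) by simp
  have place2: "place 2 2 x \<in> D" if "x \<in> D" for x
  proof -
    have "\<exists>k\<in>?M. \<exists>l\<in>G. x = commutator k l \<or> x = commutator l k"
      using that unfolding D_def by blast
    then obtain k l where kl: "k \<in> ?M" "l \<in> G" "x = commutator k l \<or> x = commutator l k"
      by blast
    have k: "k \<in> coord 2 G 2 {1}" using kl(1) by (simp add: rigid_coord_def)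
    have J: "{1..2} \<subseteq> insert 2 ({1} \<union> {} :: nat set)" "{1..2} \<subseteq> insert 2 ({} \<union> {1::nat})" by auto
    have 2: "2 \<in> {1..2::nat}" by simp
    show ?thesis
      using kl(3)
    proof
      assume "x = commutator k l"
      moreover obtain f h where "f \<in> G" "h \<in> ?M" "place 2 2 (commutator k l) = commutator f h"
        by (rule place_commutator[OF sub M(1) 2 k lift[OF kl(2)] J(1)])
      ultimately show ?thesis unfolding D_def by blast
    next
      assume "x = commutator l k"
      moreover obtain f h where "f \<in> ?M" "h \<in> G" "place 2 2 (commutator l k) = commutator f h"
        by (rule place_commutator[OF M(1) sub 2 lift[OF kl(2)] k J(2)])
      ultimately show ?thesis unfolding D_def by blast
    qed
  qed
  have conj: "finv t \<circ> x \<circ> t \<in> D" if "x \<in> D" for x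
  proof -
    have "\<exists>k\<in>?M. \<exists>l\<in>G. x = commutator k l \<or> x = commutator l k"
      using that unfolding D_def by blast
    then obtain k l where kl: "k \<in> ?M" "l \<in> G" "x = commutator k l \<or> x = commutator l k"
      by blast
    have A: "t \<in> carrier (Aut_tree 2)" "k \<in> carrier (Aut_tree 2)" "l \<in> carrier (Aut_tree 2)"
      using kl t(1) MG GD(1) by blast+
    have "finv t \<circ> k \<circ> t \<in> ?M" using M(3)[OF t(1) kl(1)] .
    moreover have "finv t \<circ> l \<circ> t \<in> G" by (intro GD(3,4) t(1) kl(2))
    ultimately show ?thesis
      using kl(3) commutator_conj[OF A] commutator_conj[OF A(1,3,2)] unfolding D_def by blast
  qed
  \<comment> \<open>Having trivial section at 1, \<open>t\<close> maps the subtree below 1 rigidly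
    onto the one below 2.\<close>
  have place1: "place 2 1 x = finv t \<circ> place 2 2 x \<circ> t" if x: "x \<in> carrier (Aut_tree 2)" for x
  proof (rule Aut_tree_eqI)
    have tA: "t \<in> carrier (Aut_tree 2)" using t(1) GD(1) by blast
    have pl: "place 2 i x \<in> carrier (Aut_tree 2)" if "i \<in> {1..2}" for i
      using level1D(1)[OF level1_place[OF x that]] .
    show "place 2 1 x \<in> carrier (Aut_tree 2)" by (rule pl) simp
    show "finv t \<circ> place 2 2 x \<circ> t \<in> carrier (Aut_tree 2)"
      by (intro Aut_tree_comp inv_fun_Aut_tree tA pl) simp
    fix v :: "nat list" assume "v \<in> vertices 2"
    then show "place 2 1 x v = (finv t \<circ> place 2 2 x \<circ> t) v"
    proof (induction v rule: vertex_2_induct)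
      case Nil
      have "t [] = []" using tA by (simp add: Aut_tree_iff)
      then show ?case using Aut_tree_finv_cancel(2)[OF tA, of "[]"] by (simp add: place_def)
    next
      case (one w)
      then have "x w \<in> vertices 2" using x by simp
      then have "finv t (2 # x w) = 1 # x w"
        using t(2)[of "x w"] Aut_tree_finv_cancel(2)[OF tA, of "1 # x w"] by simp
      then show ?case using one t(2)[of w] by (simp add: place_def)
    next
      case (two w)
      then have "place 2 2 x (t (2 # w)) = t (2 # w)" using t(2)[of w] by (auto simp: place_def)
      then show ?case using two Aut_tree_finv_cancel(2)[OF tA] by (simp add: place_def)
    qed
  qed
  have "commutator m g \<in> D" using m unfolding D_def by blast
  moreover have "commutator m g \<noteq> id"
    using commutator_eq_id_iff[of m 2 g] m MG GD(1) by blast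
  moreover have "place 2 i x \<in> D" if "x \<in> D" "i \<in> {1..2}" for x i
  proof -
    have "i = 1 \<or> i = 2" using that(2) by auto
    then show ?thesis
      using place2[OF that(1)] conj[OF place2[OF that(1)]] place1[of x] that(1) DG GD(1) by auto
  qed
  ultimately have "\<exists>x\<in>D. x \<noteq> id \<and> (\<forall>v\<in>vertices 2. take (length u) v \<noteq> u \<longrightarrow> x v = v)"
    using DG GD(1) u by (intro exists_supported_below) blast+
  then show ?thesis using DG by blast
qed

section \<open>The Basilica group and the Brunner-Sidki-Vieira group\<close>

lemma subgroup_generated_Aut_tree:
  assumes "S \<subseteq> carrier (Aut_tree d)"
  shows "subgroup_generated (Aut_tree d) S = (Aut_tree d)\<lparr>carrier := generate (Aut_tree d) S\<rparr>"
  using assms by (simp add: subgroup_generated_def Int_absorb1)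

lemma finv_generate:
  assumes "S \<subseteq> carrier (Aut_tree d)" "f \<in> S"
  shows "finv f \<in> generate (Aut_tree d) S"
  using generate.inv[OF assms(2), of "Aut_tree d"] inv_Aut_tree[of f d] assms by auto

theorem (in binary_automaton) left_engel_binary:
  assumes S: "S \<subseteq> range ev" "range ev \<subseteq> generate (Aut_tree 2) S"
    and branch: "\<And>u. u \<in> vertices 2 \<Longrightarrow> \<exists>x\<in>generate (Aut_tree 2) S. x \<noteq> id \<and>
      (\<forall>v\<in>vertices 2. take (length u) v \<noteq> u \<longrightarrow> x v = v)"
  shows "left_engel (subgroup_generated (Aut_tree 2) S) = {\<one>\<^bsub>Aut_tree 2\<^esub>}"
proof -
  have SA: "S \<subseteq> carrier (Aut_tree 2)" using S(1) ev_Aut by blast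
  note gen = generate_eq_range_fold[OF S ev_inverse]
  have sub: "subgroup (generate (Aut_tree 2) S) (Aut_tree 2)"
    by (rule group.generate_is_subgroup[OF group_Aut_tree SA])
  note GD = subgroup_Aut_treeD[OF sub]
  show ?thesis
    unfolding subgroup_generated_Aut_tree[OF SA]
  proof (rule left_engel_trivial[OF sub sub subset_refl])
    show "g \<circ> y \<circ> finv g \<in> generate (Aut_tree 2) S"
      if "g \<in> generate (Aut_tree 2) S" "y \<in> generate (Aut_tree 2) S" for g y
      using that by (intro GD(3,4))
    show "has_character P"
      if "subgroup P (Aut_tree 2)" "P \<subseteq> generate (Aut_tree 2) S" "P \<noteq> {id}" for P
      using has_character_binary[OF that(1) _ that(3) gen(2)] that(2) gen(1) by simp
  qed (rule branch)
qed

lemma finv_eqI: "f \<in> carrier (Aut_tree d) \<Longrightarrow> f u = v \<Longrightarrow> finv f v = u"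
  using Aut_tree_finv_cancel(2) by blast

fun signed :: "(nat list \<Rightarrow> nat list) \<Rightarrow> (nat list \<Rightarrow> nat list) \<Rightarrow> bool \<times> bool \<Rightarrow> nat list \<Rightarrow> nat list"
  where "signed f g (k, s) = (let h = if k then f else g in if s then h else finv h)"

lemma range_signed: "range (signed f g) = {f, g, finv f, finv g}"
proof
  show "range (signed f g) \<subseteq> {f, g, finv f, finv g}" by (auto simp: Let_def)
  have "f = signed f g (True, True)" "g = signed f g (False, True)"
    "finv f = signed f g (True, False)" "finv g = signed f g (False, False)" by simp_all
  then show "{f, g, finv f, finv g} \<subseteq> range (signed f g)" by blast
qed

lemma signed_inverse:
  assumes "f \<in> carrier (Aut_tree d)" "g \<in> carrier (Aut_tree d)"
  shows "\<exists>w. fold (signed f g) w = finv (signed f g l)"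
proof -
  obtain k s where l: "l = (k, s)" by (cases l)
  have "fold (signed f g) [(k, \<not> s)] = finv (signed f g l)"
    using assms by (simp add: l Let_def)
  then show ?thesis by blast
qed

lemma range_signed_generate:
  assumes "f \<in> carrier (Aut_tree d)" "g \<in> carrier (Aut_tree d)"
  shows "{f, g} \<subseteq> range (signed f g)" "range (signed f g) \<subseteq> generate (Aut_tree d) {f, g}"
  using finv_generate[of "{f, g}" d] assms unfolding range_signed by (auto intro: generate.incl)

lemma level1_2I:
  assumes "f \<in> carrier (Aut_tree 2)" "F 1 \<in> carrier (Aut_tree 2)" "F 2 \<in> carrier (Aut_tree 2)"
    and "\<And>v. v \<in> vertices 2 \<Longrightarrow> f (1 # v) = 1 # F 1 v \<and> f (2 # v) = 2 # F 2 v"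
  shows "level1 2 f F"
proof -
  have "j = 1 \<or> j = 2" if "j \<in> {1..2}" for j :: nat using that by auto
  then show ?thesis using assms unfolding level1_def by blast
qed

lemma basilica_eqs:
  assumes ab: "basilica_generators a b"
  shows "a \<in> carrier (Aut_tree 2)" "b \<in> carrier (Aut_tree 2)"
    and "w \<in> vertices 2 \<Longrightarrow> a (1 # w) = 1 # w" "w \<in> vertices 2 \<Longrightarrow> a (2 # w) = 2 # b w"
    and "w \<in> vertices 2 \<Longrightarrow> b (1 # w) = 2 # w" "w \<in> vertices 2 \<Longrightarrow> b (2 # w) = 1 # a w"
proof -
  show A: "a \<in> carrier (Aut_tree 2)" "b \<in> carrier (Aut_tree 2)"
    using ab unfolding basilica_generators_def by blast+
  have "a = from_sections 2 [\<one>\<^bsub>Aut_tree 2\<^esub>, b]"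
    and "b = from_sections 2 [\<one>\<^bsub>Aut_tree 2\<^esub>, a] \<otimes>\<^bsub>Aut_tree 2\<^esub> rooted 2 (transpose 1 2)"
    using ab unfolding basilica_generators_def by blast+
  then have a: "a = from_sections 2 [id, b] \<otimes>\<^bsub>Aut_tree 2\<^esub> rooted 2 id"
    and b: "b = from_sections 2 [id, a] \<otimes>\<^bsub>Aut_tree 2\<^esub> rooted 2 (transpose 1 2)" by simp_all
  assume w: "w \<in> vertices 2"
  show "a (1 # w) = 1 # w" "a (2 # w) = 2 # b w"
    using spine_rooted_2[OF a id_Aut_tree A(2) w] by simp_all
  show "b (1 # w) = 2 # w" "b (2 # w) = 1 # a w"
    using spine_rooted_2[OF b id_Aut_tree A(1) w] by simp_all
qed

lemma bsv_eqs:
  assumes cd: "bsv_generators c d"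
  shows "c \<in> carrier (Aut_tree 2)" "d \<in> carrier (Aut_tree 2)"
    and "w \<in> vertices 2 \<Longrightarrow> c (1 # w) = 2 # w" "w \<in> vertices 2 \<Longrightarrow> c (2 # w) = 1 # finv c w"
    and "w \<in> vertices 2 \<Longrightarrow> d (1 # w) = 2 # w" "w \<in> vertices 2 \<Longrightarrow> d (2 # w) = 1 # d w"
proof -
  show A: "c \<in> carrier (Aut_tree 2)" "d \<in> carrier (Aut_tree 2)"
    using cd unfolding bsv_generators_def by blast+
  have c: "c = from_sections 2 [id, finv c] \<otimes>\<^bsub>Aut_tree 2\<^esub> rooted 2 (transpose 1 2)"
    and d: "d = from_sections 2 [id, d] \<otimes>\<^bsub>Aut_tree 2\<^esub> rooted 2 (transpose 1 2)"
    using cd inv_Aut_tree[OF A(1)] unfolding bsv_generators_def by simp_all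
  assume w: "w \<in> vertices 2"
  show "c (1 # w) = 2 # w" "c (2 # w) = 1 # finv c w"
    using spine_rooted_2[OF c id_Aut_tree inv_fun_Aut_tree[OF A(1)] w] by simp_all
  show "d (1 # w) = 2 # w" "d (2 # w) = 1 # d w"
    using spine_rooted_2[OF d id_Aut_tree A(2) w] by simp_all
qed

theorem left_engel_basilica:
  assumes ab: "basilica_generators a b"
  shows "left_engel (subgroup_generated (Aut_tree 2) {a, b}) = {\<one>\<^bsub>Aut_tree 2\<^esub>}"
proof -
  note A = basilica_eqs(1,2)[OF ab] and eqs = basilica_eqs(3-)[OF ab]
  note A' = inv_fun_Aut_tree[OF A(1)] inv_fun_Aut_tree[OF A(2)]
  have eqs': "finv a (1 # w) = 1 # w" "finv a (2 # w) = 2 # finv b w"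
    "finv b (2 # w) = 1 # w" "finv b (1 # w) = 2 # finv a w" if w: "w \<in> vertices 2" for w
  proof -
    have "finv a w \<in> vertices 2" "finv b w \<in> vertices 2" using A' w by simp_all
    then show "finv a (1 # w) = 1 # w" "finv a (2 # w) = 2 # finv b w"
      "finv b (2 # w) = 1 # w" "finv b (1 # w) = 2 # finv a w"
      using eqs w A Aut_tree_finv_cancel(1)[OF A(1)] Aut_tree_finv_cancel(1)[OF A(2)]
      by (auto intro!: finv_eqI)
  qed
  \<comment> \<open>The weight is the exponent sum of \<open>b\<close>. As \<open>sub\<close>
    exchanges \<open>a\<close> and \<open>b\<close> and keeps the sign, the second weight is the
    exponent sum of \<open>a\<close>.\<close>
  interpret binary_automaton "signed a b" "\<lambda>(k, s). if k then 0 else if s then 1 else - 1"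
    "\<lambda>(k, s). (\<not> k, s)"
  proof
    show "signed a b l \<in> carrier (Aut_tree 2)" for l
      using A A' by (cases l) (simp add: Let_def)
    show "\<exists>w. fold (signed a b) w = finv (signed a b l)" for l
      using A by (rule signed_inverse)
  next
    fix x :: nat and v and l :: "bool \<times> bool"
    assume x: "x \<in> {1, 2}" and v: "v \<in> vertices 2"
    obtain k s where l: "l = (k, s)" by (cases l)
    show "signed a b l (x # v) =
      (if (case l of (k, s) \<Rightarrow> if k then 0 else if s then 1 else - 1) = (0 :: int) then x else 3 - x) #
      (if x = (if (case l of (k, s) \<Rightarrow> if k then 0 else if s then 1 else - 1) = (- 1 :: int) then 1 else 2)
       then signed a b (case l of (k, s) \<Rightarrow> (\<not> k, s)) v else v)"
      using x eqs[OF v] eqs'[OF v] unfolding l by (cases k; cases s) auto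
  qed (auto split: if_splits)
  let ?G = "generate (Aut_tree 2) {a, b}"
  have S: "{a, b} \<subseteq> carrier (Aut_tree 2)" using A by simp
  have sub: "subgroup ?G (Aut_tree 2)"
    by (rule group.generate_is_subgroup[OF group_Aut_tree S])
  note GD = subgroup_Aut_treeD[OF sub]
  have G: "a \<in> ?G" "b \<in> ?G" by (auto intro: generate.incl)
  let ?M = "rigid_coord ?G"
  have la: "level1 2 a (\<lambda>j. if j = 1 then id else b)"
    by (rule level1_2I) (use A id_Aut_tree eqs in auto)
  have lbb: "level1 2 (b \<circ> b) (\<lambda>j. a)"
    by (rule level1_2I) (use A eqs in \<open>auto intro: Aut_tree_comp\<close>)
  \<comment> \<open>The section at 2 of \<open>a\<close> is \<open>b\<close>, and that of the square
    of \<open>b\<close> is \<open>a\<close>.\<close>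
  have "{a, b} \<subseteq> coord 2 ?G 2 {}"
    using coordI[OF GD(3)[OF G(2) G(2)] lbb, where i = 2 and k = a and J = "{}"] coordI[OF G(1) la, where i = 2 and k = b and J = "{}"] by simp
  note M = binary_rigid_coord[OF refl S this]
  note MD = subgroup_Aut_treeD[OF M(1)]
  have bM: "b \<in> ?M"
    unfolding rigid_coord_def using G(2) coordI[OF G(1) la, where i = 2 and k = b and J = "{1}"] by simp
  have lb: "level1 2 (finv b \<circ> finv a \<circ> b) (\<lambda>j. if j = 1 then finv b else id)"
    by (rule level1_2I) (use A A' id_Aut_tree eqs eqs' in \<open>auto intro!: Aut_tree_comp\<close>)
  \<comment> \<open>A product of a conjugate of the inverse of \<open>b\<close> with
    \<open>b\<close>, hence in the normal subgroup \<open>?M\<close>. Regrouped as \<open>a\<close>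
    times a conjugate of the inverse of \<open>a\<close>, it has section \<open>b\<close> at 2,
    since that conjugate is trivial there.\<close>
  have "a \<circ> finv b \<circ> finv a \<circ> b \<in> ?M"
    by (intro MD(3) M(2) MD(4) bM G)
  then have "a \<circ> (finv b \<circ> finv a \<circ> b) \<in> ?M" by (simp only: o_assoc)
  from coordI[OF this level1_comp[OF la lb], where i = 2 and k = b and J = "{}"] have "b \<in> coord 2 ?M 2 {}" by simp
  moreover have "a \<in> coord 2 ?M 2 {}"
    using coordI[OF MD(3)[OF bM bM] lbb, where i = 2 and k = a and J = "{}"] by simp
  ultimately have onto: "{a, b} \<subseteq> coord 2 ?M 2 {}" by simp
  have "(b \<circ> a) [2, 1] \<noteq> (a \<circ> b) [2, 1]"
    using eqs[of "[1]"] eqs[of "[2]"] eqs[of "[]"] A by (auto simp: Aut_tree_iff)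
  then have "b \<circ> a \<noteq> a \<circ> b" by metis
  note branch = binary_branch[OF refl S onto G(2) _ bM G(1) this]
  show ?thesis
  proof (rule left_engel_binary[OF range_signed_generate[OF A]])
    fix u :: "nat list" assume "u \<in> vertices 2"
    then show "\<exists>x\<in>?G. x \<noteq> id \<and> (\<forall>v\<in>vertices 2. take (length u) v \<noteq> u \<longrightarrow> x v = v)"
      by (rule branch[rotated]) (use eqs in simp)
  qed
qed

theorem left_engel_bsv:
  assumes cd: "bsv_generators c d"
  shows "left_engel (subgroup_generated (Aut_tree 2) {c, d}) = {\<one>\<^bsub>Aut_tree 2\<^esub>}"
proof -
  note A = bsv_eqs(1,2)[OF cd] and eqs = bsv_eqs(3-)[OF cd]
  note A' = inv_fun_Aut_tree[OF A(1)] inv_fun_Aut_tree[OF A(2)]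
  have eqs': "finv c (2 # w) = 1 # w" "finv c (1 # w) = 2 # c w"
    "finv d (2 # w) = 1 # w" "finv d (1 # w) = 2 # finv d w" if w: "w \<in> vertices 2" for w
  proof -
    have "c w \<in> vertices 2" "finv d w \<in> vertices 2" using A A' w by simp_all
    then show "finv c (2 # w) = 1 # w" "finv c (1 # w) = 2 # c w"
      "finv d (2 # w) = 1 # w" "finv d (1 # w) = 2 # finv d w"
      using eqs w A Aut_tree_finv_cancel(2)[OF A(1)] Aut_tree_finv_cancel(1)[OF A(2)]
      by (auto intro!: finv_eqI)
  qed
  \<comment> \<open>The weight is the total exponent sum. \<open>sub\<close> inverts
    \<open>c\<close> and keeps \<open>d\<close>, so the second weight is the exponent sum of
    \<open>d\<close> minus that of \<open>c\<close>.\<close>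
  interpret binary_automaton "signed c d" "\<lambda>(k, s). if s then 1 else - 1" "\<lambda>(k, s). (k, s \<noteq> k)"
  proof
    show "signed c d l \<in> carrier (Aut_tree 2)" for l
      using A A' by (cases l) (simp add: Let_def)
    show "\<exists>w. fold (signed c d) w = finv (signed c d l)" for l
      using A by (rule signed_inverse)
  next
    fix x :: nat and v and l :: "bool \<times> bool"
    assume x: "x \<in> {1, 2}" and v: "v \<in> vertices 2"
    obtain k s where l: "l = (k, s)" by (cases l)
    show "signed c d l (x # v) =
      (if (case l of (k, s) \<Rightarrow> if s then 1 else - 1) = (0 :: int) then x else 3 - x) #
      (if x = (if (case l of (k, s) \<Rightarrow> if s then 1 else - 1) = (- 1 :: int) then 1 else 2)
       then signed c d (case l of (k, s) \<Rightarrow> (k, s \<noteq> k)) v else v)"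
      using x eqs[OF v] eqs'[OF v] unfolding l by (cases k; cases s) auto
  qed (auto split: if_splits)
  let ?G = "generate (Aut_tree 2) {c, d}"
  have S: "{c, d} \<subseteq> carrier (Aut_tree 2)" using A by simp
  have sub: "subgroup ?G (Aut_tree 2)"
    by (rule group.generate_is_subgroup[OF group_Aut_tree S])
  note GD = subgroup_Aut_treeD[OF sub]
  have G: "c \<in> ?G" "d \<in> ?G" by (auto intro: generate.incl)
  let ?M = "rigid_coord ?G"
  have lcd: "level1 2 (c \<circ> d) (\<lambda>j. if j = 1 then finv c else d)"
    by (rule level1_2I) (use A A' eqs in \<open>auto intro!: Aut_tree_comp\<close>)
  have ldc: "level1 2 (d \<circ> c) (\<lambda>j. if j = 1 then d else finv c)"
    by (rule level1_2I) (use A A' eqs in \<open>auto intro!: Aut_tree_comp\<close>)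
  have gens: "{c, d} \<subseteq> coord 2 N 2 {}" if N: "subgroup N (Aut_tree 2)" "c \<circ> d \<in> N" "d \<circ> c \<in> N" for N
    using coordI[OF subgroup_Aut_treeD(4)[OF N(1,3)] level1_finv[OF ldc], where i = 2 and k = c and J = "{}"]
      coordI[OF N(2) lcd, where i = 2 and k = d and J = "{}"] A by simp
  note M = binary_rigid_coord[OF refl S gens[OF sub GD(3)[OF G] GD(3)[OF G(2,1)]]]
  note MD = subgroup_Aut_treeD[OF M(1)]
  \<comment> \<open>In \<open>finv d \<circ> c\<close> the section at 1 cancels and \<open>m\<close>
    remains at 2. As \<open>m\<close> is the inverse of \<open>c \<circ> d\<close>, this puts
    \<open>c \<circ> d\<close> and its conjugate \<open>d \<circ> c\<close> into
    \<open>?M\<close>.\<close>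
  define m where "m = finv d \<circ> finv c"
  have m: "finv m = c \<circ> d"
    using Aut_tree_finv_comp[OF A'(2,1)] A by (simp add: m_def)
  have "level1 2 (finv d \<circ> c) (\<lambda>j. if j = 1 then id else m)"
    unfolding m_def
    by (rule level1_2I) (use A A' id_Aut_tree eqs eqs' in \<open>auto intro!: Aut_tree_comp\<close>)
  from coordI[OF GD(3)[OF GD(4)[OF G(2)] G(1)] this, where i = 2 and k = m and J = "{1}"]
  have mM: "m \<in> ?M"
    unfolding rigid_coord_def m_def using GD(3)[OF GD(4)[OF G(2)] GD(4)[OF G(1)]] by simp
  then have cdM: "c \<circ> d \<in> ?M" using MD(4) m by metis
  have "finv c \<circ> (c \<circ> d) \<circ> c \<in> ?M" by (rule M(3)[OF G(1) cdM])
  then have "d \<circ> c \<in> ?M" using A by (simp add: o_assoc)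
  note onto = gens[OF M(1) cdM this]
  have "(d \<circ> c) [2, 1, 1] \<noteq> (c \<circ> d) [2, 1, 1]"
    using eqs[of "[1]"] eqs'[of "[1]"] eqs[of "[1, 1]"] eqs[of "[2]"] eqs[of "[2, 1]"] eqs[of "[2, 2]"] eqs[of "[]"]  A A'
    by (auto simp: Aut_tree_iff)
  \<comment> \<open>If \<open>c\<close> commuted with the inverse of \<open>c \<circ> d\<close>, it
    would commute with \<open>d\<close>.\<close>
  have "m \<circ> c \<noteq> c \<circ> m"
  proof
    assume mc: "m \<circ> c = c \<circ> m"
    have "d (m (c (c (d v)))) = d (c (m (c (d v))))" for v
      using fun_cong[OF mc, of "c (d v)"] by simp
    then have "c (d v) = d (c v)" for v
      using Aut_tree_finv_cancel[OF A(1)] Aut_tree_finv_cancel[OF A(2)] by (simp add: m_def)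
    then show False using \<open>(d \<circ> c) [2, 1, 1] \<noteq> (c \<circ> d) [2, 1, 1]\<close> by simp
  qed
  note branch = binary_branch[OF refl S onto G(2) _ mM G(1) this]
  show ?thesis
  proof (rule left_engel_binary[OF range_signed_generate[OF A]])
    fix u :: "nat list" assume "u \<in> vertices 2"
    then show "\<exists>x\<in>?G. x \<noteq> id \<and> (\<forall>v\<in>vertices 2. take (length u) v \<noteq> u \<longrightarrow> x v = v)"
      by (rule branch[rotated]) (use eqs in simp)
  qed
qed

section \<open>The GGS-group with constant defining vector\<close>

locale constant_ggs =
  fixes p :: nat and a b :: "nat list \<Rightarrow> nat list"
  assumes three_le: "3 \<le> p" and generators: "ggs_constant_generators p a b"
begin

section \<open>The generators of the GGS-group as an automaton\<close>

definition next_letter :: "nat \<Rightarrow> nat"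
  where "next_letter x = (if x = p then 1 else Suc x)"

lemma next_letter_in: "x \<in> {1..p} \<Longrightarrow> next_letter x \<in> {1..p}"
  by (auto simp: next_letter_def)

lemma a_Aut: "a \<in> carrier (Aut_tree p)" and b_Aut: "b \<in> carrier (Aut_tree p)"
  using generators unfolding ggs_constant_generators_def by blast+

lemma a_Cons:
  assumes "x \<in> {1..p}" "v \<in> vertices p"
  shows "a (x # v) = next_letter x # v"
proof -
  have "a = rooted p (cycle_of_list [1..<Suc p])"
    using generators unfolding ggs_constant_generators_def by blast
  then show ?thesis
    using assms cycle_of_list_upt[OF assms(1)] by (simp add: next_letter_def del: upt_Suc)
qed

lemma b_Cons:
  assumes "x \<in> {1..p}" "v \<in> vertices p"
  shows "b (x # v) = x # (if x = p then b v else a v)"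
proof -
  have "b = from_sections p (replicate (p - 1) a @ [b])"
    using generators unfolding ggs_constant_generators_def by blast
  also have "\<dots> = spine p (replicate (p - 1) a @ [b])"
    using a_Aut b_Aut three_le by (intro from_sections_eq) auto
  finally have "b (x # v) = spine p (replicate (p - 1) a @ [b]) (x # v)"
    by (rule fun_cong)
  also have "\<dots> = x # (if x = p then b v else a v)"
    using assms by (auto simp: nth_append)
  finally show ?thesis .
qed

lemma finv_a_Cons:
  assumes "x \<in> {1..p}" "v \<in> vertices p"
  shows "finv a (next_letter x # v) = x # v"
  using finv_eqI[OF a_Aut] a_Cons[OF assms] by blast

text \<open>\<open>True\<close> stands for \<open>b\<close> and \<open>False\<close> for
  \<open>a\<close>; accordingly the section of \<open>b\<close> at \<open>x\<close> is the letter
  \<open>x = p\<close>.\<close>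

definition ev :: "bool \<Rightarrow> nat list \<Rightarrow> nat list" where "ev l = (if l then b else a)"
definition step :: "bool \<Rightarrow> nat \<Rightarrow> nat" where "step l x = (if l then x else next_letter x)"
definition out :: "bool \<Rightarrow> nat \<Rightarrow> bool list" where "out l x = (if l then [x = p] else [])"

sublocale automaton p ev step out
proof
  fix l x and v :: "nat list" assume "x \<in> {1..p}" "v \<in> vertices p"
  then show "ev l (x # v) = step l x # fold ev (out l x) v"
    using a_Cons b_Cons by (simp add: ev_def step_def out_def)
qed (use a_Aut b_Aut next_letter_in in \<open>auto simp: ev_def step_def\<close>)

lemma step_out_simps [simp]:
  "step True x = x" "step False x = next_letter x" "out True x = [x = p]" "out False x = []"
  by (simp_all add: step_def out_def)

abbreviation count :: "bool list \<Rightarrow> nat" where "count w \<equiv> length (filter (\<lambda>l. l) w)"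
abbreviation cocount :: "bool list \<Rightarrow> nat" where "cocount w \<equiv> length (filter Not w)"

lemma count_plus_cocount: "count w + cocount w = length w"
  by (induction w) auto

text \<open>Each \<open>b\<close> puts one letter into every section, each \<open>a\<close>
  none.\<close>

lemma length_sec: "length (sec w x) = count w"
  proof (induction w arbitrary: x)
  case (Cons l w)
  then show ?case by (cases l) simp_all
qed simp

lemma fold_step_mod: "x \<in> {1..p} \<Longrightarrow> fold step w x mod p = (x + cocount w) mod p"
proof (induction w arbitrary: x)
  case (Cons l w)
  have "step l x mod p = (x + cocount [l]) mod p"
    using three_le by (auto simp: step_def next_letter_def mod_Suc)
  then have "(step l x + cocount w) mod p = (x + cocount (l # w)) mod p"
    using mod_add_cong[of "step l x" p "x + cocount [l]" "cocount w" "cocount w"] by (cases l) auto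
  then show ?case using Cons.IH[OF step_in[OF Cons.prems]] by simp
qed simp

lemma mod_inj: "x \<in> {1..p} \<Longrightarrow> y \<in> {1..p} \<Longrightarrow> x mod p = y mod p \<Longrightarrow> x = y"
  by (cases "x = p"; cases "y = p") auto

lemma fold_step_eq_iff: "x \<in> {1..p} \<Longrightarrow> fold step w x = x \<longleftrightarrow> p dvd cocount w"
proof
  assume x: "x \<in> {1..p}"
  { assume "fold step w x = x"
    then have "(x + cocount w) mod p = (x + 0) mod p" using fold_step_mod[OF x, of w] by simp
    then have "(int x + int (cocount w)) mod int p = (int x + 0) mod int p"
      by (metis add.right_neutral of_nat_add of_nat_mod)
    then have "int p dvd int (cocount w)" by (simp add: mod_eq_dvd_iff)
    then show "p dvd cocount w" by simp }
  assume "p dvd cocount w"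
  then have "fold step w x mod p = x mod p" using fold_step_mod[OF x, of w] by (auto elim!: dvdE)
  then show "fold step w x = x" using mod_inj[OF fold_step_in[OF x] x] by simp
qed

text \<open>\<open>a\<close> and \<open>b\<close> act on the quotient of the group by the derived subgroup of the normal
  closure of \<open>b a\<inverse>\<close> as rotations of order \<open>p\<close>. The translation part of a word is the formal sum of the positions (modulo
  \<open>p\<close>) of its letters \<open>b\<close>, taken modulo the sum of all positions; \<open>wt w c\<close> is the value at it of
  the linear form with coefficients \<open>c\<close>.\<close>

primrec wt :: "bool list \<Rightarrow> (int \<Rightarrow> int) \<Rightarrow> int" where
  "wt [] c = 0"
| "wt (l # w) c = (if l then c 0 else 0) + wt w (\<lambda>j. c (j + 1))"

section \<open>Linear forms on the translation part\<close>

definition periodic :: "(int \<Rightarrow> int) \<Rightarrow> bool"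
  where "periodic c \<longleftrightarrow> (\<forall>j. c (j + int p) = c j)"

lemma periodicD: "periodic c \<Longrightarrow> c (j + int p) = c j"
  by (simp add: periodic_def)

lemma periodic_shift: "periodic c \<Longrightarrow> periodic (\<lambda>j. c (j + k))"
  using periodicD[of c "j + k" for j] by (simp add: periodic_def algebra_simps)

lemma periodic_multiple:
  assumes "periodic c" "p dvd n"
  shows "c (j + int n) = c j"
proof -
  obtain q where "n = p * q" using assms(2) by (rule dvdE)
  moreover have "c (j + int (p * q)) = c j"
  proof (induction q)
    case (Suc q)
    then show ?case using periodicD[OF assms(1), of "j + int (p * q)"] by (simp add: algebra_simps)
  qed simp
  ultimately show ?thesis by simp
qed

lemma sum_periodic_Suc:
  assumes "periodic c"
  shows "(\<Sum>x\<in>{1..p}. c (int x + 1)) = (\<Sum>x\<in>{1..p}. c (int x))"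
proof -
  have "(\<Sum>x\<in>{1..p}. c (int x + 1)) = (\<Sum>x\<in>{Suc 1..Suc p}. c (int x))"
    unfolding sum.shift_bounds_cl_Suc_ivl by (simp add: add.commute)
  moreover have "(\<Sum>x\<in>{1..Suc p}. c (int x)) = c 1 + (\<Sum>x\<in>{Suc 1..Suc p}. c (int x))"
    by (subst sum.atLeast_Suc_atMost) simp_all
  moreover have "c (int (Suc p)) = c 1"
    using periodicD[OF assms, of 1] by (simp add: add.commute)
  ultimately show ?thesis by simp
qed

lemma sum_periodic_shift:
  assumes "periodic c"
  shows "(\<Sum>x\<in>{1..p}. c (int x - int k)) = (\<Sum>x\<in>{1..p}. c (int x))"
proof (induction k)
  case (Suc k)
  have "periodic (\<lambda>j. c (j - int (Suc k)))"
    using periodic_shift[OF assms, of "- int (Suc k)"] by (simp only: diff_conv_add_uminus)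
  from sum_periodic_Suc[OF this] show ?case using Suc by (simp add: algebra_simps)
qed simp

lemma wt_append: "wt (u @ v) c = wt u c + wt v (\<lambda>j. c (j + int (length u)))"
  by (induction u arbitrary: c) (simp_all add: add_ac)

lemma wt_eq_0: "count w = 0 \<Longrightarrow> wt w c = 0"
  by (induction w arbitrary: c) (auto split: if_splits)

lemma wt_const: "wt w (\<lambda>_. k) = k * int (count w)"
  by (induction w) (auto simp: algebra_simps)

lemma wt_replicate: "wt (replicate n True) c = (\<Sum>i<n. c (int i))"
proof (induction n arbitrary: c)
  case (Suc n)
  then show ?case unfolding sum.lessThan_Suc_shift by (simp add: add.commute)
qed simp

text \<open>A letter \<open>b\<close> of \<open>w\<close> yields a \<open>b\<close> in the section
  at \<open>x\<close> exactly if \<open>x\<close> has been moved to \<open>p\<close> by then, that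
  is, if \<open>x\<close> plus the number of earlier letters \<open>a\<close> is divisible by
  \<open>p\<close>. Its position in the section is the number of earlier letters \<open>b\<close>.
  So position \<open>j\<close> there corresponds to position \<open>j - x\<close> in
  \<open>w\<close> modulo \<open>p\<close>, and each \<open>b\<close> of \<open>w\<close> is counted
  at exactly one \<open>x\<close>.\<close>

lemma wt_sec:
  assumes "periodic c"
  shows "(\<Sum>x\<in>{1..p}. wt (sec w x) (\<lambda>j. c (j - int x))) = wt w c"
  using assms
proof (induction w arbitrary: c)
  case (Cons l w)
  note IH = Cons.IH[OF periodic_shift[OF Cons.prems, of 1]]
  show ?case
  proof (cases l)
    case True
    have "(\<Sum>x\<in>{1..p}. wt (sec (l # w) x) (\<lambda>j. c (j - int x))) =
        (\<Sum>x\<in>{1..p}. (if x = p then c (- int x) else 0) + wt (sec w x) (\<lambda>j. c (j - int x + 1)))"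
      by (intro sum.cong) (auto simp: True algebra_simps)
    also have "\<dots> = c (- int p) + wt w (\<lambda>j. c (j + 1))"
      using three_le IH by (simp add: sum.distrib)
    also have "c (- int p) = c 0" using periodicD[OF Cons.prems, of "- int p"] by simp
    finally show ?thesis using True by simp
  next
    case False
    have bij: "bij_betw next_letter {1..p} {1..p}"
    proof (rule bij_betw_imageI)
      show inj: "inj_on next_letter {1..p}" by (auto simp: inj_on_def next_letter_def split: if_splits)
      show "next_letter ` {1..p} = {1..p}"
        using next_letter_in inj by (intro endo_inj_surj) auto
    qed
    have "wt w (\<lambda>j. c (j + 1)) = (\<Sum>x\<in>{1..p}. wt (sec w x) (\<lambda>j. c (j - int x + 1)))"
      using IH by simp
    also have "\<dots> = (\<Sum>x\<in>{1..p}. wt (sec w (next_letter x)) (\<lambda>j. c (j - int (next_letter x) + 1)))"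
      by (rule sum.reindex_bij_betw[OF bij, symmetric])
    also have "\<dots> = (\<Sum>x\<in>{1..p}. wt (sec (l # w) x) (\<lambda>j. c (j - int x)))"
    proof (rule sum.cong[OF refl])
      fix x assume "x \<in> {1..p}"
      have "c (j - int (next_letter x) + 1) = c (j - int x)" for j
        using periodicD[OF Cons.prems, of "j - int p"] by (simp add: next_letter_def)
      then show "wt (sec w (next_letter x)) (\<lambda>j. c (j - int (next_letter x) + 1)) =
          wt (sec (l # w) x) (\<lambda>j. c (j - int x))"
        using False by simp
    qed
    finally show ?thesis using False by simp
  qed
qed simp

lemma sum_count_sec: "(\<Sum>x\<in>{1..p}. count (sec w x)) = count w"
proof -
  have "(\<Sum>x\<in>{1..p}. int (count (sec w x))) = int (count w)"
    using wt_sec[of "\<lambda>_. 1" w] by (simp add: wt_const periodic_def)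
  then show ?thesis by (simp flip: of_nat_sum)
qed

lemma sec_replicate: "sec (replicate n True) x = replicate n (x = p)"
  by (induction n) simp_all

text \<open>The section of \<open>b^n\<close> at 1 is \<open>a^n\<close>, since 1 differs from
  \<open>p\<close>.\<close>

lemma dvd_if_replicate_trivial:
  assumes "fold ev (replicate n True) = id"
  shows "p dvd n"
proof -
  have 1: "1 \<in> {1..p}" using three_le by simp
  have "fold ev (replicate n False) = id"
    using fold_eq_id(2)[OF assms 1] three_le by (simp add: sec_replicate)
  from fold_eq_id(1)[OF this 1] show ?thesis
    using fold_step_eq_iff[OF 1, of "replicate n False"] by simp
qed

text \<open>All sections have length \<open>count w\<close>, and their numbers of letters
  \<open>b\<close> add up to \<open>count w\<close>. If none of them takes all, induction applies to
  each, and \<open>wt_sec\<close> sums up the results. Otherwise one section is a pure power of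
  \<open>b\<close>, its exponent is a multiple of \<open>p\<close>, and its positions run through
  full periods of \<open>c\<close>. There the sum of \<open>c\<close> over a period has to
  vanish.\<close>

lemma fold_trivial:
  assumes "fold ev w = id"
  shows "p dvd length w \<and>
    (\<forall>c. periodic c \<longrightarrow> (\<Sum>x\<in>{1..p}. c (int x)) = 0 \<longrightarrow> wt w c = 0)"
  using assms
proof (induction "count w" arbitrary: w rule: less_induct)
  case (less w)
  have "1 \<in> {1..p}" using three_le by simp
  then have co: "p dvd cocount w"
    using fold_eq_id(1)[OF less.prems] fold_step_eq_iff by blast
  have triv: "fold ev (sec w x) = id" if "x \<in> {1..p}" for x
    using fold_eq_id(2)[OF less.prems that] .
  have shift: "periodic (\<lambda>j. c (j - int x))" "(\<Sum>j\<in>{1..p}. c (int j - int x)) = 0"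
    if "periodic c" "(\<Sum>x\<in>{1..p}. c (int x)) = 0" for c x
    using periodic_shift[OF that(1), of "- int x"] sum_periodic_shift[OF that(1)] that(2) by simp_all
  show ?case
  proof (cases "\<exists>x\<in>{1..p}. count (sec w x) = count w")
    case True
    then obtain x where x: "x \<in> {1..p}" "count (sec w x) = count w" by blast
    have "\<forall>l\<in>set (sec w x). l"
      using x(2) length_sec[of w x] length_filter_less[of _ "sec w x" "\<lambda>l. l"] by fastforce
    then have rep: "sec w x = replicate (count w) True"
      using length_sec[of w x] by (intro replicate_eqI) auto
    then have dvd: "p dvd count w"
      using triv[OF x(1)] dvd_if_replicate_trivial by simp
    have "wt w c = 0" if c: "periodic c" "(\<Sum>x\<in>{1..p}. c (int x)) = 0" for c
    proof -
      have "(\<Sum>y\<in>{1..p}. count (sec w y)) = count (sec w x) + (\<Sum>y\<in>{1..p} - {x}. count (sec w y))"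
        using x(1) by (simp add: sum.remove)
      then have "count (sec w y) = 0" if "y \<in> {1..p} - {x}" for y
        using sum_count_sec[of w] x(2) that by simp
      then have "wt w c = wt (sec w x) (\<lambda>j. c (j - int x))"
        using wt_sec[OF c(1), of w] x(1) wt_eq_0 by (simp add: sum.remove[of _ x])
      also have "\<dots> = 0"
        unfolding rep
      proof -
        let ?c = "\<lambda>j. c (j - int x)"
        note c' = shift[OF c, of x]
        obtain q where "count w = p * q" using dvd by (rule dvdE)
        moreover have "wt (replicate (p * q) True) ?c = 0"
        proof (induction q)
          case (Suc q)
          have "{..<p} = {0..<p}" "{1..p} = {Suc 0..<Suc p}" by auto
          then have "(\<Sum>i<p. ?c (int i)) = (\<Sum>i\<in>{1..p}. ?c (int i - int 1))"
            by (simp only: sum.shift_bounds_Suc_ivl) simp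
          then have "wt (replicate p True) ?c = 0"
            unfolding wt_replicate using sum_periodic_shift[OF c'(1), of 1] c'(2) by simp
          moreover have "replicate (p * Suc q) True = replicate (p * q) True @ replicate p True"
            by (simp add: replicate_add[symmetric] add.commute)
          ultimately show ?case
            using Suc periodic_multiple[OF c'(1), of "p * q"] by (simp add: wt_append)
        qed simp
        ultimately show "wt (replicate (count w) True) ?c = 0" by simp
      qed
      finally show ?thesis .
    qed
    then show ?thesis using dvd co count_plus_cocount[of w] by (metis dvd_add)
  next
    case False
    have "count (sec w x) < count w" if "x \<in> {1..p}" for x
      using False that length_filter_le[of "\<lambda>l. l" "sec w x"] length_sec[of w x] by fastforce
    note IH = less.hyps[OF this triv]
    have "p dvd count w"
      using IH[of 1] three_le length_sec[of w 1] by simp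
    moreover have "wt w c = 0" if "periodic c" "(\<Sum>x\<in>{1..p}. c (int x)) = 0" for c
    proof -
      have "(\<Sum>x\<in>{1..p}. wt (sec w x) (\<lambda>j. c (j - int x))) = 0"
        using IH shift[OF that] by (intro sum.neutral) blast
      then show ?thesis using wt_sec[OF that(1)] by simp
    qed
    ultimately show ?thesis using co count_plus_cocount[of w] by (metis dvd_add)
  qed
qed

text \<open>A full turn for \<open>a\<close>. The sections of \<open>b^p\<close> are
  \<open>a^p\<close> and, at the place \<open>p\<close>, \<open>b^p\<close> again, which is settled
  by induction on the vertex.\<close>

lemma fold_replicate_p: "fold ev (replicate p l) = id"
proof -
  have a: "fold ev (replicate p False) (x # v) = x # v" if "x \<in> {1..p}" "v \<in> vertices p" for x v
  proof -
    have "sec (replicate n False) x = []" for n by (induction n arbitrary: x) simp_all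
    moreover have "fold step (replicate p False) x = x" 
      using fold_step_eq_iff[OF that(1), of "replicate p False"] by simp
    ultimately show ?thesis using fold_Cons[OF that, of "replicate p False"] by simp
  qed
  have "fold ev (replicate p l) v = v" if "v \<in> vertices p" for v l
    using that
  proof (induction v arbitrary: l)
    case Nil
    then show ?case using fold_Aut[of "replicate p l"] by (simp add: Aut_tree_iff)
  next
    case (Cons x v)
    then have x: "x \<in> {1..p}" "v \<in> vertices p" by simp_all
    have "fold step (replicate p True) x = x" 
      using fold_step_eq_iff[OF x(1), of "replicate p True"] by simp
    then show ?case
      using a[OF x] fold_Cons[OF x, of "replicate p True"] Cons.IH[OF x(2)] sec_replicate
      by (cases l) simp_all
  qed
  then show ?thesis by (intro Aut_tree_eqI[OF fold_Aut id_Aut_tree]) simp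
qed

lemma fold_replicate_finv: "fold ev (replicate (p - 1) l) = finv (ev l)"
proof -
  have "replicate p l = l # replicate (p - 1) l" using three_le by (cases p) auto
  then have id: "fold ev (replicate (p - 1) l) \<circ> ev l = id" using fold_replicate_p[of l] by simp
  have "fold ev (replicate (p - 1) l) (ev l (finv (ev l) v)) = finv (ev l) v" for v
    using fun_cong[OF id, of "finv (ev l) v"] by simp
  then show ?thesis using Aut_tree_finv_cancel(1)[OF ev_Aut] by (auto simp: fun_eq_iff)
qed

lemma ev_generators: "{a, b} \<subseteq> range ev" "range ev \<subseteq> generate (Aut_tree p) {a, b}"
proof -
  have "a = ev False" "b = ev True" by (simp_all add: ev_def)
  then show "{a, b} \<subseteq> range ev" by blast
  show "range ev \<subseteq> generate (Aut_tree p) {a, b}" by (auto simp: ev_def intro: generate.incl)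
qed

section \<open>The subgroup \<open>H\<close> and its characters\<close>

abbreviation G :: "(nat list \<Rightarrow> nat list) set"
  where "G \<equiv> generate (Aut_tree p) {a, b}"

lemma G_eq: "G = range (fold ev)" and inverse_word: "\<exists>v. fold ev v = finv (fold ev u)"
  using generate_eq_range_fold[OF ev_generators] fold_replicate_finv by blast+

lemma subgroup_G: "subgroup G (Aut_tree p)"
  by (rule group.generate_is_subgroup[OF group_Aut_tree]) (use a_Aut b_Aut in simp)

lemma a_in_G: "a \<in> G" and b_in_G: "b \<in> G"
  by (auto intro: generate.incl)

text \<open>By \<open>fold_trivial\<close> the length modulo \<open>p\<close> depends only on the
  automorphism. Words in \<open>W\<close> shift the positions of later letters by a multiple of
  \<open>p\<close>, so that \<open>wt\<close> with periodic coefficients is additive on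
  \<open>W\<close>.\<close>

definition W :: "bool list set" where "W = {w. p dvd length w}"

abbreviation H :: "(nat list \<Rightarrow> nat list) set"
  where "H \<equiv> fold ev ` W"

lemma length_inverse_word: "fold ev v = finv (fold ev u) \<Longrightarrow> p dvd length u + length v"
  using fold_trivial[of "u @ v"] Aut_tree_finv_cancel(4)[OF fold_Aut, of u] by (simp add: fold_append)

lemma W_inverse: "u \<in> W \<Longrightarrow> \<exists>v\<in>W. fold ev v = finv (fold ev u)"
proof -
  assume u: "u \<in> W"
  obtain v where v: "fold ev v = finv (fold ev u)" using inverse_word by blast
  then have "v \<in> W" using u length_inverse_word[OF v] by (simp add: W_def dvd_add_right_iff)
  then show ?thesis using v by blast
qed

lemma subgroup_H: "subgroup H (Aut_tree p)"
  by (rule subgroup_fold[OF _ _ W_inverse]) (auto simp: W_def)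

lemma H_normal:
  assumes "g \<in> G" "h \<in> H"
  shows "g \<circ> h \<circ> finv g \<in> H"
proof -
  obtain u w where uw: "g = fold ev u" "h = fold ev w" "w \<in> W" using assms G_eq by auto
  obtain v where v: "fold ev v = finv (fold ev u)" using inverse_word by blast
  have "fold ev (v @ w @ u) = g \<circ> h \<circ> finv g" using uw v by (simp only: fold_append o_assoc)
  moreover have "length (v @ w @ u) = (length u + length v) + length w" by simp
  then have "v @ w @ u \<in> W"
    using length_inverse_word[OF v] uw(3) unfolding W_def by (metis dvd_add mem_Collect_eq)
  ultimately show ?thesis by (metis imageI)
qed

lemma has_character_H:
  assumes "subgroup P (Aut_tree p)" "P \<subseteq> H" "P \<noteq> {id}"
  shows "has_character P"
proof -
  \<comment> \<open>The coefficients have sum zero over a period and are all congruent to -1 modulo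
    \<open>p\<close>. So \<open>wt w c\<close> is congruent to minus the number of letters
    \<open>b\<close>. If it vanishes for a word in \<open>W\<close>, then this number and the number
    of letters \<open>a\<close> are divisible by \<open>p\<close>: the word fixes the first level,
    and its sections are in \<open>W\<close> again.\<close>
  define c where "c j = (if int p dvd j then int p - 1 else - 1)" for j :: int
  have c: "periodic c" by (simp add: periodic_def c_def)
  have "(\<Sum>x\<in>{1..p}. c (int x)) = (\<Sum>x\<in>{1..p}. if x = p then int p - 1 else - 1)"
  proof (rule sum.cong[OF refl])
    fix x assume x: "x \<in> {1..p}"
    then have "p dvd x \<longleftrightarrow> x = p" using dvd_imp_le[of p x] by auto
    then show "c (int x) = (if x = p then int p - 1 else - 1)" by (simp add: c_def)
  qed
  also have "\<dots> = (\<Sum>x\<in>{1..p}. (if x = p then int p else 0) - 1)"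
    by (intro sum.cong) auto
  also have "\<dots> = 0" using three_le by (simp add: sum_subtractf)
  finally have zero: "(\<Sum>x\<in>{1..p}. c (int x)) = 0" .
  have dvd: "int p dvd wt w c' + int (count w)" if "\<forall>j. int p dvd c' j + 1" for w c'
    using that
  proof (induction w arbitrary: c')
    case (Cons l w)
    have "int p dvd wt w (\<lambda>j. c' (j + 1)) + int (count w)" using Cons by simp
    moreover have "int p dvd c' 0 + 1" using Cons.prems by blast
    ultimately have "int p dvd (c' 0 + 1) + (wt w (\<lambda>j. c' (j + 1)) + int (count w))"
      by (rule dvd_add[rotated])
    then show ?case
      using \<open>int p dvd wt w (\<lambda>j. c' (j + 1)) + int (count w)\<close> by (simp add: algebra_simps)
  qed simp
  show ?thesis
  proof (rule has_character_words[of W "\<lambda>w. wt w c", OF _ W_inverse _ _ assms])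
    show "u @ v \<in> W \<and> wt (u @ v) c = wt u c + wt v c" if "u \<in> W" "v \<in> W" for u v
      using that periodic_multiple[OF c, of "length u"] by (simp add: W_def wt_append)
    show "wt u c = 0" if "fold ev u = id" for u
      using fold_trivial[OF that] c zero by blast
    fix u x assume u: "u \<in> W" "wt u c = 0" and x: "x \<in> {1..p}"
    have "int p dvd int (count u)" using dvd[of c u] u(2) by (simp add: c_def)
    then have "p dvd count u" by simp
    moreover from this have "p dvd cocount u"
      using u(1) count_plus_cocount[of u] by (metis W_def dvd_add_right_iff mem_Collect_eq)
    ultimately show "fold step u x = x \<and> sec u x \<in> W"
      using fold_step_eq_iff[OF x] length_sec by (simp add: W_def)
  qed
qed

section \<open>The normal closure \<open>K\<close> of \<open>y\<close> and branching over its
  commutators\<close>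

definition y :: "nat list \<Rightarrow> nat list" where "y = finv a \<circ> b"

definition K :: "(nat list \<Rightarrow> nat list) set"
  where "K = generate (Aut_tree p) {z \<circ> y \<circ> finv z | z. z \<in> G}"

lemma K_generators: "{z \<circ> y \<circ> finv z | z. z \<in> G} \<subseteq> H"
proof -
  \<comment> \<open>The inverse of \<open>a\<close> is written as the power \<open>p - 1\<close> of
    \<open>a\<close>, which gives a word of length \<open>p\<close>.\<close>
  have "y = fold ev (True # replicate (p - 1) False)"
    unfolding fold.simps fold_replicate_finv by (simp add: y_def ev_def)
  moreover have "True # replicate (p - 1) False \<in> W" using three_le by (simp add: W_def)
  ultimately have "y \<in> H" by (rule image_eqI)
  then show ?thesis using H_normal by blast
qed

lemma subgroup_K: "subgroup K (Aut_tree p)"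
  unfolding K_def
  by (rule group.generate_is_subgroup[OF group_Aut_tree
        subset_trans[OF K_generators subgroup.subset[OF subgroup_H]]])

lemma K_subset_H: "K \<subseteq> H"
  unfolding K_def by (rule group.generate_subgroup_incl[OF group_Aut_tree K_generators subgroup_H])

lemma K_normal:
  assumes g: "g \<in> G" and k: "k \<in> K"
  shows "g \<circ> k \<circ> finv g \<in> K"
proof -
  note GD = subgroup_Aut_treeD[OF subgroup_G] and KD = subgroup_Aut_treeD[OF subgroup_K]
  note gA = GD(1)[OF g]
  define N where "N = {k \<in> carrier (Aut_tree p). g \<circ> k \<circ> finv g \<in> K}"
  have "subgroup N (Aut_tree p)"
  proof (rule subgroup_Aut_treeI)
    show "N \<subseteq> carrier (Aut_tree p)" by (auto simp: N_def)
    show "id \<in> N"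
      using id_Aut_tree KD(2) Aut_tree_finv_cancel(3)[OF gA] by (simp only: N_def mem_Collect_eq comp_id)
  next
    fix k l assume kl: "k \<in> N" "l \<in> N"
    then have "(g \<circ> k \<circ> finv g) \<circ> (g \<circ> l \<circ> finv g) \<in> K" 
      by (intro KD(3)[of "g \<circ> k \<circ> finv g"]) (simp_all only: N_def mem_Collect_eq)
    moreover have "(g \<circ> k \<circ> finv g) \<circ> (g \<circ> l \<circ> finv g) = g \<circ> (k \<circ> l) \<circ> finv g"
      using Aut_tree_finv_cancel(2)[OF gA] by (simp add: fun_eq_iff)
    moreover have "k \<circ> l \<in> carrier (Aut_tree p)"
      using kl by (intro Aut_tree_comp) (simp_all only: N_def mem_Collect_eq)
    ultimately show "k \<circ> l \<in> N" by (simp only: N_def mem_Collect_eq)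
  next
    fix k assume "k \<in> N"
    then have kA: "k \<in> carrier (Aut_tree p)" and "finv (g \<circ> k \<circ> finv g) \<in> K"
      using KD(4) by (simp_all only: N_def mem_Collect_eq)
    moreover have "finv (g \<circ> k \<circ> finv g) = g \<circ> finv k \<circ> finv g"
      using Aut_tree_finv_comp[OF Aut_tree_comp[OF gA kA] inv_fun_Aut_tree[OF gA]]
        Aut_tree_finv_comp[OF gA kA] Aut_tree_finv_cancel(5)[OF gA] by (simp only: o_assoc)
    ultimately show "finv k \<in> N" using inv_fun_Aut_tree[OF kA] by (simp only: N_def mem_Collect_eq)
  qed
  moreover have "{z \<circ> y \<circ> finv z | z. z \<in> G} \<subseteq> N"
  proof
    fix k assume k: "k \<in> {z \<circ> y \<circ> finv z | z. z \<in> G}"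
    then obtain z where z: "z \<in> G" "k = z \<circ> y \<circ> finv z" by blast
    have "g \<circ> k \<circ> finv g = (g \<circ> z) \<circ> y \<circ> finv (g \<circ> z)"
      using Aut_tree_finv_comp[OF gA GD(1)[OF z(1)]] z(2) by (simp only: o_assoc)
    moreover have "(g \<circ> z) \<circ> y \<circ> finv (g \<circ> z) \<in> K"
      unfolding K_def using GD(3)[OF g z(1)] by (intro generate.incl) blast
    moreover have "k \<in> carrier (Aut_tree p)"
      by (rule subgroup_Aut_treeD(1)[OF subgroup_H subsetD[OF K_generators k]])
    ultimately show "k \<in> N" by (simp only: N_def mem_Collect_eq)
  qed
  ultimately have "K \<subseteq> N"
    unfolding K_def by (intro group.generate_subgroup_incl[OF group_Aut_tree])
  then show ?thesis using k by (auto simp only: N_def)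
qed

lemma y_in_K: "y \<in> K"
proof -
  note GD = subgroup_Aut_treeD[OF subgroup_G]
  have "y = id \<circ> y \<circ> finv id" by simp
  then show ?thesis unfolding K_def using GD(2) by (intro generate.incl) blast
qed

lemma level1_conj_a:
  assumes "level1 p f F"
  shows "level1 p (a \<circ> f \<circ> finv a) (\<lambda>j. F (if j = 1 then p else j - 1))"
  unfolding level1_def
proof (intro conjI ballI)
  note fD = level1D[OF assms]
  show "a \<circ> f \<circ> finv a \<in> carrier (Aut_tree p)"
    by (intro Aut_tree_comp inv_fun_Aut_tree a_Aut fD)
  fix j assume "j \<in> {1..p}"
  moreover define i where "i = (if j = 1 then p else j - 1)"
  ultimately have i: "i \<in> {1..p}" "next_letter i = j" using three_le by (auto simp: next_letter_def)
  show "F (if j = 1 then p else j - 1) \<in> carrier (Aut_tree p)"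
    using fD(2)[OF i(1)] by (simp add: i_def)
  fix v assume v: "v \<in> vertices p"
  then have "F i v \<in> vertices p" using fD(2)[OF i(1)] by simp
  then have "(a \<circ> f \<circ> finv a) (j # v) = j # F i v"
    using finv_a_Cons[OF i(1) v] fD(3)[OF i(1) v] a_Cons[OF i(1)] i(2) by simp
  then show "(a \<circ> f \<circ> finv a) (j # v) = j # F (if j = 1 then p else j - 1) v"
    by (simp add: i_def)
qed

lemma level1_b: "level1 p b (\<lambda>j. if j = p then b else a)"
  using a_Aut b_Aut b_Cons by (auto simp: level1_def)

text \<open>Conjugation by \<open>a\<close> moves the section \<open>b\<close> of \<open>b\<close>
  from the place \<open>p\<close> to 1 and then to 2, with \<open>a\<close> at all other
  places.\<close>

definition b1 :: "nat list \<Rightarrow> nat list" where "b1 = a \<circ> b \<circ> finv a"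
definition b2 :: "nat list \<Rightarrow> nat list" where "b2 = a \<circ> b1 \<circ> finv a"

lemma level1_cong:
  "level1 p f F \<Longrightarrow> (\<And>j. j \<in> {1..p} \<Longrightarrow> F j = F' j) \<Longrightarrow> level1 p f F'"
  by (simp add: level1_def)

lemma level1_b1: "level1 p b1 (\<lambda>j. if j = 1 then b else a)"
  unfolding b1_def by (rule level1_cong[OF level1_conj_a[OF level1_b]]) auto

lemma level1_b2: "level1 p b2 (\<lambda>j. if j = 2 then b else a)"
  unfolding b2_def by (rule level1_cong[OF level1_conj_a[OF level1_b1]]) (use three_le in auto)

lemma G_subset_coord: "G \<subseteq> coord p G p {}"
proof -
  note GD = subgroup_Aut_treeD[OF subgroup_G]
  have p: "p \<in> {1..p}" "p \<noteq> 1" using three_le by auto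
  have "b1 \<in> G" unfolding b1_def by (intro GD(3,4) a_in_G b_in_G)
  from coordI[OF this level1_b1, where i = p and k = a and J = "{}"]
    coordI[OF b_in_G level1_b, where i = p and k = b and J = "{}"] have "{a, b} \<subseteq> coord p G p {}"
    using p(2) by simp
  then show ?thesis using subset_coord_if_generators[OF subgroup_G p(1)] by blast
qed

text \<open>Conjugating one element of \<open>K\<close> with section \<open>y\<close> at
  \<open>p\<close> by elements of \<open>G\<close> with prescribed section at \<open>p\<close>
  yields all generators of \<open>K\<close> there. Trivial sections stay trivial.\<close>

lemma K_subset_coord:
  assumes y: "y \<in> coord p K p J" and J: "J \<subseteq> {1..p}"
  shows "K \<subseteq> coord p K p J"
proof -
  have p: "p \<in> {1..p}" using three_le by simp
  obtain f F where f: "f \<in> K" "level1 p f F" "F p = y" "\<forall>j\<in>J. F j = id"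
    using y by (rule coordE)
  have "{z \<circ> y \<circ> finv z | z. z \<in> G} \<subseteq> coord p K p J"
  proof
    fix k assume "k \<in> {z \<circ> y \<circ> finv z | z. z \<in> G}"
    then obtain z where z: "z \<in> G" "k = z \<circ> y \<circ> finv z" by blast
    then have "z \<in> coord p G p {}" using G_subset_coord by blast
    then obtain g F' where g: "g \<in> G" "level1 p g F'" "F' p = z" by (rule coordE)
    show "k \<in> coord p K p J"
    proof (rule coordI)
      show "g \<circ> f \<circ> finv g \<in> K" using K_normal g(1) f(1) by blast
      show "level1 p (g \<circ> f \<circ> finv g) (\<lambda>j. F' j \<circ> F j \<circ> finv (F' j))"
        by (intro level1_comp level1_finv f g)
      show "F' j \<circ> F j \<circ> finv (F' j) = id" if "j \<in> J" for j
      proof -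
        have "F j = id" "F' j \<in> carrier (Aut_tree p)" using that J f(4) level1D(2)[OF g(2)] by blast+
        then show ?thesis by simp
      qed
    qed (simp add: z g f)
  qed
  from subset_coord_if_generators[OF subgroup_K p this, folded K_def] show ?thesis by blast
qed

text \<open>The quotients of \<open>b\<close> by \<open>b1\<close> and \<open>b2\<close> have
  section \<open>y\<close> at \<open>p\<close> and trivial sections elsewhere, except at 1 and at 2,
  respectively. As 1, 2 and \<open>p\<close> are distinct, the two exceptional sets share only
  \<open>p\<close>, which is what \<open>place_commutator\<close> requires.\<close>

lemma K_coord: "K \<subseteq> coord p K p ({1..p} - {1, p})" "K \<subseteq> coord p K p ({1..p} - {2, p})"
proof -
  note KD = subgroup_Aut_treeD[OF subgroup_K]
  note A = a_Aut b_Aut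
  have b1A: "b1 \<in> carrier (Aut_tree p)" and b2A: "b2 \<in> carrier (Aut_tree p)"
    using level1D(1)[OF level1_b1] level1D(1)[OF level1_b2] by simp_all
  have finv_b1: "finv b1 v = a (finv b (finv a v))" for v
    using A by (intro finv_eqI[OF b1A]) (simp add: b1_def)
  have finv_b2: "finv b2 v = a (finv b1 (finv a v))" for v
    using A b1A by (intro finv_eqI[OF b2A]) (simp add: b2_def)
  have y_apply: "y v = finv a (b v)" for v by (simp add: y_def)
  have finv_y: "finv y v = finv b (a v)" for v
    using A y_in_K KD(1) by (intro finv_eqI) (auto simp: y_apply)
  have "finv b1 \<circ> b = (a \<circ> finv y \<circ> finv a) \<circ> y"
    using A by (simp add: fun_eq_iff finv_b1 finv_y y_apply)
  moreover have "(a \<circ> finv y \<circ> finv a) \<circ> y \<in> K"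
    by (intro KD(3) K_normal a_in_G KD(4) y_in_K)
  ultimately have 1: "finv b1 \<circ> b \<in> K" by (simp only:)
  \<comment> \<open>The second quotient is the product of the conjugate of the first by
    \<open>a\<close> with the first.\<close>
  have "finv b2 \<circ> b = (a \<circ> (finv b1 \<circ> b) \<circ> finv a) \<circ> (finv b1 \<circ> b)"
    using A b1A by (simp add: fun_eq_iff finv_b2 finv_b1)
  moreover have "(a \<circ> (finv b1 \<circ> b) \<circ> finv a) \<circ> (finv b1 \<circ> b) \<in> K"
    by (intro KD(3)[of "a \<circ> (finv b1 \<circ> b) \<circ> finv a"] K_normal a_in_G 1)
  ultimately have 2: "finv b2 \<circ> b \<in> K" by (simp only:)
  have "y \<in> coord p K p ({1..p} - {1, p})"
    by (rule coordI[OF 1 level1_comp[OF level1_finv[OF level1_b1] level1_b]])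
      (use three_le A in \<open>auto simp: y_def\<close>)
  then show "K \<subseteq> coord p K p ({1..p} - {1, p})" by (rule K_subset_coord) blast
  have "y \<in> coord p K p ({1..p} - {2, p})"
    by (rule coordI[OF 2 level1_comp[OF level1_finv[OF level1_b2] level1_b]])
      (use three_le A in \<open>auto simp: y_def\<close>)
  then show "K \<subseteq> coord p K p ({1..p} - {2, p})" by (rule K_subset_coord) blast
qed

lemma place_conj_a:
  assumes x: "x \<in> carrier (Aut_tree p)" and i: "i \<in> {1..p}"
  shows "place p (next_letter i) x = a \<circ> place p i x \<circ> finv a"
proof (rule level1_eqI[OF level1_place[OF x next_letter_in[OF i]] level1_conj_a[OF level1_place[OF x i]]])
  fix j assume "j \<in> {1..p}"
  then show "(if j = next_letter i then x else id) = (if (if j = 1 then p else j - 1) = i then x else id)"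
    using i by (auto simp: next_letter_def)
qed

lemma supported_in_H:
  assumes u: "u \<in> vertices p"
  shows "\<exists>x\<in>H. x \<noteq> id \<and> (\<forall>v\<in>vertices p. take (length u) v \<noteq> u \<longrightarrow> x v = v)"
proof -
  note KD = subgroup_Aut_treeD[OF subgroup_K]
  define D where "D = {commutator k l | k l. k \<in> K \<and> l \<in> K}"
  have DK: "D \<subseteq> K" using commutator_closed[OF subgroup_K] by (auto simp: D_def)
  have conj: "a \<circ> x \<circ> finv a \<in> D" if "x \<in> D" for x
  proof -
    from that obtain k l where kl: "k \<in> K" "l \<in> K" "x = commutator k l" unfolding D_def by blast
    have "a \<circ> x \<circ> finv a = commutator (a \<circ> k \<circ> finv a) (a \<circ> l \<circ> finv a)"
      using commutator_conj[OF inv_fun_Aut_tree[OF a_Aut] KD(1)[OF kl(1)] KD(1)[OF kl(2)]]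
        Aut_tree_finv_cancel(5)[OF a_Aut] kl(3) by (simp only:)
    then show ?thesis using K_normal[OF a_in_G] kl unfolding D_def by blast
  qed
  have place_p: "place p p x \<in> D" if "x \<in> D" for x
  proof -
    from that obtain k l where kl: "k \<in> K" "l \<in> K" "x = commutator k l" unfolding D_def by blast
    have k: "k \<in> coord p K p ({1..p} - {1, p})" and l: "l \<in> coord p K p ({1..p} - {2, p})"
      using K_coord kl by blast+
    have p: "p \<in> {1..p}" "{1..p} \<subseteq> insert p (({1..p} - {1, p}) \<union> ({1..p} - {2, p}))"
      using three_le by auto
    obtain f g where "f \<in> K" "g \<in> K" "place p p (commutator k l) = commutator f g"
      by (rule place_commutator[OF subgroup_K subgroup_K p(1) k l p(2)])
    then show ?thesis using kl(3) unfolding D_def by blast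
  qed
  have step: "place p (next_letter i) x \<in> D" if "x \<in> D" "i \<in> {1..p}" "place p i x \<in> D" for x i
  proof -
    have x: "x \<in> carrier (Aut_tree p)" using that(1) DK KD(1) by blast
    show ?thesis unfolding place_conj_a[OF x that(2)] by (rule conj[OF that(3)])
  qed
  have place: "place p (Suc i) x \<in> D" if x: "x \<in> D" and "Suc i \<le> p" for x i
    using that(2)
  proof (induction i)
    case 0
    have "next_letter p = Suc 0" "p \<in> {1..p}" using three_le by (simp_all add: next_letter_def)
    then show ?case using step[OF x _ place_p[OF x]] by simp
  next
    case (Suc i)
    then have "Suc i \<in> {1..p}" "next_letter (Suc i) = Suc (Suc i)" "place p (Suc i) x \<in> D"
      by (auto simp: next_letter_def)
    then show ?case using step[OF x, of "Suc i"] by simp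
  qed
  have place: "place p i x \<in> D" if "x \<in> D" "i \<in> {1..p}" for x i
    using place[OF that(1), of "i - 1"] that(2) by simp
  \<comment> \<open>\<open>K\<close> is not commutative: the two products of \<open>y\<close> and
    its conjugate \<open>y'\<close> differ at the vertex \<open>[2, 1]\<close>.\<close>
  define y' where "y' = a \<circ> y \<circ> finv a"
  have y': "y' \<in> K" unfolding y'_def by (intro K_normal a_in_G y_in_K)
  have y'_eq: "y' v = b (finv a v)" for v
    using a_Aut by (simp add: y'_def y_def)
  have nil: "a [] = []" "b [] = []" using a_Aut b_Aut by (simp_all add: Aut_tree_iff)
  have range: "1 \<in> {1..p}" "2 \<in> {1..p}" "3 \<in> {1..p}" "p \<in> {1..p}" using three_le by auto
  have nl: "next_letter 1 = 2" "next_letter 2 = 3" "next_letter p = 1" "1 \<noteq> p" "2 \<noteq> p"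
    using three_le by (auto simp: next_letter_def)
  have a12: "a [1] = [2]" "a [2] = [3]"
    using a_Cons[of 1 "[]"] a_Cons[of 2 "[]"] range nl by (simp_all del: One_nat_def)
  have V: "[1] \<in> vertices p" "[2] \<in> vertices p" "[3] \<in> vertices p" using range by simp_all
  have y'1: "y' [2, 1] = [1, 2]"
    using finv_a_Cons[OF range(1) V(1)] b_Cons[OF range(1) V(1)] nl a12
    by (simp add: y'_eq del: One_nat_def)
  have "y [1, 2] = [p, 3]"
    using b_Cons[OF range(1) V(2)] finv_a_Cons[OF range(4) V(3)] nl a12
    by (simp add: y_def del: One_nat_def)
  with y'1 have 1: "(y \<circ> y') [2, 1] = [p, 3]" by simp
  have y1: "y [2, 1] = [1, 2]"
    using b_Cons[OF range(2) V(1)] finv_a_Cons[OF range(1) V(2)] nl a12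
    by (simp add: y_def del: One_nat_def)
  have "b [2] = [2]" using b_Cons[OF range(2), of "[]"] nil nl by simp
  then have "y' [1, 2] = [p, 2]"
    using finv_a_Cons[OF range(4) V(2)] b_Cons[OF range(4) V(2)] nl
    by (simp add: y'_eq del: One_nat_def)
  with y1 have "(y' \<circ> y) [2, 1] = [p, 2]" by simp
  moreover have "[p, 3] \<noteq> [p, 2]" by simp
  ultimately have "y \<circ> y' \<noteq> y' \<circ> y" using 1 by metis
  then have "commutator y y' \<noteq> id"
    using commutator_eq_id_iff[OF KD(1)[OF y_in_K] KD(1)[OF y']] by blast
  moreover have "commutator y y' \<in> D" using y_in_K y' unfolding D_def by blast
  moreover have "D \<subseteq> carrier (Aut_tree p)" using DK KD(1) by blast
  ultimately have "\<exists>x\<in>D. x \<noteq> id \<and> (\<forall>v\<in>vertices p. take (length u) v \<noteq> u \<longrightarrow> x v = v)"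
    using place u by (intro exists_supported_below)
  then show ?thesis using DK K_subset_H by blast
qed

theorem left_engel_constant_ggs:
  "left_engel (subgroup_generated (Aut_tree p) {a, b}) = {\<one>\<^bsub>Aut_tree p\<^esub>}"
proof -
  have "{a, b} \<subseteq> carrier (Aut_tree p)" using a_Aut b_Aut by simp
  from subgroup_generated_Aut_tree[OF this] show ?thesis
  proof (rule ssubst)
    show "left_engel ((Aut_tree p)\<lparr>carrier := G\<rparr>) = {\<one>\<^bsub>Aut_tree p\<^esub>}"
      by (rule left_engel_trivial[OF subgroup_G subgroup_H _ H_normal has_character_H supported_in_H])
        (use G_eq in blast)
  qed
qed

end

theorem theorem3:
  shows
    "(\<forall>a b. basilica_generators a b \<longrightarrow>
        left_engel (subgroup_generated (Aut_tree 2) {a, b}) = {\<one>\<^bsub>Aut_tree 2\<^esub>}) \<and>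
     (\<forall>c d. bsv_generators c d \<longrightarrow>
        left_engel (subgroup_generated (Aut_tree 2) {c, d}) = {\<one>\<^bsub>Aut_tree 2\<^esub>}) \<and>
     (\<forall>p a b. prime p \<longrightarrow> odd p \<longrightarrow> ggs_constant_generators p a b \<longrightarrow>
        left_engel (subgroup_generated (Aut_tree p) {a, b}) = {\<one>\<^bsub>Aut_tree p\<^esub>})"
proof (intro conjI allI impI)
  show "left_engel (subgroup_generated (Aut_tree 2) {a, b}) = {\<one>\<^bsub>Aut_tree 2\<^esub>}"
    if "basilica_generators a b" for a b
    using that by (rule left_engel_basilica)
  show "left_engel (subgroup_generated (Aut_tree 2) {c, d}) = {\<one>\<^bsub>Aut_tree 2\<^esub>}"
    if "bsv_generators c d" for c d
    using that by (rule left_engel_bsv)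
  fix p :: nat and a b
  assume p: "prime p" "odd p" and ab: "ggs_constant_generators p a b"
  have "p \<noteq> 2" using p(2) by auto
  then have "3 \<le> p" using prime_ge_2_nat[OF p(1)] by linarith
  then interpret constant_ggs p a b
    using ab by (rule constant_ggs.intro)
  show "left_engel (subgroup_generated (Aut_tree p) {a, b}) = {\<one>\<^bsub>Aut_tree p\<^esub>}"
    by (rule left_engel_constant_ggs)
qed

end
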